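(* Every connected locally finite graph $G$ without thick ends has a canonical tree-decomposition which efficiently distinguishes all the tangles in $G$.
   Context: Graphs may be infinite; a graph is locally finite if every vertex has finitely many neighbours. An end of $G$ is an equivalence class of rays, two rays being equivalent if no finite vertex set separates them; an end is thick if it contains infinitely many pairwise disjoint rays. A separation of $G$ is an unordered pair $\{A,B\}$ of subsets of $V(G)$ with $A\cup B=V(G)$ such that no edge of $G$ joins $A\setminus B$ to $B\setminus A$; its order is $|A\cap B|$. Its two orientations are the ordered pairs $(A,B)$ and $(B,A)$ (oriented separations), partially ordered by $(A,B)\le (C,D)$ iff $A\subseteq C$ and $B\supseteq D$. A set $O$ of oriented separations is consistent if there are no $(A,B),(C,D)\in O$ with $\{A,B\}\neq\{C,D\}$ and $(B,A)\le (C,D)$. A pre-tangle in $G$ is a set $P$ for which there is $k\in\mathbb N\cup\{\aleph_0\}$ such that $P$ contains exactly one orientation of each separation of $G$ of order less than $k$ (and nothing else) and $P$ is consistent. A tangle is a pre-tangle $P$ such that for any three (not necessarily distinct) $(A_1,B_1),(A_2,B_2),(A_3,B_3)\in P$ we have $G[A_1]\cup G[A_2]\cup G[A_3]\neq G$. A separation distinguishes two tangles if each contains an orientation of it but they contain different orientations; it does so efficiently if it has minimum order among all separations distinguishing them. Two tangles are distinguishable if some separation distinguishes them. A tree-decomposition $(T,\mathcal V)$ efficiently distinguishes all tangles of $G$ if for every two distinguishable tangles there is a separation of $G$ induced by an edge of $T$ (in the usual way) that efficiently distinguishes them. It is canonical if it is invariant under the automorphisms of $G$, i.e. the automorphism group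 of $G$ acts naturally on it. *)

theory Defs
  imports Main "HOL-Library.Extended_Nat"
begin

definition graph :: "'a set \<Rightarrow> ('a \<Rightarrow> 'a \<Rightarrow> bool) \<Rightarrow> bool" where
  "graph V E \<longleftrightarrow> (\<forall>u v. E u v \<longrightarrow> u \<in> V \<and> v \<in> V \<and> u \<noteq> v \<and> E v u)"

definition locally_finite :: "'a set \<Rightarrow> ('a \<Rightarrow> 'a \<Rightarrow> bool) \<Rightarrow> bool" where
  "locally_finite V E \<longleftrightarrow> (\<forall>v\<in>V. finite {u. E v u})"

definition gpath :: "('a \<Rightarrow> 'a \<Rightarrow> bool) \<Rightarrow> 'a list \<Rightarrow> bool" where
  "gpath E p \<longleftrightarrow> p \<noteq> [] \<and> distinct p \<and> (\<forall>i. Suc i < length p \<longrightarrow> E (p ! i) (p ! Suc i))"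

definition tpath :: "('a \<Rightarrow> 'a \<Rightarrow> bool) \<Rightarrow> 'a \<Rightarrow> 'a \<Rightarrow> 'a list \<Rightarrow> bool" where
  "tpath E x y p \<longleftrightarrow> gpath E p \<and> hd p = x \<and> last p = y"

definition connected_graph :: "'a set \<Rightarrow> ('a \<Rightarrow> 'a \<Rightarrow> bool) \<Rightarrow> bool" where
  "connected_graph V E \<longleftrightarrow> V \<noteq> {} \<and>
     (\<forall>x\<in>V. \<forall>y\<in>V. \<exists>p. tpath E x y p \<and> set p \<subseteq> V)"

definition ray :: "'a set \<Rightarrow> ('a \<Rightarrow> 'a \<Rightarrow> bool) \<Rightarrow> (nat \<Rightarrow> 'a) \<Rightarrow> bool" where
  "ray V E R \<longleftrightarrow> inj R \<and> (\<forall>n. R n \<in> V) \<and> (\<forall>n. E (R n) (R (Suc n)))"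

definition rays_equiv :: "'a set \<Rightarrow> ('a \<Rightarrow> 'a \<Rightarrow> bool) \<Rightarrow> (nat \<Rightarrow> 'a) \<Rightarrow> (nat \<Rightarrow> 'a) \<Rightarrow> bool" where
  "rays_equiv V E R1 R2 \<longleftrightarrow> (\<forall>S. finite S \<longrightarrow>
     (\<exists>m n p. (\<forall>i\<ge>m. R1 i \<notin> S) \<and> (\<forall>i\<ge>n. R2 i \<notin> S) \<and>
              tpath E (R1 m) (R2 n) p \<and> set p \<subseteq> V - S))"

definition ends :: "'a set \<Rightarrow> ('a \<Rightarrow> 'a \<Rightarrow> bool) \<Rightarrow> (nat \<Rightarrow> 'a) set set" where
  "ends V E = {{R'. ray V E R' \<and> rays_equiv V E R R'} | R. ray V E R}"

definition thick_end :: "(nat \<Rightarrow> 'a) set \<Rightarrow> bool" where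
  "thick_end \<epsilon> \<longleftrightarrow> (\<exists>Rs :: nat \<Rightarrow> nat \<Rightarrow> 'a. (\<forall>i. Rs i \<in> \<epsilon>) \<and>
      (\<forall>i j. i \<noteq> j \<longrightarrow> range (Rs i) \<inter> range (Rs j) = {}))"

definition separation :: "'a set \<Rightarrow> ('a \<Rightarrow> 'a \<Rightarrow> bool) \<Rightarrow> 'a set \<Rightarrow> 'a set \<Rightarrow> bool" where
  "separation V E A B \<longleftrightarrow> A \<subseteq> V \<and> B \<subseteq> V \<and> A \<union> B = V \<and>
     (\<forall>u v. E u v \<and> u \<in> A - B \<longrightarrow> v \<notin> B - A)"

definition sep_order :: "'a set \<Rightarrow> 'a set \<Rightarrow> enat" where
  "sep_order A B = (if finite (A \<inter> B) then enat (card (A \<inter> B)) else \<infinity>)"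

definition osep_le :: "'a set \<times> 'a set \<Rightarrow> 'a set \<times> 'a set \<Rightarrow> bool" where
  "osep_le s t \<longleftrightarrow> fst s \<subseteq> fst t \<and> snd t \<subseteq> snd s"

definition consistent :: "('a set \<times> 'a set) set \<Rightarrow> bool" where
  "consistent Os \<longleftrightarrow> \<not> (\<exists>A B C D. (A, B) \<in> Os \<and> (C, D) \<in> Os \<and> {A, B} \<noteq> {C, D} \<and>
                           osep_le (B, A) (C, D))"

definition pre_tangle :: "'a set \<Rightarrow> ('a \<Rightarrow> 'a \<Rightarrow> bool) \<Rightarrow> ('a set \<times> 'a set) set \<Rightarrow> bool" where
  "pre_tangle V E P \<longleftrightarrow> (\<exists>k :: enat.
     (\<forall>A B. separation V E A B \<and> sep_order A B < k \<longrightarrow>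
        card (P \<inter> {(A, B), (B, A)}) = 1) \<and>
     (\<forall>A B. (A, B) \<in> P \<longrightarrow> separation V E A B \<and> sep_order A B < k) \<and>
     consistent P)"

text \<open>G[A1] \<union> G[A2] \<union> G[A3] = G\<close>
definition covers3 :: "'a set \<Rightarrow> ('a \<Rightarrow> 'a \<Rightarrow> bool) \<Rightarrow> 'a set \<Rightarrow> 'a set \<Rightarrow> 'a set \<Rightarrow> bool" where
  "covers3 V E A1 A2 A3 \<longleftrightarrow> A1 \<union> A2 \<union> A3 = V \<and>
     (\<forall>u v. E u v \<longrightarrow> (u \<in> A1 \<and> v \<in> A1) \<or> (u \<in> A2 \<and> v \<in> A2) \<or> (u \<in> A3 \<and> v \<in> A3))"

definition tangle :: "'a set \<Rightarrow> ('a \<Rightarrow> 'a \<Rightarrow> bool) \<Rightarrow> ('a set \<times> 'a set) set \<Rightarrow> bool" where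
  "tangle V E P \<longleftrightarrow> pre_tangle V E P \<and>
     (\<forall>A1 B1 A2 B2 A3 B3. (A1, B1) \<in> P \<and> (A2, B2) \<in> P \<and> (A3, B3) \<in> P \<longrightarrow>
        \<not> covers3 V E A1 A2 A3)"

definition distinguishes :: "'a set \<Rightarrow> ('a \<Rightarrow> 'a \<Rightarrow> bool) \<Rightarrow> ('a set \<times> 'a set) set \<Rightarrow>
    ('a set \<times> 'a set) set \<Rightarrow> 'a set \<Rightarrow> 'a set \<Rightarrow> bool" where
  "distinguishes V E P1 P2 A B \<longleftrightarrow> separation V E A B \<and>
     P1 \<inter> {(A, B), (B, A)} \<noteq> {} \<and> P2 \<inter> {(A, B), (B, A)} \<noteq> {} \<and>
     P1 \<inter> {(A, B), (B, A)} \<noteq> P2 \<inter> {(A, B), (B, A)}"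

definition eff_distinguishes :: "'a set \<Rightarrow> ('a \<Rightarrow> 'a \<Rightarrow> bool) \<Rightarrow> ('a set \<times> 'a set) set \<Rightarrow>
    ('a set \<times> 'a set) set \<Rightarrow> 'a set \<Rightarrow> 'a set \<Rightarrow> bool" where
  "eff_distinguishes V E P1 P2 A B \<longleftrightarrow> distinguishes V E P1 P2 A B \<and>
     (\<forall>C D. distinguishes V E P1 P2 C D \<longrightarrow> sep_order A B \<le> sep_order C D)"

definition is_tree :: "'t set \<Rightarrow> ('t \<Rightarrow> 't \<Rightarrow> bool) \<Rightarrow> bool" where
  "is_tree TV TE \<longleftrightarrow> TV \<noteq> {} \<and> graph TV TE \<and> (\<forall>x\<in>TV. \<forall>y\<in>TV. \<exists>!p. tpath TE x y p)"

definition tree_path :: "('t \<Rightarrow> 't \<Rightarrow> bool) \<Rightarrow> 't \<Rightarrow> 't \<Rightarrow> 't list" where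
  "tree_path TE x y = (THE p. tpath TE x y p)"

definition tree_decomp :: "'a set \<Rightarrow> ('a \<Rightarrow> 'a \<Rightarrow> bool) \<Rightarrow> 't set \<Rightarrow> ('t \<Rightarrow> 't \<Rightarrow> bool) \<Rightarrow>
    ('t \<Rightarrow> 'a set) \<Rightarrow> bool" where
  "tree_decomp V E TV TE bags \<longleftrightarrow> is_tree TV TE \<and>
     (\<forall>t\<in>TV. bags t \<subseteq> V) \<and> (\<Union>t\<in>TV. bags t) = V \<and>
     (\<forall>u v. E u v \<longrightarrow> (\<exists>t\<in>TV. u \<in> bags t \<and> v \<in> bags t)) \<and>
     (\<forall>t1\<in>TV. \<forall>t3\<in>TV. \<forall>t2\<in>set (tree_path TE t1 t3). bags t1 \<inter> bags t3 \<subseteq> bags t2)"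

text \<open>The component of T - t1t2 containing t1.\<close>
definition tree_side :: "'t set \<Rightarrow> ('t \<Rightarrow> 't \<Rightarrow> bool) \<Rightarrow> 't \<Rightarrow> 't \<Rightarrow> 't set" where
  "tree_side TV TE t1 t2 = {t \<in> TV. t2 \<notin> set (tree_path TE t1 t)}"

definition induced_sep :: "'t set \<Rightarrow> ('t \<Rightarrow> 't \<Rightarrow> bool) \<Rightarrow> ('t \<Rightarrow> 'a set) \<Rightarrow> 't \<Rightarrow> 't \<Rightarrow>
    'a set \<times> 'a set" where
  "induced_sep TV TE bags t1 t2 =
     ((\<Union>t\<in>tree_side TV TE t1 t2. bags t), (\<Union>t\<in>tree_side TV TE t2 t1. bags t))"

definition eff_distinguishes_all_tangles :: "'a set \<Rightarrow> ('a \<Rightarrow> 'a \<Rightarrow> bool) \<Rightarrow> 't set \<Rightarrow>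
    ('t \<Rightarrow> 't \<Rightarrow> bool) \<Rightarrow> ('t \<Rightarrow> 'a set) \<Rightarrow> bool" where
  "eff_distinguishes_all_tangles V E TV TE bags \<longleftrightarrow>
     (\<forall>P1 P2. tangle V E P1 \<and> tangle V E P2 \<and> (\<exists>A B. distinguishes V E P1 P2 A B) \<longrightarrow>
        (\<exists>t1 t2. TE t1 t2 \<and>
           eff_distinguishes V E P1 P2 (fst (induced_sep TV TE bags t1 t2))
                                       (snd (induced_sep TV TE bags t1 t2))))"

definition graph_aut :: "'a set \<Rightarrow> ('a \<Rightarrow> 'a \<Rightarrow> bool) \<Rightarrow> ('a \<Rightarrow> 'a) \<Rightarrow> bool" where
  "graph_aut V E \<phi> \<longleftrightarrow> bij_betw \<phi> V V \<and> (\<forall>x. x \<notin> V \<longrightarrow> \<phi> x = x) \<and>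
     (\<forall>u\<in>V. \<forall>v\<in>V. E u v \<longleftrightarrow> E (\<phi> u) (\<phi> v))"

definition canonical_td :: "'a set \<Rightarrow> ('a \<Rightarrow> 'a \<Rightarrow> bool) \<Rightarrow> 't set \<Rightarrow> ('t \<Rightarrow> 't \<Rightarrow> bool) \<Rightarrow>
    ('t \<Rightarrow> 'a set) \<Rightarrow> bool" where
  "canonical_td V E TV TE bags \<longleftrightarrow> (\<exists>\<alpha> :: ('a \<Rightarrow> 'a) \<Rightarrow> ('t \<Rightarrow> 't).
     (\<forall>\<phi>. graph_aut V E \<phi> \<longrightarrow> graph_aut TV TE (\<alpha> \<phi>) \<and>
                                  (\<forall>t\<in>TV. bags (\<alpha> \<phi> t) = \<phi> ` bags t)) \<and>
     (\<forall>\<phi> \<psi>. graph_aut V E \<phi> \<and> graph_aut V E \<psi> \<longrightarrow> \<alpha> (\<phi> \<circ> \<psi>) = \<alpha> \<phi> \<circ> \<alpha> \<psi>))"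

end

theory Submission
  imports Defs
begin

text \<open>
  Call a separation relevant if it efficiently distinguishes two tangles. In a locally finite
  connected graph a separation of finite order crosses only finitely many relevant separations of
  order at most k, because each side of a relevant separation contains a component of the rest that
  is adjacent to the whole separator. Going through the orders k one after the other and taking, for
  every pair of tangles, the relevant separations that are nested with all those chosen at lower
  orders and that cross as few relevant separations of order k as possible, yields by submodularity
  a nested set N; no choice is involved, so N is invariant under automorphisms.

  Let W be the separator of the supremum (A, B) of a strictly increasing sequence in N. If W is
  infinite, no separation of order k can have more than k vertices of W strictly on both sides,
  since the elements of the sequence are linked to the tangles they distinguish; so W converges to
  an end which is not cut off by boundedly many vertices, and Menger's theorem produces infinitely
  many disjoint rays in it. If W is finite and not empty, then late elements of the sequence either
  can be replaced by a separation of smaller order or have separator W, which is impossible.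
  Hence W is empty and B is empty. Therefore intervals of N are finite, the consistent orientations
  of N generated by its elements form a tree, and the intersections of the sides they point to
  cover the graph.
\<close>

section \<open>Menger's theorem\<close>

text \<open>Finiteness of crossing alone makes all crossing numbers finite and yields a nested set
  \<open>N\<close> in every connected locally finite graph. It does not yield a tree: the orders in
  \<open>N\<close> may be unbounded, and a strictly increasing sequence in \<open>N\<close> with
  growing separators could stay below another member, so that no finite path would join the
  corresponding nodes. The absence of thick ends is used exactly here, to make the limit separator W
  finite.

  Relevance, and not merely finite order, matters twice: the component attached to the whole
  separator is what makes crossing finite, and the minimality of the order is what links the
  separator to a tangle, so that few vertices cannot split a limit separator.

  Keeping all minimisers instead of one makes the construction canonical, at the price that two best
  choices for the same pair of tangles have to be nested too. Nodes are sets of oriented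
  separations, so an automorphism acts on them by taking images, and compatibility with composition
  is immediate.\<close>

definition avoid :: "('a \<times> 'a) set \<Rightarrow> 'a set \<Rightarrow> ('a \<times> 'a) set" where
  "avoid F S = {(u, v) \<in> F. u \<notin> S \<and> v \<notin> S}"

text \<open>\<open>S\<close> may meet \<open>A\<close> and \<open>B\<close>. A vertex of
  \<open>A \<inter> B\<close> outside \<open>S\<close> is a violation by itself, since the closure
  is reflexive.\<close>

definition separates :: "('a \<times> 'a) set \<Rightarrow> 'a set \<Rightarrow> 'a set \<Rightarrow> 'a set \<Rightarrow> bool" where
  "separates F A B S \<longleftrightarrow> (\<forall>a\<in>A - S. \<forall>b\<in>B - S. (a, b) \<notin> (avoid F S)\<^sup>*)"

text \<open>A system of disjoint paths from all of A to all of B, recorded as the set M of its edges;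
  the two reachability conditions exclude cycles.\<close>

definition linkage :: "('a \<times> 'a) set \<Rightarrow> 'a set \<Rightarrow> 'a set \<Rightarrow> bool" where
  "linkage M A B \<longleftrightarrow> single_valued M \<and> single_valued (M\<inverse>) \<and> Domain M \<union> B = Range M \<union> A \<and>
     Domain M \<inter> B = {} \<and> Range M \<inter> A = {} \<and> Range M \<union> A \<subseteq> M\<^sup>* `` A \<and>
     (\<forall>v\<in>Range M \<union> A. \<exists>b\<in>B. (v, b) \<in> M\<^sup>*)"

lemma avoid_mono: "F \<subseteq> G \<Longrightarrow> S \<subseteq> T \<Longrightarrow> avoid F T \<subseteq> avoid G S"
  by (auto simp: avoid_def)

lemma separates_antimono: "F \<subseteq> G \<Longrightarrow> separates G A B S \<Longrightarrow> separates F A B S"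
  unfolding separates_def using rtrancl_mono[OF avoid_mono[of F G S S]] by blast

lemma separatesD:
  "separates F A B S \<Longrightarrow> a \<in> A \<Longrightarrow> a \<notin> S \<Longrightarrow> b \<in> B \<Longrightarrow> b \<notin> S \<Longrightarrow> (a, b) \<in> R\<^sup>* \<Longrightarrow> R \<subseteq> avoid F S \<Longrightarrow> False"
  unfolding separates_def using rtrancl_mono[of R "avoid F S"] by blast

lemma linkage_from: "linkage M A B \<Longrightarrow> v \<in> Range M \<union> A \<Longrightarrow> \<exists>a\<in>A. (a, v) \<in> M\<^sup>*"
  unfolding linkage_def by blast

lemma linkage_to: "linkage M A B \<Longrightarrow> v \<in> Range M \<union> A \<Longrightarrow> \<exists>b\<in>B. (v, b) \<in> M\<^sup>*"
  unfolding linkage_def by blast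

lemma rtrancl_avoid_source:
  "(a, v) \<in> M\<^sup>* \<Longrightarrow> Domain M \<inter> S = {} \<Longrightarrow> v \<notin> S \<Longrightarrow> a \<notin> S \<and> (a, v) \<in> (avoid M S)\<^sup>*"
  by (induction rule: converse_rtrancl_induct)
    (auto simp: avoid_def intro: converse_rtrancl_into_rtrancl)

lemma rtrancl_avoid_target:
  "(v, b) \<in> M\<^sup>* \<Longrightarrow> Range M \<inter> S = {} \<Longrightarrow> v \<notin> S \<Longrightarrow> b \<notin> S \<and> (v, b) \<in> (avoid M S)\<^sup>*"
  by (induction rule: rtrancl_induct)
    (auto simp: avoid_def intro: rtrancl_into_rtrancl)

lemma rtrancl_avoid_notin: "(a, b) \<in> (avoid F S)\<^sup>* \<Longrightarrow> a \<notin> S \<longleftrightarrow> b \<notin> S"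
  by (induction rule: rtrancl_induct) (auto simp: avoid_def)

lemma rtrancl_first_hit:
  "(a, b) \<in> R\<^sup>* \<Longrightarrow> b \<in> P \<Longrightarrow> \<exists>c\<in>P. (a, c) \<in> {(u, v) \<in> R. u \<notin> P}\<^sup>* \<and> (c, b) \<in> R\<^sup>*"
proof (induction rule: converse_rtrancl_induct)
  case (step y z)
  then obtain c where c: "c \<in> P" "(z, c) \<in> {(u, v) \<in> R. u \<notin> P}\<^sup>*" "(c, b) \<in> R\<^sup>*" by blast
  show ?case
  proof (cases "y \<in> P")
    case True
    then show ?thesis using step by (meson converse_rtrancl_into_rtrancl rtrancl.rtrancl_refl)
  next
    case False
    then have "(y, c) \<in> {(u, v) \<in> R. u \<notin> P}\<^sup>*"
      using c step by (auto intro: converse_rtrancl_into_rtrancl)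
    then show ?thesis using c by blast
  qed
qed auto

lemma rtrancl_last_hit:
  "(a, b) \<in> R\<^sup>* \<Longrightarrow> a \<in> Q \<Longrightarrow> \<exists>c\<in>Q. (c, b) \<in> {(u, v) \<in> R. v \<notin> Q}\<^sup>*"
proof (induction rule: rtrancl_induct)
  case (step y z)
  then obtain c where c: "c \<in> Q" "(c, y) \<in> {(u, v) \<in> R. v \<notin> Q}\<^sup>*" by blast
  show ?case
  proof (cases "z \<in> Q")
    case False
    then have "(c, z) \<in> {(u, v) \<in> R. v \<notin> Q}\<^sup>*"
      using c step by (auto intro: rtrancl_into_rtrancl)
    then show ?thesis using c by blast
  qed auto
qed auto

lemma rtrancl_avoid_or_hit:
  "(a, b) \<in> R\<^sup>* \<Longrightarrow> (a \<notin> P \<and> b \<notin> P \<and> (a, b) \<in> (avoid R P)\<^sup>*) \<or> (\<exists>c\<in>P. (a, c) \<in> R\<^sup>* \<and> (c, b) \<in> R\<^sup>*)"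
proof (induction rule: rtrancl_induct)
  case (step y z)
  show ?case
  proof (cases "z \<in> P")
    case True
    then show ?thesis using step by (meson rtrancl.rtrancl_into_rtrancl rtrancl.rtrancl_refl)
  next
    case False
    then show ?thesis using step
      by (auto simp: avoid_def intro: rtrancl_into_rtrancl)
  qed
qed (cases "a \<in> P", auto)

lemma rtrancl_finite_subset: "(a, b) \<in> F\<^sup>* \<Longrightarrow> \<exists>F0. finite F0 \<and> F0 \<subseteq> F \<and> (a, b) \<in> F0\<^sup>*"
proof (induction rule: rtrancl_induct)
  case (step y z)
  then obtain F0 where F0: "finite F0" "F0 \<subseteq> F" "(a, y) \<in> F0\<^sup>*" by blast
  then have "(a, y) \<in> (insert (y, z) F0)\<^sup>*" by (meson rtrancl_mono subset_iff subset_insertI)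
  then have "(a, z) \<in> (insert (y, z) F0)\<^sup>*" by (meson insertI1 rtrancl.rtrancl_into_rtrancl)
  then show ?case using F0 step(2) by (intro exI[of _ "insert (y, z) F0"]) auto
qed auto

text \<open>The two linkages can meet only in \<open>S\<close>: a common vertex outside
  \<open>S\<close> would give a walk from \<open>A\<close> to \<open>B\<close> that misses
  \<open>S\<close>. So at each vertex of \<open>S\<close> a path of \<open>M1\<close> ends and a
  path of \<open>M2\<close> begins, and the edge from x to y joins the two paths left over.\<close>

lemma linkage_combine:
  assumes l1: "linkage M1 A0 (insert x S)" and l2: "linkage M2 (insert y S) B0"
    and xy: "x \<notin> S" "y \<notin> S" "x \<noteq> y"
    and sub: "M1 \<subseteq> F" "M2 \<subseteq> F" "A0 \<subseteq> A" "B0 \<subseteq> B"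
    and sep: "separates F A B S"
  shows "linkage (insert (x, y) (M1 \<union> M2)) A0 B0"
proof -
  define D1 where "D1 = Range M1 \<union> A0"
  define D2 where "D2 = Range M2 \<union> insert y S"
  let ?M = "insert (x, y) (M1 \<union> M2)"
  note L1 = l1[unfolded linkage_def]
  note L2 = l2[unfolded linkage_def]
  have D1: "Domain M1 = D1 - insert x S" "Range M1 = D1 - A0" "A0 \<subseteq> D1" "insert x S \<subseteq> D1"
    using L1 by (auto simp: D1_def)
  have D2: "Domain M2 = D2 - B0" "Range M2 = D2 - insert y S" "B0 \<subseteq> D2" "insert y S \<subseteq> D2"
    using L2 by (auto simp: D2_def)
  have int: "D1 \<inter> D2 \<subseteq> S"
  proof (rule ccontr)
    assume "\<not> D1 \<inter> D2 \<subseteq> S"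
    then obtain v where v: "v \<in> D1" "v \<in> D2" "v \<notin> S" by auto
    obtain a where a: "a \<in> A0" "(a, v) \<in> M1\<^sup>*" using linkage_from[OF l1] v(1) unfolding D1_def by blast
    obtain b where b: "b \<in> B0" "(v, b) \<in> M2\<^sup>*" using linkage_to[OF l2] v(2) unfolding D2_def by blast
    have "a \<notin> S \<and> (a, v) \<in> (avoid M1 S)\<^sup>*" using a v D1 by (intro rtrancl_avoid_source) auto
    moreover have "b \<notin> S \<and> (v, b) \<in> (avoid M2 S)\<^sup>*" using b v D2 by (intro rtrancl_avoid_target) auto
    ultimately have "a \<notin> S" "b \<notin> S" "(a, b) \<in> (avoid F S)\<^sup>*"
      using rtrancl_mono[OF avoid_mono[OF sub(1), of S S]] rtrancl_mono[OF avoid_mono[OF sub(2), of S S]]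
      by (auto intro: rtrancl_trans)
    then show False using separatesD[OF sep] a(1) b(1) sub(3,4) by blast
  qed
  have yD1: "y \<notin> D1" and xD2: "x \<notin> D2" using int D1 D2 xy by auto
  have e1: "u \<in> D1 - insert x S \<and> w \<in> D1 - A0" if "(u, w) \<in> M1" for u w
    using that D1 by (metis DomainI RangeI)
  have e2: "u \<in> D2 - B0 \<and> w \<in> D2 - insert y S" if "(u, w) \<in> M2" for u w
    using that D2 by (metis DomainI RangeI)
  have sv1: "single_valued M1" "single_valued (M1\<inverse>)" "single_valued M2" "single_valued (M2\<inverse>)"
    using L1 L2 by auto
  have sv: "single_valued ?M"
  proof (rule single_valuedI)
    fix u w w' assume "(u, w) \<in> ?M" "(u, w') \<in> ?M"
    then show "w = w'"
      using e1[of u w] e1[of u w'] e2[of u w] e2[of u w'] int xD2 sv1(1,3)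
        single_valuedD[of M1 u w w'] single_valuedD[of M2 u w w'] by blast
  qed
  have svc: "single_valued (?M\<inverse>)"
  proof (rule single_valuedI)
    fix u w w' assume "(u, w) \<in> ?M\<inverse>" "(u, w') \<in> ?M\<inverse>"
    then have "(w, u) \<in> ?M" "(w', u) \<in> ?M" by auto
    then show "w = w'"
      using e1[of w u] e1[of w' u] e2[of w u] e2[of w' u] int yD1 sv1(2,4)
        single_valuedD[of "M1\<inverse>" u w w'] single_valuedD[of "M2\<inverse>" u w w'] by blast
  qed
  have dom: "Domain ?M \<union> B0 = D1 \<union> D2" and ran: "Range ?M \<union> A0 = D1 \<union> D2"
    using D1 D2 unfolding Domain_insert Range_insert Domain_Un_eq Range_Un_eq by auto
  have d0: "Domain ?M \<inter> B0 = {}" "Range ?M \<inter> A0 = {}"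
    using D1 D2 int yD1 xD2 xy unfolding Domain_insert Range_insert Domain_Un_eq Range_Un_eq by auto
  have m1: "M1\<^sup>* \<subseteq> ?M\<^sup>*" and m2: "M2\<^sup>* \<subseteq> ?M\<^sup>*" by (auto intro!: rtrancl_mono)
  have r1: "D1 \<subseteq> ?M\<^sup>* `` A0" using linkage_from[OF l1] m1 unfolding D1_def by blast
  have rQ: "insert y S \<subseteq> ?M\<^sup>* `` A0"
  proof -
    have "x \<in> ?M\<^sup>* `` A0" "S \<subseteq> ?M\<^sup>* `` A0" using r1 D1 by auto
    then show ?thesis by (auto intro: rtrancl_into_rtrancl)
  qed
  have r2: "D2 \<subseteq> ?M\<^sup>* `` A0"
  proof
    fix v assume "v \<in> D2"
    then obtain q where "q \<in> insert y S" "(q, v) \<in> M2\<^sup>*"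
      using linkage_from[OF l2] unfolding D2_def by blast
    then obtain a where "a \<in> A0" "(a, q) \<in> ?M\<^sup>*" "(q, v) \<in> ?M\<^sup>*" using rQ m2 by blast
    then show "v \<in> ?M\<^sup>* `` A0" by (meson ImageI rtrancl_trans)
  qed
  have s2: "\<exists>b\<in>B0. (v, b) \<in> ?M\<^sup>*" if "v \<in> D2" for v using linkage_to[OF l2] that m2 unfolding D2_def by blast
  have s1: "\<exists>b\<in>B0. (v, b) \<in> ?M\<^sup>*" if vD: "v \<in> D1" for v
  proof -
    obtain p where p: "p \<in> insert x S" "(v, p) \<in> ?M\<^sup>*"
      using linkage_to[OF l1, of v] vD subsetD[OF m1] unfolding D1_def by blast
    have "\<exists>q\<in>D2. (p, q) \<in> ?M\<^sup>*" using p D2 by auto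
    then show ?thesis using s2 p by (meson rtrancl_trans)
  qed
  have "D1 \<union> D2 \<subseteq> ?M\<^sup>* `` A0" "\<forall>v\<in>D1 \<union> D2. \<exists>b\<in>B0. (v, b) \<in> ?M\<^sup>*" using r1 r2 s1 s2 by auto
  then show ?thesis unfolding linkage_def ran dom using sv svc d0 by simp
qed

text \<open>Induction on the number of edges, following Goering: if deleting an edge xy creates a
  separator S of size k - 1, link A to S + x and S + y to B in the smaller graph.\<close>

lemma Menger_finite:
  assumes "finite F" "\<And>v. (v, v) \<notin> F" "\<And>S. finite S \<Longrightarrow> separates F A B S \<Longrightarrow> k \<le> card S"
  shows "\<exists>M A0 B0. M \<subseteq> F \<and> A0 \<subseteq> A \<and> B0 \<subseteq> B \<and> finite A0 \<and> finite B0 \<and> card A0 = k \<and> card B0 = k \<and>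
    linkage M A0 B0"
  using assms
proof (induction F arbitrary: A B rule: finite_induct)
  case empty
  \<comment> \<open>Without edges \<open>A \<inter> B\<close> itself is a separator, so it offers k
    trivial paths.\<close>
  have "\<exists>C\<subseteq>A \<inter> B. finite C \<and> card C = k"
  proof (cases "finite (A \<inter> B)")
    case True
    have "separates {} A B (A \<inter> B)" by (auto simp: separates_def avoid_def)
    then have "k \<le> card (A \<inter> B)" using empty True by blast
    then show ?thesis by (meson finite_subset obtain_subset_with_card_n True)
  qed (meson infinite_arbitrarily_large)
  then obtain C where "C \<subseteq> A \<inter> B" "finite C" "card C = k" by blast
  moreover have "linkage {} C C" by (auto simp: linkage_def)
  ultimately show ?case by (intro exI[of _ "{}"] exI[of _ C]) auto
next
  case (insert e F)
  obtain x y where e: "e = (x, y)" by fastforce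
  have xy: "x \<noteq> y" using insert.prems(1) e by auto
  show ?case
  proof (cases "\<forall>S. finite S \<longrightarrow> separates F A B S \<longrightarrow> k \<le> card S")
    case True
    with insert.IH[of A B] insert.prems(1) show ?thesis by (meson insertI2 subset_insertI2)
  next
    case False
    then obtain S where S: "finite S" "separates F A B S" "card S < k" by auto
    have sepP: "separates (insert e F) A B (insert z S)" if "z = x \<or> z = y" for z
    proof -
      have "avoid (insert e F) (insert z S) \<subseteq> avoid F S" using that by (auto simp: avoid_def e)
      then show ?thesis using separatesD[OF S(2)] unfolding separates_def by (metis DiffD1 DiffD2 insertI2)
    qed
    have kP: "k \<le> card (insert z S)" if "z = x \<or> z = y" for z
      using insert.prems(2)[OF _ sepP[OF that]] S(1) by simp
    have nx: "x \<notin> S" and ny: "y \<notin> S" using kP[of x] kP[of y] S by (auto simp: insert_absorb)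
    have kS: "card (insert x S) = k" "card (insert y S) = k" using kP[of x] kP[of y] S nx ny by auto
    \<comment> \<open>Such a \<open>T\<close> also separates \<open>A\<close> from \<open>B\<close>
      after the edge xy is restored: a walk from \<open>A\<close> to \<open>B\<close> must meet S +
      x, and until its first vertex there it cannot have used xy, which starts in x.
      \<open>A2\<close> is the mirror image with last vertices in S + y.\<close>
    have A1: "k \<le> card T" if T: "finite T" "separates F A (insert x S) T" for T
    proof -
      have "separates (insert e F) A B T"
        unfolding separates_def
      proof (intro ballI notI)
        fix a b assume ab: "a \<in> A - T" "b \<in> B - T" "(a, b) \<in> (avoid (insert e F) T)\<^sup>*"
        have "\<not> (a \<notin> insert x S \<and> b \<notin> insert x S \<and> (a, b) \<in> (avoid (avoid (insert e F) T) (insert x S))\<^sup>*)"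
          using separatesD[OF sepP[of x], of a b "avoid (avoid (insert e F) T) (insert x S)"] ab(1,2)
          by (auto simp: avoid_def)
        then obtain c where c: "c \<in> insert x S" "(a, c) \<in> (avoid (insert e F) T)\<^sup>*"
          using rtrancl_avoid_or_hit[OF ab(3), of "insert x S"] by blast
        from rtrancl_first_hit[OF c(2,1)] obtain d where d: "d \<in> insert x S"
          "(a, d) \<in> {(u, v) \<in> avoid (insert e F) T. u \<notin> insert x S}\<^sup>*" by blast
        have "{(u, v) \<in> avoid (insert e F) T. u \<notin> insert x S} \<subseteq> avoid F T"
          by (auto simp: avoid_def e)
        then have ad: "(a, d) \<in> (avoid F T)\<^sup>*" using d(2) rtrancl_mono by blast
        then have "d \<notin> T" using ab(1) rtrancl_avoid_notin by fastforce
        then show False using separatesD[OF T(2) _ _ d(1) _ ad] ab(1) by blast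
      qed
      then show ?thesis using insert.prems(2) T(1) by blast
    qed
    have A2: "k \<le> card T" if T: "finite T" "separates F (insert y S) B T" for T
    proof -
      have "separates (insert e F) A B T"
        unfolding separates_def
      proof (intro ballI notI)
        fix a b assume ab: "a \<in> A - T" "b \<in> B - T" "(a, b) \<in> (avoid (insert e F) T)\<^sup>*"
        have "\<not> (a \<notin> insert y S \<and> b \<notin> insert y S \<and> (a, b) \<in> (avoid (avoid (insert e F) T) (insert y S))\<^sup>*)"
          using separatesD[OF sepP[of y], of a b "avoid (avoid (insert e F) T) (insert y S)"] ab(1,2)
          by (auto simp: avoid_def)
        then obtain c where c: "c \<in> insert y S" "(c, b) \<in> (avoid (insert e F) T)\<^sup>*"
          using rtrancl_avoid_or_hit[OF ab(3), of "insert y S"] by blast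
        from rtrancl_last_hit[OF c(2,1)] obtain d where d: "d \<in> insert y S"
          "(d, b) \<in> {(u, v) \<in> avoid (insert e F) T. v \<notin> insert y S}\<^sup>*" by blast
        have "{(u, v) \<in> avoid (insert e F) T. v \<notin> insert y S} \<subseteq> avoid F T"
          by (auto simp: avoid_def e)
        then have ad: "(d, b) \<in> (avoid F T)\<^sup>*" using d(2) rtrancl_mono by blast
        then have "d \<notin> T" using ab(2) rtrancl_avoid_notin by fastforce
        then show False using separatesD[OF T(2) d(1) _ _ _ ad] ab(2) by blast
      qed
      then show ?thesis using insert.prems(2) T(1) by blast
    qed
    have irr: "\<And>v. (v, v) \<notin> F" using insert.prems(1) by blast
    have "\<exists>M A0 P. M \<subseteq> F \<and> A0 \<subseteq> A \<and> P \<subseteq> insert x S \<and> finite A0 \<and> finite P \<and> card A0 = k \<and>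
        card P = k \<and> linkage M A0 P"
      by (rule insert.IH[OF irr]) (rule A1)
    then obtain M1 A0 P where 1: "M1 \<subseteq> F" "A0 \<subseteq> A" "P \<subseteq> insert x S" "finite A0" "card A0 = k" "card P = k"
      "linkage M1 A0 P" by (elim exE conjE)
    have "\<exists>M Q B0. M \<subseteq> F \<and> Q \<subseteq> insert y S \<and> B0 \<subseteq> B \<and> finite Q \<and> finite B0 \<and> card Q = k \<and>
        card B0 = k \<and> linkage M Q B0"
      by (rule insert.IH[OF irr]) (rule A2)
    then obtain M2 Q B0 where 2: "M2 \<subseteq> F" "Q \<subseteq> insert y S" "B0 \<subseteq> B" "finite B0" "card Q = k" "card B0 = k"
      "linkage M2 Q B0" by (elim exE conjE)
    have "P = insert x S" "Q = insert y S"
      using card_subset_eq[of "insert x S" P] card_subset_eq[of "insert y S" Q] 1 2 kS S(1) by simp_all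
    then have "linkage (insert (x, y) (M1 \<union> M2)) A0 B0"
      using linkage_combine[of M1 A0 x S M2 y B0 F A B] 1 2 nx ny xy S(2) by simp
    then show ?thesis using 1 2 e
      by (intro exI[of _ "insert (x, y) (M1 \<union> M2)"] exI[of _ A0] exI[of _ B0]) auto
  qed
qed

lemma separates_insert:
  "separates F A B (insert v S) \<longleftrightarrow> separates (avoid F {v}) (A - {v}) (B - {v}) S"
proof -
  have "avoid F (insert v S) = avoid (avoid F {v}) S" by (auto simp: avoid_def)
  then show ?thesis unfolding separates_def by auto
qed

text \<open>Every separator meets a fixed finite walk from \<open>A\<close> to \<open>B\<close>. If
  each vertex of this walk failed for some finite part of \<open>F\<close>, the union of these parts
  with the walk would have no small separator at all. So one vertex v works for all finite parts;
  deleting v lowers k by one.\<close>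

lemma separates_compactness:
  assumes "\<And>F'. finite F' \<Longrightarrow> F' \<subseteq> F \<Longrightarrow> \<exists>S. finite S \<and> card S \<le> k \<and> separates F' A B S"
  shows "\<exists>S. finite S \<and> card S \<le> k \<and> separates F A B S"
  using assms
proof (induction k arbitrary: F A B)
  case 0
  have "separates F A B {}"
  proof (rule ccontr)
    assume "\<not> separates F A B {}"
    then obtain a b where ab: "a \<in> A" "b \<in> B" "(a, b) \<in> F\<^sup>*" by (auto simp: separates_def avoid_def)
    from rtrancl_finite_subset[OF ab(3)] obtain F0 where F0: "finite F0" "F0 \<subseteq> F" "(a, b) \<in> F0\<^sup>*" by blast
    have "separates F0 A B {}" using 0[OF F0(1,2)] by auto
    then show False using ab F0 by (auto simp: separates_def avoid_def)
  qed
  then show ?case by (intro exI[of _ "{}"]) auto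
next
  case (Suc k)
  show ?case
  proof (cases "separates F A B {}")
    case True
    then show ?thesis by (intro exI[of _ "{}"]) auto
  next
    case False
    then obtain a b where ab: "a \<in> A" "b \<in> B" "(a, b) \<in> F\<^sup>*" by (auto simp: separates_def avoid_def)
    from rtrancl_finite_subset[OF ab(3)] obtain F0 where F0: "finite F0" "F0 \<subseteq> F" "(a, b) \<in> F0\<^sup>*" by blast
    define U where "U = insert a (Field F0)"
    have finU: "finite U" using F0 by (simp add: U_def finite_Field)
    have hit: "S \<inter> U \<noteq> {}" if "separates F0 A B S" for S
    proof
      assume S: "S \<inter> U = {}"
      then have av: "avoid F0 S = F0" unfolding avoid_def U_def by (auto simp: Field_def)
      then have "b \<notin> S" using S F0(3) by (metis IntI UnI1 empty_iff insertI1 rtrancl_avoid_notin U_def)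
      then show False using that ab F0 S av unfolding separates_def U_def by auto
    qed
    have "\<exists>v\<in>U. \<forall>F'. finite F' \<and> F' \<subseteq> F \<longrightarrow> (\<exists>S. v \<in> S \<and> finite S \<and> card S \<le> Suc k \<and> separates F' A B S)"
    proof (rule ccontr)
      assume "\<not> ?thesis"
      then have "\<forall>v\<in>U. \<exists>F'. finite F' \<and> F' \<subseteq> F \<and> \<not> (\<exists>S. v \<in> S \<and> finite S \<and> card S \<le> Suc k \<and> separates F' A B S)"
        by blast
      then obtain g where g: "\<And>v. v \<in> U \<Longrightarrow> finite (g v) \<and> g v \<subseteq> F \<and> \<not> (\<exists>S. v \<in> S \<and> finite S \<and> card S \<le> Suc k \<and> separates (g v) A B S)"
        by metis
      have "finite (F0 \<union> (\<Union>v\<in>U. g v))" "F0 \<union> (\<Union>v\<in>U. g v) \<subseteq> F" using F0 g finU by auto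
      from Suc.prems[OF this]
      obtain S where S: "finite S" "card S \<le> Suc k" "separates (F0 \<union> (\<Union>v\<in>U. g v)) A B S" by blast
      have "separates F0 A B S" by (rule separates_antimono[OF _ S(3)]) auto
      then obtain v where v: "v \<in> U" "v \<in> S" using hit by blast
      have "separates (g v) A B S" by (rule separates_antimono[OF _ S(3)]) (use v in auto)
      then show False using g[OF v(1)] v S by blast
    qed
    then obtain v where v: "\<And>F'. finite F' \<Longrightarrow> F' \<subseteq> F \<Longrightarrow> \<exists>S. v \<in> S \<and> finite S \<and> card S \<le> Suc k \<and> separates F' A B S"
      by blast
    have "\<exists>S. finite S \<and> card S \<le> k \<and> separates (avoid F {v}) (A - {v}) (B - {v}) S"
    proof (rule Suc.IH)
      fix F' assume F': "finite F'" "F' \<subseteq> avoid F {v}"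
      then have "F' \<subseteq> F" by (auto simp: avoid_def)
      from v[OF F'(1) this] obtain S where S: "v \<in> S" "finite S" "card S \<le> Suc k" "separates F' A B S" by blast
      have "avoid F' {v} = F'" using F' by (auto simp: avoid_def)
      then have "separates F' (A - {v}) (B - {v}) (S - {v})"
        using S separates_insert[of F' A B v "S - {v}"] by (simp add: insert_absorb)
      moreover have "card (S - {v}) \<le> k" using S by simp
      ultimately show "\<exists>S. finite S \<and> card S \<le> k \<and> separates F' (A - {v}) (B - {v}) S" using S by blast
    qed
    then obtain S where S: "finite S" "card S \<le> k" "separates F A B (insert v S)"
      unfolding separates_insert[symmetric] by blast
    then show ?thesis by (intro exI[of _ "insert v S"]) (auto simp: card_insert_if)
  qed
qed

text \<open>By compactness some finite set of edges already has no separator with fewer than k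
  vertices, and the finite theorem applies there.\<close>

lemma Menger:
  assumes "\<And>v. (v, v) \<notin> F" "\<And>S. finite S \<Longrightarrow> separates F A B S \<Longrightarrow> k \<le> card S"
  shows "\<exists>M A0 B0. finite M \<and> M \<subseteq> F \<and> A0 \<subseteq> A \<and> B0 \<subseteq> B \<and> finite A0 \<and> finite B0 \<and>
    card A0 = k \<and> card B0 = k \<and> linkage M A0 B0"
proof -
  have "\<exists>F'. finite F' \<and> F' \<subseteq> F \<and> (\<forall>S. finite S \<longrightarrow> separates F' A B S \<longrightarrow> k \<le> card S)"
  proof (cases k)
    case (Suc j)
    show ?thesis
    proof (rule ccontr)
      assume n: "\<not> ?thesis"
      have "\<exists>S. finite S \<and> card S \<le> j \<and> separates F A B S"
      proof (rule separates_compactness)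
        fix F' assume "finite F'" "F' \<subseteq> F"
        then obtain S where "finite S" "separates F' A B S" "\<not> k \<le> card S" using n by blast
        then show "\<exists>S. finite S \<and> card S \<le> j \<and> separates F' A B S" using Suc by (intro exI[of _ S]) auto
      qed
      then obtain S where "finite S" "card S \<le> j" "separates F A B S" by blast
      then show False using assms(2)[of S] Suc by simp
    qed
  qed auto
  then obtain F' where F': "finite F'" "F' \<subseteq> F" "\<And>S. finite S \<Longrightarrow> separates F' A B S \<Longrightarrow> k \<le> card S" by blast
  have irr: "\<And>v. (v, v) \<notin> F'" using F'(2) assms(1) by blast
  have "\<exists>M A0 B0. M \<subseteq> F' \<and> A0 \<subseteq> A \<and> B0 \<subseteq> B \<and> finite A0 \<and> finite B0 \<and> card A0 = k \<and> card B0 = k \<and>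
      linkage M A0 B0"
    by (rule Menger_finite[OF F'(1) irr]) (rule F'(3))
  then obtain M A0 B0 where M: "M \<subseteq> F'" "A0 \<subseteq> A \<and> B0 \<subseteq> B \<and> finite A0 \<and> finite B0 \<and> card A0 = k \<and>
      card B0 = k \<and> linkage M A0 B0" by blast
  then have "finite M" "M \<subseteq> F" using F'(1,2) by (auto intro: finite_subset)
  then show ?thesis using M(2) by blast
qed

section \<open>Thick ends\<close>

lemma gpath_alt: "gpath E p \<longleftrightarrow> p \<noteq> [] \<and> distinct p \<and> successively E p"
  unfolding gpath_def successively_conv_nth by blast

section \<open>Connected locally finite graphs\<close>

locale lf_graph =
  fixes V :: "'a set" and E :: "'a \<Rightarrow> 'a \<Rightarrow> bool"
  assumes gr: "graph V E" and con: "connected_graph V E" and lf: "locally_finite V E"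
begin

definition ER :: "('a \<times> 'a) set" where "ER = {(u, v). E u v}"

definition nbrs :: "'a set \<Rightarrow> 'a set" where "nbrs X = {v. \<exists>x\<in>X. E x v}"

lemma E_sym: "E u v \<Longrightarrow> E v u" and E_V: "E u v \<Longrightarrow> u \<in> V" "E u v \<Longrightarrow> v \<in> V" and E_irrefl: "\<not> E v v"
  using gr unfolding graph_def by blast+

lemma V_nonempty: "V \<noteq> {}"
  using con unfolding connected_graph_def by blast

lemma finite_nbrs: "finite X \<Longrightarrow> X \<subseteq> V \<Longrightarrow> finite (nbrs X)"
proof -
  assume X: "finite X" "X \<subseteq> V"
  have "nbrs X = (\<Union>x\<in>X. {v. E x v})" by (auto simp: nbrs_def)
  then show ?thesis using X lf unfolding locally_finite_def by auto
qed

text \<open>The form in which connectedness is used: most contradictions below come from a part of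
  the graph that would be closed under adjacency.\<close>

lemma connected_closed:
  assumes "U \<noteq> {}" "U \<subseteq> V" "\<And>u v. u \<in> U \<Longrightarrow> E u v \<Longrightarrow> v \<in> U"
  shows "U = V"
proof (rule ccontr)
  assume "U \<noteq> V"
  then obtain x y where xy: "x \<in> U" "y \<in> V" "y \<notin> U" using assms(1,2) by blast
  then obtain p where p: "tpath E x y p" using con assms(2) unfolding connected_graph_def by blast
  have "i < length p \<Longrightarrow> p ! i \<in> U" for i
  proof (induction i)
    case 0
    then show ?case using p xy by (simp add: tpath_def hd_conv_nth)
  next
    case (Suc i)
    then show ?case using p assms(3)[of "p ! i"] by (simp add: tpath_def gpath_def)
  qed
  moreover have "p \<noteq> []" "p ! (length p - 1) = y"
    using p by (auto simp: tpath_def gpath_def last_conv_nth)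
  ultimately show False using xy(3) by (metis diff_less length_greater_0_conv less_numeral_extra(1))
qed

lemma rtrancl_tpath:
  "(x, y) \<in> R\<^sup>* \<Longrightarrow> R \<subseteq> ER \<Longrightarrow> \<exists>p. tpath E x y p \<and> set p \<subseteq> insert x (Range R)"
proof (induction rule: rtrancl_induct)
  case base
  show ?case by (intro exI[of _ "[x]"]) (auto simp: tpath_def gpath_def)
next
  case (step y z)
  then obtain p where p: "tpath E x y p" "set p \<subseteq> insert x (Range R)" by blast
  show ?case
  proof (cases "z \<in> set p")
    case True
    then obtain p1 p2 where "p = p1 @ z # p2" by (meson split_list)
    then show ?thesis using p
      by (intro exI[of _ "p1 @ [z]"]) (auto simp: tpath_def gpath_alt successively_append_iff hd_append)
  next
    case False
    have "E y z" using step by (auto simp: ER_def)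
    then show ?thesis using p False step(2)
      by (intro exI[of _ "p @ [z]"]) (auto simp: tpath_def gpath_alt successively_append_iff)
  qed
qed

lemma avoid_ER_V: "(u, v) \<in> (avoid ER S)\<^sup>* \<Longrightarrow> u \<in> V \<Longrightarrow> v \<in> V"
  by (induction rule: rtrancl_induct) (auto simp: avoid_def ER_def E_V)

lemma avoid_ER_sym: "(u, v) \<in> (avoid ER S)\<^sup>* \<Longrightarrow> (v, u) \<in> (avoid ER S)\<^sup>*"
  by (rule symD[OF sym_rtrancl]) (auto intro!: symI simp: avoid_def ER_def E_sym)

end

text \<open>For an injective successor map, the orbits of points without predecessor are injective
  and pairwise disjoint; they will be the rays.\<close>

lemma funpow_start_unique:
  assumes "inj_on f D" "f ` D \<subseteq> D" "s \<in> D - f ` D" "t \<in> D - f ` D" "(f ^^ i) s = (f ^^ j) t"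
  shows "i = j \<and> s = t"
  using assms(5)
proof (induction i arbitrary: j)
  have D: "(f ^^ n) s \<in> D" "(f ^^ n) t \<in> D" for n
    using assms(2-4) by (induction n) auto
  {
    case 0
    then show ?case using assms(3) D(2) by (cases j) auto
  next
    case (Suc i)
    show ?case
    proof (cases j)
      case 0
      then show ?thesis using Suc.prems assms(4) D(1)[of i] by auto
    next
      case j: (Suc j')
      then have "(f ^^ i) s = (f ^^ j') t" using Suc.prems assms(1) D by (auto dest: inj_onD)
      then show ?thesis using Suc.IH j by blast
    qed
  }
qed

text \<open>A direction assigns to each finite S a component of the graph minus S, coherently;
  it stands for an end. The last assumption says that no bounded number of vertices suffices
  to cut it off from arbitrary finite sets.\<close>

locale direction = lf_graph +
  fixes C :: "'a set \<Rightarrow> 'a set"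
  assumes C_sub: "finite S \<Longrightarrow> C S \<subseteq> V - S"
    and C_conn: "finite S \<Longrightarrow> u \<in> C S \<Longrightarrow> v \<in> C S \<Longrightarrow> (u, v) \<in> (avoid ER S)\<^sup>*"
    and C_closed: "finite S \<Longrightarrow> u \<in> C S \<Longrightarrow> E u v \<Longrightarrow> v \<notin> S \<Longrightarrow> v \<in> C S"
    and C_meet: "finite S \<Longrightarrow> finite T \<Longrightarrow> C S \<inter> C T \<noteq> {}"
    and C_unbounded: "\<exists>X\<subseteq>V. finite X \<and> (\<forall>S. finite S \<and> X \<inter> C S = {} \<longrightarrow> k < card S)"
begin

text \<open>\<open>C T\<close> is connected by walks that stay inside it and hence miss
  \<open>S\<close>, so starting from a common vertex of both components they never leave
  \<open>C S\<close>.\<close>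

lemma C_mono:
  assumes "finite S" "finite T" "S \<inter> C T = {}"
  shows "C T \<subseteq> C S"
proof
  fix u assume u: "u \<in> C T"
  obtain z where z: "z \<in> C S" "z \<in> C T" using C_meet assms by blast
  have "(z, u) \<in> (avoid ER T)\<^sup>*" using C_conn assms(2) z u by blast
  then have "u \<in> C T \<and> u \<in> C S"
  proof (induction rule: rtrancl_induct)
    case (step y w)
    then have "E y w" "w \<notin> T" by (auto simp: avoid_def ER_def)
    then show ?case using step C_closed assms by blast
  qed (use z in auto)
  then show "u \<in> C S" by blast
qed

lemma C_entry:
  assumes "finite S" "(x, z) \<in> R\<^sup>*" "R \<subseteq> ER" "x \<notin> C S" "z \<in> C S"
  shows "\<exists>c\<in>S. (x, c) \<in> R\<^sup>* \<and> (c, z) \<in> R\<^sup>*"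
  using assms(2,4)
proof (induction rule: converse_rtrancl_induct)
  case (step y w)
  have E: "E w y" using step assms(3) by (auto simp: ER_def intro: E_sym)
  show ?case
  proof (cases "w \<in> C S")
    case True
    then have "y \<in> S" using C_closed[OF assms(1) True E] step by blast
    then show ?thesis using step by (meson converse_rtrancl_into_rtrancl rtrancl.rtrancl_refl)
  next
    case False
    then show ?thesis using step by (meson converse_rtrancl_into_rtrancl)
  qed
qed (use assms in auto)

section \<open>Minimum separators converging to the direction\<close>

definition sel :: "'a set \<Rightarrow> 'a set" where
  "sel X = (ARG_MIN card S. finite S \<and> X \<inter> C S = {})"

lemma sel:
  assumes "finite X"
  shows "finite (sel X)" "X \<inter> C (sel X) = {}" "\<And>S. finite S \<Longrightarrow> X \<inter> C S = {} \<Longrightarrow> card (sel X) \<le> card S"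
proof -
  have 0: "finite X \<and> X \<inter> C X = {}" using assms C_sub by blast
  have "(finite (sel X) \<and> X \<inter> C (sel X) = {}) \<and> (\<forall>S. finite S \<and> X \<inter> C S = {} \<longrightarrow> card (sel X) \<le> card S)"
    unfolding sel_def by (rule arg_min_nat_lemma[of "\<lambda>S. finite S \<and> X \<inter> C S = {}", OF 0])
  then show "finite (sel X)" "X \<inter> C (sel X) = {}" "\<And>S. finite S \<Longrightarrow> X \<inter> C S = {} \<Longrightarrow> card (sel X) \<le> card S"
    by blast+
qed

text \<open>If s had no neighbour in the component, putting s back into the graph would not enlarge
  it, and \<open>sel X - {s}\<close> would be a smaller choice.\<close>

lemma sel_nbr:
  assumes "finite X" "s \<in> sel X"
  shows "\<exists>v\<in>C (sel X). E s v"
proof (rule ccontr)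
  assume n: "\<not> ?thesis"
  let ?S = "sel X" and ?T = "sel X - {s}"
  have fin: "finite ?S" "finite ?T" using sel[OF assms(1)] by auto
  obtain z where z: "z \<in> C ?S" "z \<in> C ?T" using C_meet[OF fin] by blast
  have "C ?T \<subseteq> C ?S"
  proof
    fix u assume u: "u \<in> C ?T"
    have "(z, u) \<in> (avoid ER ?T)\<^sup>*" using C_conn fin(2) z u by blast
    then show "u \<in> C ?S"
    proof (induction rule: rtrancl_induct)
      case (step y w)
      then have "E y w" "w \<notin> ?T" by (auto simp: avoid_def ER_def)
      moreover have "w \<noteq> s" using n step E_sym \<open>E y w\<close> by blast
      ultimately show ?case using step C_closed[OF fin(1)] by blast
    qed (use z in auto)
  qed
  then have "X \<inter> C ?T = {}" using sel(2)[OF assms(1)] by blast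
  then have "card ?S \<le> card ?T" using sel(3)[OF assms(1) fin(2)] by blast
  then show False using assms(2) fin(1) by (meson card_Diff1_less leD)
qed

lemma sel_V: "finite X \<Longrightarrow> sel X \<subseteq> V"
  using sel_nbr E_V by blast

text \<open>An exhaustion of \<open>V\<close> by finite sets from an arbitrary vertex. Each stage
  absorbs its own separator together with all neighbours, which pushes the next separator strictly
  beyond: this is what makes \<open>S_Suc_sub\<close> and \<open>S_disj\<close> true.\<close>

definition X :: "nat \<Rightarrow> 'a set" where
  "X n = ((\<lambda>Y. Y \<union> sel Y \<union> nbrs (Y \<union> sel Y)) ^^ n) {SOME v. v \<in> V}"

definition S :: "nat \<Rightarrow> 'a set" where "S n = sel (X n)"

lemma X_Suc: "X (Suc n) = X n \<union> S n \<union> nbrs (X n \<union> S n)"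
  by (simp add: X_def S_def)

lemma X_fin: "finite (X n) \<and> X n \<subseteq> V"
proof (induction n)
  case 0
  then show ?case using V_nonempty by (simp add: X_def some_in_eq)
next
  case (Suc n)
  then have "finite (S n)" "S n \<subseteq> V" using sel sel_V by (auto simp: S_def)
  then show ?case using Suc finite_nbrs[of "X n \<union> S n"] by (auto simp: X_Suc nbrs_def E_V)
qed

lemma S_fin: "finite (S n)" and X_S: "X n \<inter> C (S n) = {}"
  and S_min: "finite T \<Longrightarrow> X n \<inter> C T = {} \<Longrightarrow> card (S n) \<le> card T"
  using sel X_fin unfolding S_def by auto

lemma X_mono: "m \<le> n \<Longrightarrow> X m \<subseteq> X n"
  by (rule lift_Suc_mono_le[of X]) (auto simp: X_Suc)

lemma X_exhaust: "(\<Union>n. X n) = V"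
proof (rule connected_closed)
  show "(\<Union>n. X n) \<noteq> {}" by (auto simp: X_def intro: exI[of _ 0])
  show "(\<Union>n. X n) \<subseteq> V" using X_fin by blast
  fix u v assume "u \<in> (\<Union>n. X n)" "E u v"
  then obtain n where "u \<in> X n" by blast
  then have "v \<in> X (Suc n)" using \<open>E u v\<close> by (auto simp: X_Suc nbrs_def)
  then show "v \<in> (\<Union>n. X n)" by blast
qed

lemma finite_sub_X: "finite T \<Longrightarrow> \<exists>m. T \<inter> V \<subseteq> X m"
proof (induction T rule: finite_induct)
  case (insert x T)
  then obtain m where m: "T \<inter> V \<subseteq> X m" by blast
  show ?case
  proof (cases "x \<in> V")
    case True
    then obtain n where "x \<in> X n" using X_exhaust by blast
    then show ?thesis using m X_mono[of m "max m n"] X_mono[of n "max m n"]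
      by (intro exI[of _ "max m n"]) auto
  next
    case False
    then show ?thesis using m by (intro exI[of _ m]) auto
  qed
qed auto

lemma finite_avoid_C: "finite T \<Longrightarrow> \<exists>m. T \<inter> C (S m) = {}"
  using finite_sub_X[of T] X_S C_sub[OF S_fin] by blast

lemma S_C_Suc: "S n \<inter> C (S (Suc n)) = {}"
  using X_S[of "Suc n"] by (auto simp: X_Suc)

lemma C_Suc: "C (S (Suc n)) \<subseteq> C (S n)"
  by (rule C_mono[OF S_fin S_fin S_C_Suc])

lemma C_decr: "m \<le> n \<Longrightarrow> C (S n) \<subseteq> C (S m)"
  using lift_Suc_antimono_le[of "\<lambda>n. C (S n)"] C_Suc by blast

lemma S_Suc_sub: "S (Suc n) \<subseteq> C (S n)"
proof
  fix s assume s: "s \<in> S (Suc n)"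
  then obtain v where v: "v \<in> C (S (Suc n))" "E s v"
    using sel_nbr[of "X (Suc n)" s] X_fin unfolding S_def by blast
  then have "s \<notin> S n" using X_S[of "Suc n"] by (auto simp: X_Suc nbrs_def)
  then show "s \<in> C (S n)" using C_closed[OF S_fin _ E_sym[OF v(2)]] v(1) C_Suc by blast
qed

lemma S_disj: "S n \<inter> S (Suc n) = {}"
  using S_Suc_sub C_sub[OF S_fin] by blast

lemma card_S_mono: "card (S n) \<le> card (S (Suc n))"
  using S_min[OF S_fin, of n "Suc n"] X_S[of "Suc n"] X_mono[of n "Suc n"] by force

text \<open>Otherwise the sizes would be constant from m on, although the sets cut off by these
  separators eventually contain any given finite set, against \<open>C_unbounded\<close>.\<close>

lemma card_S_grows: "\<exists>n\<ge>m. card (S n) < card (S (Suc n))"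
proof (rule ccontr)
  assume n: "\<not> ?thesis"
  have eq: "card (S (m + i)) = card (S m)" for i
  proof (induction i)
    case (Suc i)
    have "card (S (Suc (m + i))) \<le> card (S (m + i))" using n by (simp add: not_less)
    then show ?case using Suc card_S_mono[of "m + i"] by simp
  qed simp
  obtain Y where Y: "Y \<subseteq> V" "finite Y" "\<And>T. finite T \<Longrightarrow> Y \<inter> C T = {} \<Longrightarrow> card (S m) < card T"
    using C_unbounded[of "card (S m)"] by auto
  obtain j where j: "Y \<inter> V \<subseteq> X j" using finite_sub_X Y by blast
  have "Y \<inter> C (S (m + j)) = {}" 
    using j Y(1) X_mono[of j "m + j"] X_S[of "m + j"] by (simp add: disjoint_iff subset_iff)
  then show False using Y(3)[OF S_fin[of "m + j"]] eq[of j] by simp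
qed

text \<open>No edge enters \<open>S n\<close> and none leaves \<open>S (Suc n)\<close>, so a linkage
  meets these sets only in first and last vertices, respectively.\<close>

definition F :: "nat \<Rightarrow> ('a \<times> 'a) set" where
  "F n = {(u, v) \<in> ER. u \<notin> S (Suc n) \<and> v \<notin> S n}"

text \<open>As \<open>S n\<close> is a minimum set cutting off \<open>X n\<close>, it is enough that
  \<open>T\<close> cuts off \<open>X n\<close> too. Otherwise some walk avoiding \<open>T\<close>
  leads from \<open>X n\<close> into \<open>C (S (Suc n))\<close>. It passes \<open>S n\<close> and
  later \<open>S (Suc n)\<close>, and the segment from its last vertex in \<open>S n\<close> to the
  next vertex in \<open>S (Suc n)\<close> uses edges of \<open>F n\<close> only.\<close>

lemma F_separator:
  assumes "finite T" "separates (F n) (S n) (S (Suc n)) T"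
  shows "card (S n) \<le> card T"
proof (rule S_min[OF assms(1)], rule ccontr)
  assume "X n \<inter> C T \<noteq> {}"
  then obtain x where x: "x \<in> X n" "x \<in> C T" by blast
  obtain z where z: "z \<in> C T" "z \<in> C (S (Suc n))" using C_meet[OF assms(1) S_fin] by blast
  define R where "R = avoid ER T"
  define R' where "R' = {(u, v) \<in> R. v \<notin> S n}"
  define R'' where "R'' = {(u, v) \<in> R'. u \<notin> S (Suc n)}"
  have RE: "R \<subseteq> ER" "R' \<subseteq> ER" by (auto simp: R_def R'_def avoid_def)
  have "(x, z) \<in> R\<^sup>*" using C_conn assms(1) x z unfolding R_def by blast
  moreover have "x \<notin> C (S n)" "z \<in> C (S n)" using x z X_S C_Suc by blast+
  ultimately obtain c where c: "c \<in> S n" "(c, z) \<in> R\<^sup>*" using C_entry[OF S_fin _ RE(1)] by blast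
  obtain c' where c': "c' \<in> S n" "(c', z) \<in> R'\<^sup>*"
    using rtrancl_last_hit[OF c(2,1)] unfolding R'_def by blast
  have "c' \<notin> C (S (Suc n))" using c' S_C_Suc by blast
  then obtain d where d: "d \<in> S (Suc n)" "(c', d) \<in> R'\<^sup>*" using C_entry[OF S_fin c'(2) RE(2)] z by blast
  obtain d' where d': "d' \<in> S (Suc n)" "(c', d') \<in> R''\<^sup>*"
    using rtrancl_first_hit[OF d(2,1)] unfolding R''_def by blast
  have sub: "R'' \<subseteq> avoid (F n) T" by (auto simp: R''_def R'_def R_def avoid_def F_def)
  have "z \<notin> T" using z C_sub assms by blast
  then have "c' \<notin> T" using rtrancl_avoid_notin[of c' z ER T] c'(2) rtrancl_mono[of R' "avoid ER T"]
    unfolding R'_def R_def by blast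
  then have "d' \<notin> T" using rtrancl_avoid_notin[of c' d' "F n" T] d'(2) rtrancl_mono[OF sub] by blast
  then show False using separatesD[OF assms(2) c'(1) \<open>c' \<notin> T\<close> d'(1) _ d'(2) sub] by blast
qed

lemma linkage_exists:
  "\<exists>M B. finite M \<and> M \<subseteq> F n \<and> B \<subseteq> S (Suc n) \<and> card B = card (S n) \<and> linkage M (S n) B"
proof -
  have irr: "\<And>v. (v, v) \<notin> F n" by (auto simp: F_def ER_def E_irrefl)
  have "\<exists>M A0 B0. finite M \<and> M \<subseteq> F n \<and> A0 \<subseteq> S n \<and> B0 \<subseteq> S (Suc n) \<and> finite A0 \<and> finite B0 \<and>
    card A0 = card (S n) \<and> card B0 = card (S n) \<and> linkage M A0 B0"
    by (rule Menger[OF irr]) (rule F_separator)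
  then obtain M A0 B0 where *: "finite M" "M \<subseteq> F n" "A0 \<subseteq> S n" "B0 \<subseteq> S (Suc n)"
    "card A0 = card (S n)" "card B0 = card (S n)" "linkage M A0 B0" by blast
  then have "A0 = S n" using card_subset_eq[OF S_fin] by blast
  then show ?thesis using * by blast
qed

definition M :: "nat \<Rightarrow> ('a \<times> 'a) set" where
  "M n = (SOME M. \<exists>B. finite M \<and> M \<subseteq> F n \<and> B \<subseteq> S (Suc n) \<and> card B = card (S n) \<and> linkage M (S n) B)"

definition B :: "nat \<Rightarrow> 'a set" where
  "B n = (SOME B. finite (M n) \<and> M n \<subseteq> F n \<and> B \<subseteq> S (Suc n) \<and> card B = card (S n) \<and> linkage (M n) (S n) B)"

lemma MB: "finite (M n)" "M n \<subseteq> F n" "B n \<subseteq> S (Suc n)" "card (B n) = card (S n)" "linkage (M n) (S n) (B n)"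
proof -
  have "\<exists>B. finite (M n) \<and> M n \<subseteq> F n \<and> B \<subseteq> S (Suc n) \<and> card B = card (S n) \<and> linkage (M n) (S n) B"
    unfolding M_def by (rule someI_ex[OF linkage_exists])
  from someI_ex[OF this, folded B_def]
  show "finite (M n)" "M n \<subseteq> F n" "B n \<subseteq> S (Suc n)" "card (B n) = card (S n)" "linkage (M n) (S n) (B n)"
    by blast+
qed

lemma M_E: "(u, v) \<in> M n \<Longrightarrow> E u v \<and> u \<notin> S (Suc n) \<and> v \<notin> S n"
  using MB(2)[of n] by (auto simp: F_def ER_def)

text \<open>To leave the region between the two separators a path would have to enter
  \<open>S n\<close> or leave \<open>S (Suc n)\<close>, and edges of \<open>F n\<close> do neither.
  As these regions overlap at most in a separator, the union of all linkages is still single-valued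
  in both directions.\<close>

lemma M_region: "v \<in> Range (M n) \<union> S n \<Longrightarrow> v \<in> C (S n) \<union> S n \<and> v \<notin> C (S (Suc n))"
proof
  assume v: "v \<in> Range (M n) \<union> S n"
  obtain b where b: "b \<in> B n" "(v, b) \<in> (M n)\<^sup>*" using linkage_to[OF MB(5) v] by blast
  show "v \<in> C (S n) \<union> S n" using b(2)
  proof (induction rule: converse_rtrancl_induct)
    case base
    then show ?case using b MB(3) S_Suc_sub by blast
  next
    case (step y w)
    then show ?case using M_E[OF step(1)] C_closed[OF S_fin, of w n y] E_sym by blast
  qed
  obtain a where a: "a \<in> S n" "(a, v) \<in> (M n)\<^sup>*" using linkage_from[OF MB(5) v] by blast
  show "v \<notin> C (S (Suc n))" using a(2)
  proof (induction rule: rtrancl_induct)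
    case base
    then show ?case using a S_C_Suc by blast
  next
    case (step y w)
    then show ?case using M_E[OF step(2)] C_closed[OF S_fin, of w "Suc n" y] E_sym by blast
  qed
qed

lemma M_field: "Domain (M n) \<union> B n = Range (M n) \<union> S n"
  using MB(5) unfolding linkage_def by blast

lemma M_source: "(u, v) \<in> M n \<Longrightarrow> u \<in> C (S n) \<union> S n \<and> u \<notin> C (S (Suc n)) \<union> S (Suc n)"
  using M_region[of u n] M_field[of n] M_E[of u v n] by blast

lemma M_target: "(u, v) \<in> M n \<Longrightarrow> v \<in> C (S n) \<and> v \<notin> C (S (Suc n))"
  using M_region[of v n] M_E[of u v n] by blast

lemma S_below: "m < n \<Longrightarrow> C (S n) \<union> S n \<subseteq> C (S m)"
proof -
  assume "m < n"
  then obtain k where k: "n = Suc k" "m \<le> k" by (cases n) auto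
  then show ?thesis using C_decr[of m k] S_Suc_sub[of k] C_Suc[of k] by blast
qed

lemma M_source_inj: "(u, v) \<in> M n \<Longrightarrow> (u, w) \<in> M m \<Longrightarrow> n = m"
proof (rule ccontr)
  assume "(u, v) \<in> M n" "(u, w) \<in> M m" "n \<noteq> m"
  note 1 = M_source[OF this(1)] M_source[OF this(2)]
  have False if "i < j" "u \<in> C (S j) \<union> S j" "u \<notin> C (S (Suc i)) \<union> S (Suc i)" for i j
  proof (cases "j = Suc i")
    case False
    then have "Suc i < j" using that by simp
    then show ?thesis using S_below that by blast
  qed (use that in blast)
  then show False using 1 \<open>n \<noteq> m\<close> by (metis linorder_neqE_nat)
qed

lemma M_target_inj:
  assumes "v \<in> C (S n)" "v \<notin> C (S (Suc n))" "v \<in> C (S m)" "v \<notin> C (S (Suc m))"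
  shows "n = m"
  using assms C_decr[of "Suc n" m] C_decr[of "Suc m" n] by (metis linorder_neqE_nat Suc_leI subsetD)

section \<open>Disjoint rays from the linkages\<close>

definition MM :: "('a \<times> 'a) set" where "MM = (\<Union>n. M n)"

lemma MM_sv: "(u, v) \<in> MM \<Longrightarrow> (u, w) \<in> MM \<Longrightarrow> v = w"
proof -
  assume "(u, v) \<in> MM" "(u, w) \<in> MM"
  then obtain n m where nm: "(u, v) \<in> M n" "(u, w) \<in> M m" unfolding MM_def by blast
  moreover have "n = m" using M_source_inj nm by blast
  moreover have "single_valued (M n)" using MB(5) unfolding linkage_def by blast
  ultimately show "v = w" by (auto dest: single_valuedD)
qed

lemma MM_svc: "(v, u) \<in> MM \<Longrightarrow> (w, u) \<in> MM \<Longrightarrow> v = w"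
proof -
  assume "(v, u) \<in> MM" "(w, u) \<in> MM"
  then obtain n m where nm: "(v, u) \<in> M n" "(w, u) \<in> M m" unfolding MM_def by blast
  moreover have "n = m" using M_target_inj M_target[OF nm(1)] M_target[OF nm(2)] by blast
  moreover have "single_valued ((M n)\<inverse>)" using MB(5) unfolding linkage_def by blast
  ultimately show "v = w" by (auto dest: single_valuedD)
qed

lemma S_Domain: "S n \<subseteq> Domain (M n)"
  using M_field[of n] MB(3)[of n] S_disj[of n] by blast

lemma MM_Range: "Range MM \<subseteq> Domain MM"
proof
  fix v assume "v \<in> Range MM"
  then obtain n where "v \<in> Range (M n)" by (auto simp: MM_def)
  then have "v \<in> Domain (M n) \<or> v \<in> S (Suc n)" using M_field[of n] MB(3)[of n] by blast
  then show "v \<in> Domain MM" using S_Domain[of "Suc n"] unfolding MM_def by blast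
qed

text \<open>Whenever the separators grow, some vertex of \<open>S (Suc n)\<close> is not the end of
  a path of the n-th linkage, so it has no predecessor. By \<open>card_S_grows\<close> this happens
  beyond every finite set.\<close>

lemma starts_infinite: "infinite (Domain MM - Range MM)"
proof
  assume "finite (Domain MM - Range MM)"
  then obtain m where m: "(Domain MM - Range MM) \<inter> C (S m) = {}" using finite_avoid_C by blast
  obtain n where n: "m \<le> n" "card (S n) < card (S (Suc n))" using card_S_grows by blast
  have "\<not> S (Suc n) \<subseteq> B n" using n(2) MB(3)[of n] MB(4)[of n] by auto
  then obtain s where s: "s \<in> S (Suc n)" "s \<notin> B n" by blast
  have sC: "s \<in> C (S n)" "s \<notin> C (S (Suc n))" using s S_Suc_sub C_sub[OF S_fin] by blast+
  have "s \<notin> Range MM"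
  proof
    assume "s \<in> Range MM"
    then obtain u k where k: "(u, s) \<in> M k" by (auto simp: MM_def)
    then have "k = n" using M_target[OF k] M_target_inj sC by blast
    then have "s \<in> Domain (M n)" using k M_field[of n] s(2) by blast
    then show False using M_E s(1) by blast
  qed
  moreover have "s \<in> Domain MM" using S_Domain[of "Suc n"] s(1) unfolding MM_def by blast
  ultimately show False using m sC(1) C_decr[OF n(1)] by blast
qed

definition nxt :: "'a \<Rightarrow> 'a" where "nxt u = (SOME v. (u, v) \<in> MM)"

lemma nxt: "u \<in> Domain MM \<Longrightarrow> (u, nxt u) \<in> MM"
  unfolding nxt_def by (rule someI_ex) blast

text \<open>Every vertex of \<open>Domain MM\<close> has a successor there, so each of the
  infinitely many starting vertices gives a ray. Only finitely many vertices of
  \<open>Domain MM\<close> lie outside \<open>C (S m)\<close>; hence every ray has a tail in each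
  \<open>C (S m)\<close>, and all the rays belong to one end.\<close>

lemma thick_end_exists: "\<exists>\<epsilon>\<in>ends V E. thick_end \<epsilon>"
proof -
  let ?D = "Domain MM"
  have inj: "inj_on nxt ?D" using nxt MM_svc by (metis inj_onI)
  have nD: "nxt ` ?D \<subseteq> ?D" using nxt MM_Range by blast
  have starts: "?D - nxt ` ?D = ?D - Range MM"
    using nxt MM_sv by blast
  obtain f :: "nat \<Rightarrow> 'a" where f: "inj f" "range f \<subseteq> ?D - nxt ` ?D"
    using infinite_countable_subset[OF starts_infinite] starts by auto
  define Rs where "Rs i n = (nxt ^^ n) (f i)" for i n
  have D: "Rs i n \<in> ?D" for i n
  proof (induction n)
    case 0
    then show ?case using f by (auto simp: Rs_def)
  next
    case (Suc n)
    then show ?case using nD by (auto simp: Rs_def)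
  qed
  have E: "E (Rs i n) (Rs i (Suc n))" for i n
    using nxt[OF D[of i n]] M_E by (fastforce simp: MM_def Rs_def)
  have eq: "i = j \<and> m = n" if "Rs i m = Rs j n" for i j m n
  proof -
    have "f i \<in> ?D - nxt ` ?D" "f j \<in> ?D - nxt ` ?D" using f(2) by auto
    then have "m = n \<and> f i = f j"
      using that funpow_start_unique[OF inj nD, of "f i" "f j" m n] unfolding Rs_def by simp
    then show ?thesis using f(1) by (auto dest: injD)
  qed
  have ray: "ray V E (Rs i)" for i
    unfolding ray_def using E E_V(1)[OF E] eq by (auto intro!: injI)
  have tail: "\<exists>n0. \<forall>n\<ge>n0. Rs i n \<in> C (S m)" for i m
  proof -
    have "?D - C (S m) \<subseteq> (\<Union>n\<le>m. Domain (M n))"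
    proof
      fix v assume v: "v \<in> ?D - C (S m)"
      then obtain n w where n: "(v, w) \<in> M n" by (auto simp: MM_def)
      have "n \<le> m" using M_source[OF n] S_below[of m n] v by (meson DiffE linorder_not_le subsetD)
      then show "v \<in> (\<Union>n\<le>m. Domain (M n))" using n by blast
    qed
    moreover have "finite (\<Union>n\<le>m. Domain (M n))" using MB(1) by (auto simp: finite_Domain)
    ultimately have "finite (?D - C (S m))" by (rule finite_subset)
    moreover have "inj (Rs i)" using ray unfolding ray_def by blast
    ultimately have "finite (Rs i -` (?D - C (S m)))" by (rule finite_vimageI)
    then obtain n0 where "\<forall>n\<in>Rs i -` (?D - C (S m)). n < n0" using finite_nat_set_iff_bounded by blast
    then have "\<forall>n\<ge>n0. Rs i n \<in> C (S m)" using D by (metis Diff_iff leD vimageI)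
    then show ?thesis by blast
  qed
  have equiv: "rays_equiv V E (Rs i) (Rs j)" for i j
    unfolding rays_equiv_def
  proof (intro allI impI)
    fix T :: "'a set" assume T: "finite T"
    obtain k where k: "T \<inter> C (S k) = {}" using finite_avoid_C[OF T] by blast
    obtain m where m: "\<forall>n\<ge>m. Rs i n \<in> C (S k)" using tail by blast
    obtain n where n: "\<forall>l\<ge>n. Rs j l \<in> C (S k)" using tail by blast
    have CT: "C (S k) \<subseteq> C T" by (rule C_mono[OF T S_fin k])
    have "(Rs i m, Rs j n) \<in> (avoid ER T)\<^sup>*" using C_conn[OF T] m n CT by blast
    then obtain p where p: "tpath E (Rs i m) (Rs j n) p" "set p \<subseteq> insert (Rs i m) (Range (avoid ER T))"
      using rtrancl_tpath[of "Rs i m" "Rs j n" "avoid ER T"] unfolding avoid_def by blast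
    have "set p \<subseteq> V - T" using p(2) m k E_V(1)[OF E, of i m] by (auto simp: avoid_def ER_def E_V)
    moreover have "\<forall>i'\<ge>m. Rs i i' \<notin> T" "\<forall>i\<ge>n. Rs j i \<notin> T" using m n k by blast+
    ultimately show "\<exists>m n p. (\<forall>i'\<ge>m. Rs i i' \<notin> T) \<and> (\<forall>i\<ge>n. Rs j i \<notin> T) \<and> tpath E (Rs i m) (Rs j n) p \<and> set p \<subseteq> V - T"
      using p(1) by (intro exI[of _ m] exI[of _ n] exI[of _ p]) simp
  qed
  let ?\<epsilon> = "{R'. ray V E R' \<and> rays_equiv V E (Rs 0) R'}"
  have "?\<epsilon> \<in> ends V E" unfolding ends_def using ray by blast
  moreover have "thick_end ?\<epsilon>" unfolding thick_end_def
  proof (intro exI[of _ Rs] conjI allI impI)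
    show "Rs i \<in> ?\<epsilon>" for i using ray equiv by blast
    show "range (Rs i) \<inter> range (Rs j) = {}" if "i \<noteq> j" for i j using eq that by blast
  qed
  ultimately show ?thesis by blast
qed

end

section \<open>Vertex sets that converge to a single end\<close>

context lf_graph
begin

definition component :: "'a set \<Rightarrow> 'a \<Rightarrow> 'a set" where
  "component S v = {u. (v, u) \<in> (avoid ER S)\<^sup>*}"

lemma comp_self: "v \<in> component S v"
  by (simp add: component_def)

lemma comp_sub: "v \<in> V - S \<Longrightarrow> component S v \<subseteq> V - S"
  unfolding component_def using avoid_ER_V[of v _ S] rtrancl_avoid_notin[of v _ ER S] by auto

lemma comp_closed: "v \<notin> S \<Longrightarrow> u \<in> component S v \<Longrightarrow> E u w \<Longrightarrow> w \<notin> S \<Longrightarrow> w \<in> component S v"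
  unfolding component_def using rtrancl_avoid_notin[of v u ER S]
  by (auto intro!: rtrancl_into_rtrancl[of v u] simp: avoid_def ER_def)

lemma comp_eq: "u \<in> component S v \<Longrightarrow> component S u = component S v"
  unfolding component_def using avoid_ER_sym[of v u S] by (auto intro: rtrancl_trans)

lemma comp_separation:
  assumes "v \<in> V - S"
  shows "separation V E (V - component S v) (component S v \<union> (S \<inter> V))"
  using assms comp_sub[OF assms] comp_closed[of v S] E_sym E_V unfolding separation_def by blast

text \<open>\<open>C S\<close> is the component with infinitely many vertices of \<open>W\<close>.
  It exists because local finiteness leaves finitely many components. By \<open>conc\<close> all but
  at most \<open>card S\<close> vertices of \<open>W - S\<close> lie in it, which gives uniqueness
  and coherence.\<close>

lemma concentrated_imp_thick_end:
  assumes W: "W \<subseteq> V" "infinite W"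
    and conc: "\<And>X Y U U'. separation V E X Y \<Longrightarrow> finite (X \<inter> Y) \<Longrightarrow> finite U \<Longrightarrow> finite U' \<Longrightarrow>
      U \<subseteq> W \<inter> (X - Y) \<Longrightarrow> U' \<subseteq> W \<inter> (Y - X) \<Longrightarrow> card (X \<inter> Y) < card U \<Longrightarrow> card (X \<inter> Y) < card U' \<Longrightarrow> False"
  shows "\<exists>\<epsilon>\<in>ends V E. thick_end \<epsilon>"
proof -
  define C where "C S = {v \<in> V - S. infinite (W \<inter> component S v)}" for S
  have big: "finite (W - S - component S v) \<and> card (W - S - component S v) \<le> card S" if S: "finite S" and v: "v \<in> C S" for S v
  proof (rule ccontr)
    assume n: "\<not> ?thesis"
    let ?k = "card (S \<inter> V)"
    have vV: "v \<in> V - S" using v by (simp add: C_def)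
    have le: "?k \<le> card S" using S by (simp add: card_mono)
    have "\<exists>U\<subseteq>W - S - component S v. finite U \<and> card U = Suc ?k"
    proof (cases "finite (W - S - component S v)")
      case True
      then have "Suc ?k \<le> card (W - S - component S v)" using n le by simp
      then show ?thesis by (meson True finite_subset obtain_subset_with_card_n)
    qed (meson infinite_arbitrarily_large)
    then obtain U where U: "U \<subseteq> W - S - component S v" "finite U" "card U = Suc ?k" by blast
    have "infinite (W \<inter> component S v)" using v by (simp add: C_def)
    then obtain U' where U': "U' \<subseteq> W \<inter> component S v" "finite U'" "card U' = Suc ?k"
      by (meson infinite_arbitrarily_large)
    have int: "(V - component S v) \<inter> (component S v \<union> (S \<inter> V)) = S \<inter> V" using comp_sub[OF vV] by blast
    show False
    proof (rule conc[OF comp_separation[OF vV], of U U'])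
      show "U \<subseteq> W \<inter> (V - component S v - (component S v \<union> S \<inter> V))" using U W by blast
      show "U' \<subseteq> W \<inter> (component S v \<union> S \<inter> V - (V - component S v))" using U' comp_sub[OF vV] by blast
    qed (use U U' S int in auto)
  qed
  have C_comp: "component S v \<subseteq> C S" if "v \<in> C S" for S v
    using that comp_sub[of v S] comp_eq[of _ S v] by (auto simp: C_def)
  have rest: "W - C S \<subseteq> S \<union> (W - S - component S v)" if "v \<in> C S" for S v
    using C_comp[OF that] by blast
  have ne: "\<exists>v. v \<in> C S" if S: "finite S" for S
  proof (rule ccontr)
    assume n: "\<not> ?thesis"
    \<comment> \<open>A component that is not the whole graph contains a neighbour of
      \<open>S\<close>, and there are finitely many of these.\<close>
    let ?N = "nbrs (S \<inter> V) - S"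
    have "W - S \<subseteq> (\<Union>y\<in>?N. W \<inter> component S y)"
    proof
      fix x assume x: "x \<in> W - S"
      then have xV: "x \<in> V - S" using W by blast
      have "component S x \<noteq> V"
      proof
        assume "component S x = V"
        then have "x \<in> C S" using xV W by (simp add: C_def Int_absorb2)
        then show False using n by blast
      qed
      then obtain u w where uw: "u \<in> component S x" "E u w" "w \<notin> component S x"
        using connected_closed[of "component S x"] comp_sub[OF xV] comp_self by blast
      then have "w \<in> S \<inter> V" using comp_closed[of x S u w] xV E_V by blast
      then have "u \<in> ?N" using uw E_sym comp_sub[OF xV] by (auto simp: nbrs_def)
      moreover have "x \<in> component S u" using comp_eq[OF uw(1)] comp_self by blast
      ultimately show "x \<in> (\<Union>y\<in>?N. W \<inter> component S y)" using x by blast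
    qed
    moreover have "finite (\<Union>y\<in>?N. W \<inter> component S y)"
    proof -
      have "finite ?N" using finite_nbrs S by simp
      moreover have "finite (W \<inter> component S y)" if "y \<in> ?N" for y
        using n that E_V(2) unfolding C_def nbrs_def by blast
      ultimately show ?thesis by blast
    qed
    ultimately have "finite (W - S)" by (rule finite_subset)
    then show False using W S by simp
  qed
  have fin: "finite (W - C S)" if "finite S" for S
  proof -
    obtain v where v: "v \<in> C S" using ne \<open>finite S\<close> by blast
    show ?thesis using rest[OF v] big[OF that v] that by (meson finite_UnI finite_subset)
  qed
  interpret direction V E C
  proof
    fix S T :: "'a set" and u v assume S: "finite S"
    show "C S \<subseteq> V - S" by (auto simp: C_def)
    show "(u, v) \<in> (avoid ER S)\<^sup>*" if u: "u \<in> C S" and v: "v \<in> C S"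
    proof (rule ccontr)
      assume "\<not> ?thesis"
      then have "v \<notin> component S u" by (simp add: component_def)
      then have "component S u \<noteq> component S v" using comp_self[of v S] by metis
      then have "component S u \<inter> component S v = {}" by (metis comp_eq disjoint_iff)
      then have "W \<inter> component S v \<subseteq> W - S - component S u" using comp_sub[of v S] v by (auto simp: C_def)
      then have "finite (W \<inter> component S v)" using big[OF S u] finite_subset by blast
      then show False using v by (simp add: C_def)
    qed
    show "v \<in> C S" if "u \<in> C S" "E u v" "v \<notin> S"
      using C_comp[OF that(1)] comp_closed[of u S u v] comp_self that by (auto simp: C_def)
    show "C S \<inter> C T \<noteq> {}" if "finite T"
    proof
      assume "C S \<inter> C T = {}"
      then have "W \<subseteq> (W - C S) \<union> (W - C T)" by blast
      then show False using fin[OF S] fin[OF that] W finite_subset by blast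
    qed
  next
    fix k :: nat
    \<comment> \<open>A set of at most k vertices contains at most k elements of \<open>X\<close>,
      and by \<open>big\<close> at most k further ones lie outside its component; one is left
      over.\<close>
    obtain X where X: "X \<subseteq> W" "finite X" "card X = Suc (2 * k)" using W by (meson infinite_arbitrarily_large)
    have "k < card S" if S: "finite S" "X \<inter> C S = {}" for S
    proof (rule ccontr)
      assume k: "\<not> k < card S"
      obtain v where v: "v \<in> C S" using ne S by blast
      have "X \<subseteq> S \<union> (W - S - component S v)" using rest[OF v] S X by blast
      then have "card X \<le> card (S \<union> (W - S - component S v))" using big[OF S(1) v] S(1) by (intro card_mono) auto
      also have "\<dots> \<le> card S + card (W - S - component S v)" by (rule card_Un_le)
      also have "\<dots> \<le> 2 * k" using big[OF S(1) v] k by simp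
      finally show False using X by simp
    qed
    then show "\<exists>X\<subseteq>V. finite X \<and> (\<forall>S. finite S \<and> X \<inter> C S = {} \<longrightarrow> k < card S)"
      using X W(1) by (intro exI[of _ X]) auto
  qed
  show ?thesis by (rule thick_end_exists)
qed

end

section \<open>Tangles and efficient separations\<close>

text \<open>Infinite separators get the default value 0, so the number is meaningful only together
  with finiteness; \<open>fsep\<close> records this, and all members of tangles satisfy it.\<close>

definition ord :: "'a set \<times> 'a set \<Rightarrow> nat" where
  "ord s = card (fst s \<inter> snd s)"

definition join :: "'a set \<times> 'a set \<Rightarrow> 'a set \<times> 'a set \<Rightarrow> 'a set \<times> 'a set" where
  "join r s = (fst r \<union> fst s, snd r \<inter> snd s)"

definition nested :: "'a set \<times> 'a set \<Rightarrow> 'a set \<times> 'a set \<Rightarrow> bool" where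
  "nested r s \<longleftrightarrow> osep_le r s \<or> osep_le r (prod.swap s) \<or> osep_le (prod.swap r) s \<or>
     osep_le (prod.swap r) (prod.swap s)"

lemma ord_swap [simp]: "ord (prod.swap s) = ord s"
  by (simp add: ord_def Int_commute)

lemma osep_le_swap: "osep_le (prod.swap r) (prod.swap s) = osep_le s r"
  "osep_le (prod.swap r) s = osep_le (prod.swap s) r" "osep_le r (prod.swap s) = osep_le s (prod.swap r)"
  unfolding osep_le_def by auto

lemma osep_le_refl: "osep_le r r"
  unfolding osep_le_def by simp

lemma osep_le_trans: "osep_le r s \<Longrightarrow> osep_le s t \<Longrightarrow> osep_le r t"
  unfolding osep_le_def by blast

lemma osep_le_antisym: "osep_le r s \<Longrightarrow> osep_le s r \<Longrightarrow> r = s"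
  unfolding osep_le_def by (auto simp: prod_eq_iff)

lemma osep_le_join: "osep_le r (join r s)" "osep_le s (join r s)"
  unfolding osep_le_def join_def by auto

lemma join_osep_le: "osep_le r t \<Longrightarrow> osep_le s t \<Longrightarrow> osep_le (join r s) t"
  unfolding osep_le_def join_def by auto

lemma nested_iff: "nested r s \<longleftrightarrow> osep_le r s \<or> osep_le s r \<or> osep_le r (prod.swap s) \<or> osep_le (prod.swap r) s"
  unfolding nested_def osep_le_swap(1) by blast

lemma nested_swap [simp]: "nested (prod.swap r) s = nested r s" "nested r (prod.swap s) = nested r s"
  unfolding nested_def by (simp_all add: disj_ac)

lemma nested_sym: "nested r s \<longleftrightarrow> nested s r"
  unfolding nested_iff osep_le_swap(2)[of s r] osep_le_swap(3)[of s r] by blast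

lemma nested_join: "nested r (join r s)" "nested s (join r s)"
  unfolding nested_iff by (simp_all add: osep_le_join)

text \<open>If an orientation of t lies below r or s, it lies below the join. Otherwise r and s both
  lie below orientations of t. These cannot be opposite ones, as then r and s would be nested; so
  the join lies below the same orientation.\<close>

lemma nested_join_both:
  assumes "nested t r" "nested t s" "\<not> nested r s"
  shows "nested t (join r s)"
proof -
  have *: "osep_le t u \<or> osep_le (prod.swap t) u \<or> osep_le u t \<or> osep_le u (prod.swap t)" if "nested t u" for u
    using that unfolding nested_iff osep_le_swap(3)[of t u] by blast
  have up: "nested t (join r s)" if "osep_le t u \<or> osep_le (prod.swap t) u" "u = r \<or> u = s" for u
    using that osep_le_trans osep_le_join unfolding nested_def by metis
  have down: "nested t (join r s)" if "osep_le r u" "osep_le s u" "u = t \<or> u = prod.swap t" for u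
    using join_osep_le[OF that(1,2)] that(3) osep_le_swap(3)[of t "join r s"] unfolding nested_iff by auto
  have no: "\<not> (osep_le r u \<and> osep_le s (prod.swap u))" for u
    using assms(3) osep_le_trans[of r u "prod.swap s"] osep_le_swap(3)[of s u] unfolding nested_iff by blast
  show ?thesis using *[OF assms(1)] *[OF assms(2)] up down no no[of "prod.swap t"] by (metis swap_swap)
qed

text \<open>Being nested puts some orientation of t below r, s or one of their reverses, hence below
  the corresponding join. The second join is the reverse of the corner opposite to the
  first.\<close>

lemma nested_join_or:
  assumes "nested t r \<or> nested t s"
  shows "nested t (join r s) \<or> nested t (join (prod.swap r) (prod.swap s))"
proof -
  have *: "osep_le t u \<or> osep_le (prod.swap t) u \<or> osep_le (prod.swap t) (prod.swap u) \<or> osep_le t (prod.swap u)"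
    if "nested t u" for u using that unfolding nested_def by blast
  have up: "nested t (join x y)" if "osep_le t u \<or> osep_le (prod.swap t) u" "u = x \<or> u = y" for u x y
    using that osep_le_trans osep_le_join unfolding nested_def by metis
  show ?thesis using assms *[of r] *[of s] up by metis
qed

text \<open>The separators of opposite corners are contained in the union of the two given
  separators, and they meet only inside the intersection.\<close>

lemma ord_join_submodular:
  assumes "finite (fst r \<inter> snd r)" "finite (fst s \<inter> snd s)"
  shows "ord (join r s) + ord (join (prod.swap r) (prod.swap s)) \<le> ord r + ord s"
proof -
  let ?X = "(fst r \<union> fst s) \<inter> (snd r \<inter> snd s)" and ?Y = "(snd r \<union> snd s) \<inter> (fst r \<inter> fst s)"
  let ?R = "fst r \<inter> snd r" and ?S = "fst s \<inter> snd s"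
  have sub: "?X \<union> ?Y \<subseteq> ?R \<union> ?S" "?X \<inter> ?Y \<subseteq> ?R \<inter> ?S" by auto
  then have fin: "finite ?X" "finite ?Y" using assms by (auto intro: finite_subset[of _ "?R \<union> ?S"])
  have "card ?X + card ?Y = card (?X \<union> ?Y) + card (?X \<inter> ?Y)" by (rule card_Un_Int[OF fin])
  also have "\<dots> \<le> card (?R \<union> ?S) + card (?R \<inter> ?S)" using sub assms by (intro add_mono card_mono) auto
  also have "\<dots> = card ?R + card ?S" using card_Un_Int[OF assms] by simp
  finally show ?thesis by (simp add: ord_def join_def)
qed

section \<open>Orienting separations by a tangle\<close>

context lf_graph
begin

definition fsep :: "'a set \<times> 'a set \<Rightarrow> bool" where
  "fsep s \<longleftrightarrow> separation V E (fst s) (snd s) \<and> finite (fst s \<inter> snd s)"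

lemma separation_edge:
  "separation V E A B \<Longrightarrow> E u v \<Longrightarrow> (u \<in> A \<and> v \<in> A) \<or> (u \<in> B \<and> v \<in> B)"
  unfolding separation_def using E_V[of u v] E_sym[of u v] by blast

lemma separationI:
  "A \<union> B = V \<Longrightarrow> (\<And>u v. E u v \<Longrightarrow> u \<in> A - B \<Longrightarrow> v \<in> B - A \<Longrightarrow> False) \<Longrightarrow> separation V E A B"
  unfolding separation_def by blast

lemma fsep_swap [simp]: "fsep (prod.swap s) = fsep s"
proof -
  have "fsep (prod.swap s)" if "fsep s" for s
    using that E_sym unfolding fsep_def separation_def fst_swap snd_swap Int_commute[of "snd s"] by blast
  from this[of s] this[of "prod.swap s"] show ?thesis by auto
qed

lemma fsep_join: "fsep r \<Longrightarrow> fsep s \<Longrightarrow> fsep (join r s)"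
proof -
  assume r: "fsep r" and s: "fsep s"
  have "(fst r \<union> fst s) \<inter> (snd r \<inter> snd s) \<subseteq> (fst r \<inter> snd r) \<union> (fst s \<inter> snd s)" by auto
  then have "finite ((fst r \<union> fst s) \<inter> (snd r \<inter> snd s))" using r s unfolding fsep_def
    by (meson finite_UnI finite_subset)
  moreover have "separation V E (fst r \<union> fst s) (snd r \<inter> snd s)"
    using r s unfolding fsep_def separation_def by blast
  ultimately show ?thesis by (simp add: fsep_def join_def)
qed

lemma tangle_fsep: "tangle V E P \<Longrightarrow> s \<in> P \<Longrightarrow> fsep s"
proof -
  assume P: "tangle V E P" "s \<in> P"
  obtain k :: enat where "\<forall>A B. (A, B) \<in> P \<longrightarrow> separation V E A B \<and> sep_order A B < k"
    using P(1) unfolding tangle_def pre_tangle_def by blast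
  then have "separation V E (fst s) (snd s)" "sep_order (fst s) (snd s) < k"
    using P(2) by (metis prod.collapse)+
  then show ?thesis unfolding fsep_def sep_order_def by (auto split: if_splits)
qed

text \<open>The bound k of a tangle is hidden behind an existential quantifier. A member r of at
  least the required order serves as its witness, here and in the next lemmas.\<close>

lemma tangle_orient:
  assumes "tangle V E P" "r \<in> P" "fsep s" "ord s \<le> ord r"
  shows "s \<in> P \<or> prod.swap s \<in> P"
proof -
  obtain k :: enat where k: "\<forall>A B. separation V E A B \<and> sep_order A B < k \<longrightarrow> card (P \<inter> {(A, B), (B, A)}) = 1"
      "\<forall>A B. (A, B) \<in> P \<longrightarrow> separation V E A B \<and> sep_order A B < k"
    using assms(1) unfolding tangle_def pre_tangle_def by blast
  have "sep_order (fst r) (snd r) < k" using k(2) assms(2) by (metis prod.collapse)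
  moreover have "sep_order (fst s) (snd s) \<le> sep_order (fst r) (snd r)"
    using assms tangle_fsep[OF assms(1,2)] unfolding sep_order_def fsep_def ord_def by simp
  ultimately have "card (P \<inter> {(fst s, snd s), (snd s, fst s)}) = 1"
    using k(1) assms(3) unfolding fsep_def by (meson order_le_less_trans)
  then have "P \<inter> {(fst s, snd s), (snd s, fst s)} \<noteq> {}" by force
  then show ?thesis by (cases s) auto
qed

lemma tangle_cover:
  "tangle V E P \<Longrightarrow> r \<in> P \<Longrightarrow> s \<in> P \<Longrightarrow> t \<in> P \<Longrightarrow> \<not> covers3 V E (fst r) (fst s) (fst t)"
  unfolding tangle_def by (metis prod.collapse)

text \<open>Otherwise the reverse of s is in \<open>P\<close>, and its first side together with that
  of r covers the graph.\<close>

lemma tangle_down: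
  assumes "tangle V E P" "r \<in> P" "fsep s" "fst s \<subseteq> fst r" "t \<in> P" "ord s \<le> ord t"
  shows "s \<in> P"
proof (rule ccontr)
  assume "s \<notin> P"
  then have "prod.swap s \<in> P" using tangle_orient[OF assms(1,5,3,6)] by blast
  moreover have "separation V E (fst s) (snd s)" "fst r \<subseteq> V"
    using assms(3) tangle_fsep[OF assms(1,2)] by (auto simp: fsep_def separation_def)
  then have "covers3 V E (fst (prod.swap s)) (fst r) (fst r)"
    using separation_edge[of "fst s" "snd s"] assms(4) unfolding covers3_def
    by (auto simp: separation_def)
  ultimately show False using tangle_cover[OF assms(1) _ assms(2) assms(2)] by blast
qed

text \<open>The first sides of r, s and the reversed join cover the graph, which needs the full
  strength of three sets.\<close>

lemma tangle_join:
  assumes "tangle V E P" "r \<in> P" "s \<in> P" "t \<in> P" "ord (join r s) \<le> ord t"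
  shows "join r s \<in> P"
proof (rule ccontr)
  assume n: "join r s \<notin> P"
  have rs: "fsep r" "fsep s" using tangle_fsep assms by auto
  have "prod.swap (join r s) \<in> P" using tangle_orient[OF assms(1,4) fsep_join[OF rs] assms(5)] n by blast
  moreover have "covers3 V E (fst r) (fst s) (fst (prod.swap (join r s)))"
    using rs separation_edge[of "fst r" "snd r"] separation_edge[of "fst s" "snd s"]
    unfolding covers3_def join_def fsep_def by (auto simp: separation_def)
  ultimately show False using tangle_cover[OF assms(1-3)] by blast
qed

lemma tangle_not_both:
  assumes "tangle V E P" "s \<in> P"
  shows "prod.swap s \<notin> P"
proof
  assume "prod.swap s \<in> P"
  moreover have "covers3 V E (fst s) (fst (prod.swap s)) (fst s)"
    using separation_edge[of "fst s" "snd s"] tangle_fsep[OF assms]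
    unfolding covers3_def fsep_def by (auto simp: separation_def)
  ultimately show False using tangle_cover[OF assms(1) assms(2) _ assms(2)] by blast
qed

lemma tangle_fst_proper: "tangle V E P \<Longrightarrow> s \<in> P \<Longrightarrow> fst s \<subset> V"
proof -
  assume P: "tangle V E P" "s \<in> P"
  have "covers3 V E V V V" unfolding covers3_def by (auto simp: E_V)
  then have "fst s \<noteq> V" using tangle_cover[OF P(1,2,2,2)] by auto
  then show ?thesis using tangle_fsep[OF P] by (auto simp: fsep_def separation_def)
qed

text \<open>An oriented form of efficient distinction. The first sides are the small ones, so
  \<open>Q\<close> lives in \<open>snd s\<close> and \<open>P\<close> in \<open>fst s\<close>;
  fixing this direction tells which corners to form.\<close>

definition eff :: "('a set \<times> 'a set) set \<Rightarrow> ('a set \<times> 'a set) set \<Rightarrow> 'a set \<times> 'a set \<Rightarrow> bool" where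
  "eff P Q s \<longleftrightarrow> tangle V E P \<and> tangle V E Q \<and> prod.swap s \<in> P \<and> s \<in> Q \<and>
     (\<forall>t. prod.swap t \<in> P \<and> t \<in> Q \<longrightarrow> ord s \<le> ord t)"

definition relevant :: "'a set \<times> 'a set \<Rightarrow> bool" where
  "relevant s \<longleftrightarrow> (\<exists>P Q. eff P Q s)"

lemma effD:
  assumes "eff P Q s"
  shows "tangle V E P" "tangle V E Q" "prod.swap s \<in> P" "s \<in> Q" "fsep s"
    "\<And>t. prod.swap t \<in> P \<Longrightarrow> t \<in> Q \<Longrightarrow> ord s \<le> ord t"
  using assms tangle_fsep[of Q s] unfolding eff_def by blast+

lemma eff_swap: "eff P Q s \<longleftrightarrow> eff Q P (prod.swap s)"
proof -
  have "eff Q P (prod.swap s)" if "eff P Q s" for P Q s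
    unfolding eff_def
  proof (intro conjI allI impI)
    fix t assume "prod.swap t \<in> Q \<and> t \<in> P"
    then show "ord (prod.swap s) \<le> ord t" using effD(6)[OF that, of "prod.swap t"] by simp
  qed (use effD[OF that] in auto)
  from this[of P Q s] this[of Q P "prod.swap s"] show ?thesis by auto
qed

lemma relevant_swap [simp]: "relevant (prod.swap s) = relevant s"
proof -
  have "relevant (prod.swap s)" if "relevant s" for s
    using that unfolding relevant_def by (meson eff_swap)
  from this[of s] this[of "prod.swap s"] show ?thesis by auto
qed

lemma relevant_fsep: "relevant s \<Longrightarrow> fsep s"
  unfolding relevant_def using effD(5) by blast

lemma relevant_proper:
  assumes "relevant s"
  shows "fst s \<subset> V" "snd s \<subset> V"
proof -
  obtain P Q where "eff P Q s" using assms unfolding relevant_def by blast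
  note s = effD[OF this]
  show "fst s \<subset> V" by (rule tangle_fst_proper[OF s(2,4)])
  show "snd s \<subset> V" using tangle_fst_proper[OF s(1,3)] by simp
qed

lemma relevant_union: "relevant s \<Longrightarrow> fst s \<union> snd s = V"
  using relevant_fsep unfolding fsep_def separation_def by blast

lemma relevant_nonempty: "relevant s \<Longrightarrow> fst s \<noteq> {}" "relevant s \<Longrightarrow> snd s \<noteq> {}"
  using relevant_proper[of s] relevant_union[of s] by auto

lemma relevant_regular: "relevant s \<Longrightarrow> \<not> osep_le s (prod.swap s)" "relevant s \<Longrightarrow> \<not> osep_le (prod.swap s) s"
  using relevant_proper[of s] relevant_union[of s] unfolding osep_le_def by auto

lemma eff_same_ord: "eff P Q s \<Longrightarrow> prod.swap t \<in> P \<Longrightarrow> t \<in> Q \<Longrightarrow> ord t \<le> ord s \<Longrightarrow> eff P Q t"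
  unfolding eff_def using order_trans[of "ord t" "ord s"] by blast

text \<open>If the join has order at most \<open>ord r\<close>, both tangles orient it as they
  orient r: \<open>Q\<close> by \<open>tangle_join\<close>, \<open>P\<close> by
  \<open>tangle_down\<close>. So its order cannot be smaller than \<open>ord r\<close>, and at
  equality it is efficient as well.\<close>

lemma eff_join:
  assumes "eff P Q r" "s \<in> Q"
  shows "ord r \<le> ord (join r s)" "ord (join r s) \<le> ord r \<Longrightarrow> eff P Q (join r s)"
proof -
  note r = effD[OF assms(1)]
  have j: "fsep (join r s)" using fsep_join r(5) tangle_fsep[OF r(2) assms(2)] by blast
  have *: "prod.swap (join r s) \<in> P \<and> join r s \<in> Q" if "ord (join r s) \<le> ord r"
  proof
    show "join r s \<in> Q" using tangle_join[OF r(2) r(4) assms(2) r(4) that] .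
    show "prod.swap (join r s) \<in> P"
    proof (rule tangle_down[OF r(1) r(3) _ _ r(3)])
      show "fsep (prod.swap (join r s))" "ord (prod.swap (join r s)) \<le> ord (prod.swap r)"
        using j that by (simp_all only: fsep_swap ord_swap)
    qed (auto simp: join_def)
  qed
  then show "ord r \<le> ord (join r s)" using r(6)[of "join r s"] by (meson nat_le_linear)
  show "eff P Q (join r s)" if "ord (join r s) \<le> ord r"
    using eff_same_ord[OF assms(1), of "join r s"] *[OF that] that by simp
qed

text \<open>\<open>K\<close> is the component of the rest in which \<open>Q\<close> lives. Let
  \<open>Q\<close> shrink its big side as far as possible while keeping the separator
  \<open>Z\<close>. If the big side split into two parts, \<open>Q\<close> would either shrink
  further or contain three first sides covering the graph. A vertex of \<open>Z\<close> without
  neighbour in \<open>K\<close> could be dropped from the separator, against efficiency or again by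
  a cover.\<close>

lemma eff_full_component:
  assumes "eff P Q s"
  defines "Z \<equiv> fst s \<inter> snd s"
  shows "\<exists>K. K \<noteq> {} \<and> K \<subseteq> snd s - fst s \<and> (\<forall>u\<in>K. \<forall>v. E u v \<longrightarrow> v \<in> K \<or> v \<in> Z) \<and>
    (\<forall>u\<in>K. K \<subseteq> component Z u) \<and> (\<forall>z\<in>Z. \<exists>u\<in>K. E z u)"
proof -
  note s = effD[OF assms(1)]
  have finZ: "finite Z" and sep_s: "separation V E (fst s) (snd s)" using s(5) by (auto simp: fsep_def Z_def)
  then have ZV: "Z \<subseteq> V" by (auto simp: Z_def separation_def)
  define good where "good t \<longleftrightarrow> t \<in> Q \<and> fst s \<subseteq> fst t \<and> fst t \<inter> snd t = Z" for t
  have "good s" using s by (simp add: good_def Z_def)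
  then obtain t where t: "good t"
    and tmin: "\<And>t'. good t' \<Longrightarrow> card (nbrs Z \<inter> (snd t - fst t)) \<le> card (nbrs Z \<inter> (snd t' - fst t'))"
    using ex_has_least_nat[of good s "\<lambda>t. card (nbrs Z \<inter> (snd t - fst t))"] by blast
  obtain X Y where XY: "t = (X, Y)" by fastforce
  have tQ: "(X, Y) \<in> Q" and AX: "fst s \<subseteq> X" and int: "X \<inter> Y = Z" using t by (auto simp: good_def XY)
  have sep: "separation V E X Y" using tangle_fsep[OF s(2) tQ] by (simp add: fsep_def)
  then have XYV: "X \<union> Y = V" by (auto simp: separation_def)
  define K where "K = Y - X"
  have KB: "K \<subseteq> snd s - fst s" using AX sep_s XYV unfolding K_def separation_def by auto
  have finN: "finite (nbrs Z)" by (rule finite_nbrs[OF finZ ZV])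
  have ordZ: "ord (A', B') = ord s" if "A' \<inter> B' = Z" for A' B' using that by (simp add: ord_def Z_def)
  have ne: "K \<noteq> {}" using tangle_fst_proper[OF s(2) tQ] XYV unfolding K_def by auto
  have closed: "v \<in> K \<or> v \<in> Z" if "u \<in> K" "E u v" for u v
    using that separation_edge[OF sep that(2)] int unfolding K_def by blast
  have full: "\<exists>u\<in>K. E z u" if z: "z \<in> Z" for z
  proof (rule ccontr)
    assume n: "\<not> ?thesis"
    have zX: "z \<in> X" using z int by blast
    have int': "X \<inter> (Y - {z}) = Z - {z}" using int by blast
    have f: "fsep (X, Y - {z})"
      unfolding fsep_def fst_conv snd_conv int'
    proof
      show "separation V E X (Y - {z})"
      proof (rule separationI)
        show "X \<union> (Y - {z}) = V" using XYV zX by blast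
        fix u v assume uv: "E u v" "u \<in> X - (Y - {z})" "v \<in> Y - {z} - X"
        have "u \<noteq> z" using n uv unfolding K_def by blast
        then show False using uv separation_edge[OF sep uv(1)] by blast
      qed
    qed (use finZ in auto)
    have lt: "ord (X, Y - {z}) < ord s"
      unfolding ord_def fst_conv snd_conv int' Z_def[symmetric] by (rule card_Diff1_less[OF finZ z])
    show False
    proof (cases "(X, Y - {z}) \<in> Q")
      case True
      have "prod.swap (X, Y - {z}) \<in> P"
      proof (rule tangle_down[OF s(1) s(3) _ _ s(3)])
        have "Y \<subseteq> snd s" using KB int unfolding K_def Z_def by blast
        then show "fst (prod.swap (X, Y - {z})) \<subseteq> fst (prod.swap s)" by auto
        show "fsep (prod.swap (X, Y - {z}))" using f by (simp only: fsep_swap)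
        show "ord (prod.swap (X, Y - {z})) \<le> ord (prod.swap s)" using lt by (simp only: ord_swap)
      qed
      then show False using s(6) True lt by (meson leD)
    next
      case False
      then have "prod.swap (X, Y - {z}) \<in> Q" using tangle_orient[OF s(2,4) f] lt by auto
      moreover have "covers3 V E (fst (X, Y)) (fst (prod.swap (X, Y - {z}))) (fst (X, Y))"
        unfolding covers3_def
      proof (intro conjI allI impI)
        show "fst (X, Y) \<union> fst (prod.swap (X, Y - {z})) \<union> fst (X, Y) = V" using XYV zX by auto
        fix u v assume uv: "E u v"
        have "u \<notin> K" if "v = z" using n uv E_sym that by blast
        moreover have "v \<notin> K" if "u = z" using n uv that by blast
        ultimately show "u \<in> fst (X, Y) \<and> v \<in> fst (X, Y) \<or>
            u \<in> fst (prod.swap (X, Y - {z})) \<and> v \<in> fst (prod.swap (X, Y - {z})) \<or>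
            u \<in> fst (X, Y) \<and> v \<in> fst (X, Y)"
          using separation_edge[OF sep uv] zX unfolding K_def by auto
      qed
      ultimately show False using tangle_cover[OF s(2) tQ _ tQ] by blast
    qed
  qed
  have connected: "K \<subseteq> component Z u" if u: "u \<in> K" for u
  proof (rule ccontr)
    assume n: "\<not> ?thesis"
    let ?L = "component Z u"
    have uZ: "u \<in> V - Z" using u KB int unfolding K_def using XYV by blast
    have LK: "?L \<subseteq> K"
    proof
      fix v assume "v \<in> ?L"
      then have "(u, v) \<in> (avoid ER Z)\<^sup>*" by (simp add: component_def)
      then show "v \<in> K"
      proof (induction rule: rtrancl_induct)
        case (step y w)
        then show ?case using closed[of y w] by (auto simp: avoid_def ER_def)
      qed (use u in auto)
    qed
    define K2 where "K2 = K - ?L"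
    have no_edge: "\<not> E v w" "\<not> E w v" if "v \<in> ?L" "w \<in> K2" for v w
      using that comp_closed[of u Z v w] uZ E_sym int unfolding K2_def K_def by blast+
    have leave: "nbrs Z \<inter> U \<noteq> {}" if U: "U \<noteq> {}" "U \<subseteq> K" "\<And>v w. v \<in> U \<Longrightarrow> E v w \<Longrightarrow> w \<in> U \<or> w \<in> Z" "\<exists>w\<in>K. w \<notin> U" for U
    proof
      assume e: "nbrs Z \<inter> U = {}"
      have "U = V"
      proof (rule connected_closed[OF U(1)])
        show "U \<subseteq> V" using U(2) KB sep_s unfolding separation_def by blast
        show "w \<in> U" if "v \<in> U" "E v w" for v w
          using U(3)[OF that] e that E_sym unfolding nbrs_def by blast
      qed
      then show False using U(4) KB sep_s unfolding separation_def by blast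
    qed
    have split: "fsep (X \<union> U, Z \<union> U') \<and> (X \<union> U) \<inter> (Z \<union> U') = Z"
      if "U \<union> U' = K" "U \<inter> U' = {}" "\<And>v w. v \<in> U \<Longrightarrow> w \<in> U' \<Longrightarrow> \<not> E v w" for U U'
    proof -
      have i: "(X \<union> U) \<inter> (Z \<union> U') = Z" using that int unfolding K_def by blast
      have "separation V E (X \<union> U) (Z \<union> U')"
      proof (rule separationI)
        show "X \<union> U \<union> (Z \<union> U') = V" using that(1) XYV int unfolding K_def by blast
        fix v w assume "E v w" "v \<in> X \<union> U - (Z \<union> U')" "w \<in> Z \<union> U' - (X \<union> U)"
        then show False using that separation_edge[OF sep, of v w] int unfolding K_def by blast
      qed
      then show ?thesis using i finZ by (simp add: fsep_def)
    qed
    have nin: "(X \<union> U, Z \<union> U') \<notin> Q"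
      if "U \<union> U' = K" "U \<inter> U' = {}" "nbrs Z \<inter> U \<noteq> {}" "\<And>v w. v \<in> U \<Longrightarrow> w \<in> U' \<Longrightarrow> \<not> E v w" for U U'
    proof
      assume q: "(X \<union> U, Z \<union> U') \<in> Q"
      have "good (X \<union> U, Z \<union> U')" unfolding good_def using q AX split[OF that(1,2,4)] by auto
      then have "card (nbrs Z \<inter> K) \<le> card (nbrs Z \<inter> (Z \<union> U' - (X \<union> U)))" using tmin unfolding XY K_def by fastforce
      moreover have "nbrs Z \<inter> (Z \<union> U' - (X \<union> U)) \<subset> nbrs Z \<inter> K" using that int unfolding K_def by blast
      ultimately show False using psubset_card_mono[of "nbrs Z \<inter> K"] finN by (meson finite_Int leD)
    qed
    have LK2: "?L \<union> K2 = K" "K2 \<union> ?L = K" "?L \<inter> K2 = {}" "K2 \<inter> ?L = {}" using LK unfolding K2_def by auto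
    have K2ne: "K2 \<noteq> {}" using n unfolding K2_def by blast
    have N1: "nbrs Z \<inter> ?L \<noteq> {}"
    proof (rule leave)
      show "?L \<noteq> {}" using comp_self by blast
      show "w \<in> ?L \<or> w \<in> Z" if "v \<in> ?L" "E v w" for v w using comp_closed[of u Z v w] uZ that by blast
      show "\<exists>w\<in>K. w \<notin> ?L" using K2ne unfolding K2_def by blast
    qed (rule LK)
    have N2: "nbrs Z \<inter> K2 \<noteq> {}"
    proof (rule leave)
      show "w \<in> K2 \<or> w \<in> Z" if "v \<in> K2" "E v w" for v w
        using closed[of v w] no_edge(2)[of w v] that unfolding K2_def by blast
      show "\<exists>w\<in>K. w \<notin> K2" using u comp_self[of u Z] unfolding K2_def by blast
      show "K2 \<subseteq> K" unfolding K2_def by blast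
    qed (rule K2ne)
    have s1: "fsep (X \<union> ?L, Z \<union> K2)" "(X \<union> ?L) \<inter> (Z \<union> K2) = Z" using split[OF LK2(1,3)] no_edge by auto
    have s2: "fsep (X \<union> K2, Z \<union> ?L)" "(X \<union> K2) \<inter> (Z \<union> ?L) = Z" using split[OF LK2(2,4)] no_edge by auto
    have "(X \<union> ?L, Z \<union> K2) \<notin> Q" using nin[OF LK2(1,3) N1] no_edge by blast
    then have q1: "(Z \<union> K2, X \<union> ?L) \<in> Q" using tangle_orient[OF s(2,4) s1(1)] ordZ[OF s1(2)] by auto
    have "(X \<union> K2, Z \<union> ?L) \<notin> Q" using nin[OF LK2(2,4) N2] no_edge by blast
    then have q2: "(Z \<union> ?L, X \<union> K2) \<in> Q" using tangle_orient[OF s(2,4) s2(1)] ordZ[OF s2(2)] by auto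
    have "covers3 V E (fst (X, Y)) (fst (Z \<union> K2, X \<union> ?L)) (fst (Z \<union> ?L, X \<union> K2))"
      unfolding covers3_def
    proof (intro conjI allI impI)
      have Y: "Y = Z \<union> K2 \<union> ?L" using LK2(1) int unfolding K_def by blast
      show "fst (X, Y) \<union> fst (Z \<union> K2, X \<union> ?L) \<union> fst (Z \<union> ?L, X \<union> K2) = V" using XYV Y int by auto
      fix v w assume vw: "E v w"
      show "v \<in> fst (X, Y) \<and> w \<in> fst (X, Y) \<or> v \<in> fst (Z \<union> K2, X \<union> ?L) \<and> w \<in> fst (Z \<union> K2, X \<union> ?L) \<or>
          v \<in> fst (Z \<union> ?L, X \<union> K2) \<and> w \<in> fst (Z \<union> ?L, X \<union> K2)"
        using separation_edge[OF sep vw] no_edge[of v w] no_edge[of w v] vw Y by auto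
    qed
    then show False using tangle_cover[OF s(2) tQ q1 q2] by blast
  qed
  show ?thesis using ne KB closed connected full by (intro exI[of _ K]) auto
qed

end

section \<open>Finiteness of crossing\<close>

context lf_graph
begin

text \<open>\<open>R\<close> holds the vertices deleted so far in the induction; \<open>Z\<close> is
  inclusion-minimal among the sets that complete \<open>R\<close> to a separator of u and v.\<close>

definition min_separator :: "'a set \<Rightarrow> 'a \<Rightarrow> 'a \<Rightarrow> 'a set \<Rightarrow> bool" where
  "min_separator R u v Z \<longleftrightarrow> finite Z \<and> Z \<inter> R = {} \<and> (u, v) \<notin> (avoid ER (R \<union> Z))\<^sup>* \<and>
     (\<forall>z\<in>Z. (u, v) \<in> (avoid ER (R \<union> Z - {z}))\<^sup>*)"

text \<open>Any separator meets a fixed finite walk from u to v. Moving a vertex where it does so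
  from \<open>Z\<close> to \<open>R\<close> keeps minimality and lowers the size, leaving finitely
  many choices at each step. If \<open>R\<close> separates already, only the empty set is
  minimal.\<close>

lemma min_separator_finite: "finite {Z. min_separator R u v Z \<and> card Z \<le> k}"
proof (induction k arbitrary: R)
  case 0
  have "{Z. min_separator R u v Z \<and> card Z \<le> 0} \<subseteq> {{}}" by (auto simp: min_separator_def)
  then show ?case by (rule finite_subset) simp
next
  case (Suc k)
  show ?case
  proof (cases "(u, v) \<in> (avoid ER R)\<^sup>*")
    case False
    have "{Z. min_separator R u v Z \<and> card Z \<le> Suc k} \<subseteq> {{}}"
    proof
      fix Z assume "Z \<in> {Z. min_separator R u v Z \<and> card Z \<le> Suc k}"
      then have Z: "min_separator R u v Z" by blast
      have "Z = {}"
      proof (rule ccontr)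
        assume "Z \<noteq> {}"
        then obtain z where z: "z \<in> Z" by blast
        then have "(u, v) \<in> (avoid ER (R \<union> Z - {z}))\<^sup>*" using Z unfolding min_separator_def by blast
        moreover have "R \<subseteq> R \<union> Z - {z}" using Z z unfolding min_separator_def by blast
        ultimately show False using False rtrancl_mono[OF avoid_mono[of ER ER R "R \<union> Z - {z}"]] by blast
      qed
      then show "Z \<in> {{}}" by blast
    qed
    then show ?thesis by (rule finite_subset) simp
  next
    case True
    from rtrancl_finite_subset[OF this] obtain F0 where F0: "finite F0" "F0 \<subseteq> avoid ER R" "(u, v) \<in> F0\<^sup>*" by blast
    have "{Z. min_separator R u v Z \<and> card Z \<le> Suc k} \<subseteq>
      (\<Union>z\<in>Field F0. insert z ` {Z. min_separator (insert z R) u v Z \<and> card Z \<le> k})"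
    proof
      fix Z assume "Z \<in> {Z. min_separator R u v Z \<and> card Z \<le> Suc k}"
      then have Z: "min_separator R u v Z" "card Z \<le> Suc k" by blast+
      have "Z \<inter> Field F0 \<noteq> {}"
      proof
        assume e: "Z \<inter> Field F0 = {}"
        have "F0 \<subseteq> avoid ER (R \<union> Z)"
        proof
          fix p assume p: "p \<in> F0"
          then have "fst p \<in> Field F0" "snd p \<in> Field F0" by (auto simp: Field_def Domain_fst Range_snd)
          then show "p \<in> avoid ER (R \<union> Z)" using e F0(2) p by (auto simp: avoid_def)
        qed
        then show False using F0(3) Z(1) rtrancl_mono unfolding min_separator_def by blast
      qed
      then obtain z where z: "z \<in> Z" "z \<in> Field F0" by blast
      have "min_separator (insert z R) u v (Z - {z})"
        unfolding min_separator_def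
      proof (intro conjI ballI)
        have e: "insert z R \<union> (Z - {z}) = R \<union> Z" using z by blast
        show "(u, v) \<notin> (avoid ER (insert z R \<union> (Z - {z})))\<^sup>*" using Z(1) unfolding e min_separator_def by blast
        show "(u, v) \<in> (avoid ER (insert z R \<union> (Z - {z}) - {y}))\<^sup>*" if "y \<in> Z - {z}" for y
          using Z(1) that unfolding e min_separator_def by blast
      qed (use Z(1) in \<open>auto simp: min_separator_def\<close>)
      moreover have "card (Z - {z}) \<le> k" using Z z by (simp add: min_separator_def)
      ultimately show "Z \<in> (\<Union>z\<in>Field F0. insert z ` {Z. min_separator (insert z R) u v Z \<and> card Z \<le> k})"
        using z by (intro UN_I[of z]) (auto intro!: image_eqI[of _ _ "Z - {z}"])
    qed
    moreover have "finite (\<Union>z\<in>Field F0. insert z ` {Z. min_separator (insert z R) u v Z \<and> card Z \<le> k})"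
      using Suc.IH F0(1) by (simp add: finite_Field)
    ultimately show ?thesis by (rule finite_subset)
  qed
qed

lemma component_side:
  assumes sep: "separation V E A B" and "A \<inter> B = Z" "u \<in> A - B"
  shows "component Z u \<subseteq> A - B"
proof
  fix v assume "v \<in> component Z u"
  then have "(u, v) \<in> (avoid ER Z)\<^sup>*" by (simp add: component_def)
  then show "v \<in> A - B"
  proof (induction rule: rtrancl_induct)
    case (step y w)
    then have "E y w" "w \<notin> Z" by (auto simp: avoid_def ER_def)
    then show ?case using separation_edge[OF sep] step assms(2) by blast
  qed (use assms in auto)
qed

text \<open>Both sides contain a component attached to the whole separator. Neighbours of x in these
  two components are separated, and restoring any vertex of the separator reconnects them.\<close>

lemma eff_min_separator:
  assumes "eff P Q s" "x \<in> fst s \<inter> snd s"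
  shows "\<exists>u\<in>nbrs {x}. \<exists>v\<in>nbrs {x}. min_separator {} u v (fst s \<inter> snd s)"
proof -
  let ?Z = "fst s \<inter> snd s"
  note s = effD[OF assms(1)]
  have sep: "separation V E (fst s) (snd s)" "finite ?Z" using s(5) by (auto simp: fsep_def)
  obtain K where K: "K \<noteq> {}" "K \<subseteq> snd s - fst s" "\<forall>u\<in>K. K \<subseteq> component ?Z u" "\<forall>z\<in>?Z. \<exists>u\<in>K. E z u"
    using eff_full_component[OF assms(1)] by blast
  have "eff Q P (prod.swap s)" using assms(1) eff_swap by blast
  from eff_full_component[OF this]
  obtain L where L: "L \<noteq> {}" "L \<subseteq> fst s - snd s" "\<forall>u\<in>L. L \<subseteq> component ?Z u" "\<forall>z\<in>?Z. \<exists>u\<in>L. E z u"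
    by (simp add: Int_commute) blast
  obtain u v where uv: "u \<in> L" "E x u" "v \<in> K" "E x v" using K L assms(2) by blast
  have "min_separator {} u v ?Z" unfolding min_separator_def
  proof (intro conjI ballI)
    have "component ?Z u \<subseteq> fst s - snd s" by (rule component_side[OF sep(1)]) (use L uv in auto)
    then show "(u, v) \<notin> (avoid ER ({} \<union> ?Z))\<^sup>*" using K uv by (auto simp: component_def)
    fix z assume z: "z \<in> ?Z"
    obtain u' v' where uv': "u' \<in> L" "E z u'" "v' \<in> K" "E z v'" using K L z by blast
    have m: "(avoid ER ?Z)\<^sup>* \<subseteq> (avoid ER (?Z - {z}))\<^sup>*" by (rule rtrancl_mono[OF avoid_mono]) auto
    have "(u, u') \<in> (avoid ER (?Z - {z}))\<^sup>*" using L(3) uv uv' m unfolding component_def by blast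
    moreover have "(u', z) \<in> avoid ER (?Z - {z})" using uv' L(2) E_sym by (auto simp: avoid_def ER_def)
    moreover have "(z, v') \<in> avoid ER (?Z - {z})" using uv' K(2) by (auto simp: avoid_def ER_def)
    moreover have "(v', v) \<in> (avoid ER (?Z - {z}))\<^sup>*" using K(3) uv uv' m unfolding component_def by blast
    ultimately have "(u, v) \<in> (avoid ER (?Z - {z}))\<^sup>*"
      by (meson converse_rtrancl_into_rtrancl rtrancl_into_rtrancl rtrancl_trans)
    then show "(u, v) \<in> (avoid ER ({} \<union> ?Z - {z}))\<^sup>*" by simp
  qed (use sep in auto)
  then show ?thesis using uv by (auto simp: nbrs_def)
qed

text \<open>Every component of the rest contains a neighbour of \<open>Z\<close>, so the neighbours
  of \<open>Z\<close> on the first side determine that side.\<close>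

lemma finite_separations_with_separator:
  assumes "finite Z" "Z \<subseteq> V" "Z \<noteq> {}"
  shows "finite {s. separation V E (fst s) (snd s) \<and> fst s \<inter> snd s = Z}" (is "finite ?S")
proof -
  have sub: "fst s \<subseteq> fst t" if s: "s \<in> ?S" and t: "t \<in> ?S" and e: "fst s \<inter> nbrs Z = fst t \<inter> nbrs Z" for s t
  proof (rule ccontr)
    assume n: "\<not> fst s \<subseteq> fst t"
    let ?U = "fst s - fst t"
    have ss: "separation V E (fst s) (snd s)" "fst s \<inter> snd s = Z" using s by auto
    have tt: "separation V E (fst t) (snd t)" "fst t \<inter> snd t = Z" using t by auto
    have "?U = V"
    proof (rule connected_closed)
      show "?U \<noteq> {}" using n by blast
      show "?U \<subseteq> V" using ss unfolding separation_def by blast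
      fix u v assume u: "u \<in> ?U" "E u v"
      have u1: "u \<notin> snd s" using u ss tt by blast
      then have v1: "v \<in> fst s" using separation_edge[OF ss(1) u(2)] by blast
      have v2: "v \<in> snd t" using separation_edge[OF tt(1) u(2)] u by blast
      have "v \<notin> Z"
      proof
        assume "v \<in> Z"
        then have "u \<in> nbrs Z" using u E_sym by (auto simp: nbrs_def)
        then show False using e u by blast
      qed
      then show "v \<in> ?U" using v1 v2 tt by blast
    qed
    then show False using assms(2,3) tt by blast
  qed
  have "inj_on (\<lambda>s. fst s \<inter> nbrs Z) ?S"
  proof (rule inj_onI)
    fix s t assume st: "s \<in> ?S" "t \<in> ?S" "fst s \<inter> nbrs Z = fst t \<inter> nbrs Z"
    then have e: "fst s = fst t" using sub[of s t] sub[of t s] by blast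
    have "snd u = (V - fst u) \<union> Z" if "u \<in> ?S" for u using that by (auto simp: separation_def)
    from this[OF st(1)] this[OF st(2)] show "s = t" using e by (simp add: prod_eq_iff)
  qed
  moreover have "finite ((\<lambda>s. fst s \<inter> nbrs Z) ` ?S)"
    by (rule finite_subset[of _ "Pow (nbrs Z)"]) (use finite_nbrs[OF assms(1,2)] in auto)
  ultimately show ?thesis by (rule finite_imageD[rotated])
qed

lemma finite_relevant_through: "finite {s. relevant s \<and> ord s \<le> k \<and> x \<in> fst s \<inter> snd s}"
proof -
  let ?ZZ = "\<Union>u\<in>nbrs {x}. \<Union>v\<in>nbrs {x}. {Z. min_separator {} u v Z \<and> card Z \<le> k}"
  let ?T = "\<lambda>Z. {s. separation V E (fst s) (snd s) \<and> fst s \<inter> snd s = Z}"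
  show ?thesis
  proof (cases "x \<in> V")
    case True
    have "{s. relevant s \<and> ord s \<le> k \<and> x \<in> fst s \<inter> snd s} \<subseteq> (\<Union>Z\<in>{Z \<in> ?ZZ. finite Z \<and> Z \<subseteq> V \<and> Z \<noteq> {}}. ?T Z)"
    proof
      fix s assume s: "s \<in> {s. relevant s \<and> ord s \<le> k \<and> x \<in> fst s \<inter> snd s}"
      then obtain P Q where "eff P Q s" unfolding relevant_def by blast
      then obtain u v where "u \<in> nbrs {x}" "v \<in> nbrs {x}" "min_separator {} u v (fst s \<inter> snd s)"
        using eff_min_separator[of P Q s x] s by blast
      moreover have "separation V E (fst s) (snd s)" "finite (fst s \<inter> snd s)" "fst s \<inter> snd s \<subseteq> V"
        using relevant_fsep[of s] s by (auto simp: fsep_def separation_def)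
      ultimately show "s \<in> (\<Union>Z\<in>{Z \<in> ?ZZ. finite Z \<and> Z \<subseteq> V \<and> Z \<noteq> {}}. ?T Z)"
        using s unfolding ord_def by blast
    qed
    moreover have "finite ?ZZ" using finite_nbrs[of "{x}"] True min_separator_finite by auto
    then have "finite {Z \<in> ?ZZ. finite Z \<and> Z \<subseteq> V \<and> Z \<noteq> {}}"
      by (rule finite_subset[rotated]) blast
    then have "finite (\<Union>Z\<in>{Z \<in> ?ZZ. finite Z \<and> Z \<subseteq> V \<and> Z \<noteq> {}}. ?T Z)"
      by (rule finite_UN_I) (use finite_separations_with_separator in blast)
    ultimately show ?thesis by (rule finite_subset)
  next
    case False
    then have "\<not> (relevant s \<and> x \<in> fst s \<inter> snd s)" for s
      using relevant_proper(1)[of s] by blast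
    then have "{s. relevant s \<and> ord s \<le> k \<and> x \<in> fst s \<inter> snd s} = {}" by simp
    then show ?thesis by (simp only: finite.emptyI)
  qed
qed

text \<open>The component \<open>K\<close> attached to the separator of s, together with that
  separator, is connected and misses \<open>A \<inter> B\<close>, so it lies strictly on one side of
  \<open>(A, B)\<close>. Vertices of \<open>snd s\<close> on the other side would then form a set
  closed under adjacency; so \<open>snd s\<close> lies on one side entirely.\<close>

lemma eff_nested_if_avoids:
  assumes "eff P Q s" and sep: "separation V E A B" and d: "A \<inter> B \<subseteq> fst s - snd s"
  shows "nested (A, B) s"
proof -
  let ?Z = "fst s \<inter> snd s" and ?D = "snd s"
  note s = effD[OF assms(1)]
  have seps: "separation V E (fst s) (snd s)" using s(5) by (auto simp: fsep_def)
  obtain K where K: "K \<noteq> {}" "K \<subseteq> snd s - fst s" "\<forall>u\<in>K. K \<subseteq> component ?Z u" "\<forall>z\<in>?Z. \<exists>u\<in>K. E z u"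
    using eff_full_component[OF assms(1)] by blast
  have side: "?D \<subseteq> A' - B'" if sep': "separation V E A' B'" and d': "A' \<inter> B' \<subseteq> fst s - snd s" and k: "k \<in> K" "k \<in> A' - B'" for A' B' k
  proof -
    have KA: "K \<subseteq> A' - B'"
    proof
      fix v assume v: "v \<in> K"
      have "(k, v) \<in> (avoid ER ?Z)\<^sup>*" using K(3) k v unfolding component_def by blast
      then have "v \<in> A' - B' \<and> v \<in> snd s - fst s"
      proof (induction rule: rtrancl_induct)
        case (step y w)
        then have yw: "E y w" "w \<notin> ?Z" by (auto simp: avoid_def ER_def)
        then have "w \<in> snd s - fst s" using separation_edge[OF seps yw(1)] step by blast
        then show ?case using separation_edge[OF sep' yw(1)] step d' by blast
      qed (use k K in auto)
      then show "v \<in> A' - B'" by blast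
    qed
    have ZA: "?Z \<subseteq> A' - B'"
    proof
      fix z assume z: "z \<in> ?Z"
      then obtain u where u: "u \<in> K" "E z u" using K by blast
      then show "z \<in> A' - B'" using separation_edge[OF sep' u(2)] KA d' z by blast
    qed
    show ?thesis
    proof (rule ccontr)
      assume n: "\<not> ?thesis"
      let ?U = "(?D - fst s) \<inter> (B' - A')"
      have "?U = V"
      proof (rule connected_closed)
        obtain d where d: "d \<in> ?D" "d \<notin> A' - B'" using n by blast
        then have "d \<in> A' \<union> B'" using seps sep' unfolding separation_def by blast
        then have "d \<in> B' - A'" using d d' by blast
        then show "?U \<noteq> {}" using ZA d by blast
        show "?U \<subseteq> V" using seps unfolding separation_def by blast
        fix u v assume uv: "u \<in> ?U" "E u v"
        have "v \<in> ?D" using separation_edge[OF seps uv(2)] uv by blast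
        moreover have "v \<in> B' - A'" using separation_edge[OF sep' uv(2)] uv calculation d' by blast
        ultimately show "v \<in> ?U" using ZA by blast
      qed
      then show False using k K seps unfolding separation_def by blast
    qed
  qed
  obtain k where k: "k \<in> K" using K by blast
  have swapsep: "separation V E B A" using sep E_sym unfolding separation_def by blast
  have U: "A \<union> B = V" "fst s \<union> snd s = V" using sep seps unfolding separation_def by auto
  have kV: "k \<in> A \<union> B" "k \<notin> A \<inter> B" using k K(2) U d by auto
  show ?thesis
  proof (cases "k \<in> A")
    case True
    then have "?D \<subseteq> A - B" using side[OF sep d k] kV by blast
    then have "osep_le (prod.swap (A, B)) s" using U unfolding osep_le_def by auto
    then show ?thesis unfolding nested_def by blast
  next
    case False
    then have "?D \<subseteq> B - A" using side[OF swapsep _ k] kV d by blast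
    then have "osep_le (A, B) s" using U unfolding osep_le_def by auto
    then show ?thesis unfolding nested_def by blast
  qed
qed

lemma ER_connected: "x \<in> V \<Longrightarrow> y \<in> V \<Longrightarrow> (x, y) \<in> ER\<^sup>*"
proof -
  assume x: "x \<in> V" and y: "y \<in> V"
  have "{z. (x, z) \<in> ER\<^sup>*} = V"
  proof (rule connected_closed)
    show "{z. (x, z) \<in> ER\<^sup>*} \<subseteq> V"
      using avoid_ER_V[of x _ "{}"] x by (auto simp: avoid_def)
  qed (auto simp: ER_def intro: rtrancl_into_rtrancl)
  then show ?thesis using y by blast
qed

text \<open>Enlarge the separator of r to a finite connected set \<open>X\<close> by walks from one
  vertex. If the separator of a relevant s misses \<open>X\<close>, then \<open>A \<inter> B\<close>
  lies strictly on one side of s and s is nested with r; every other s passes through one of the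
  finitely many vertices of \<open>X\<close>.\<close>

lemma finite_crossing:
  assumes "fsep r"
  shows "finite {s. relevant s \<and> ord s \<le> k \<and> \<not> nested r s}"
proof -
  obtain A B where r: "r = (A, B)" by fastforce
  have sep: "separation V E A B" "finite (A \<inter> B)" using assms by (auto simp: fsep_def r)
  obtain x0 where x0: "x0 \<in> V" using V_nonempty by blast
  have "\<exists>F0. finite F0 \<and> F0 \<subseteq> ER \<and> (x0, z) \<in> F0\<^sup>*" if "z \<in> A \<inter> B" for z
    using rtrancl_finite_subset[OF ER_connected[OF x0]] that sep unfolding separation_def by blast
  then obtain F0 where F0: "\<And>z. z \<in> A \<inter> B \<Longrightarrow> finite (F0 z) \<and> F0 z \<subseteq> ER \<and> (x0, z) \<in> (F0 z)\<^sup>*" by metis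
  define X where "X = insert x0 (\<Union>z\<in>A \<inter> B. Field (F0 z))"
  have finX: "finite X" using F0 sep by (auto simp: X_def finite_Field)
  have reach: "(x0, z) \<in> (avoid ER S)\<^sup>*" if "S \<inter> X = {}" "z \<in> A \<inter> B" for S z
  proof -
    have "F0 z \<subseteq> avoid ER S"
    proof
      fix p assume p: "p \<in> F0 z"
      then have "fst p \<in> X" "snd p \<in> X" using that(2) by (auto simp: X_def Field_def Domain_fst Range_snd)
      then show "p \<in> avoid ER S" using F0[OF that(2)] p that(1) by (auto simp: avoid_def)
    qed
    then show ?thesis using F0[OF that(2)] rtrancl_mono by blast
  qed
  have nest: "nested r s" if rel: "relevant s" and "fst s \<inter> snd s \<inter> X = {}" "x0 \<in> fst s" for s
  proof -
    obtain P Q where e: "eff P Q s" using rel unfolding relevant_def by blast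
    have seps: "separation V E (fst s) (snd s)" using relevant_fsep[OF rel] by (simp add: fsep_def)
    have "x0 \<in> fst s - snd s" using that by (auto simp: X_def)
    then have "component (fst s \<inter> snd s) x0 \<subseteq> fst s - snd s" using component_side[OF seps] by blast
    then have "A \<inter> B \<subseteq> fst s - snd s" using reach[OF that(2)] unfolding component_def by blast
    then show ?thesis using eff_nested_if_avoids[OF e sep(1)] r by blast
  qed
  have "{s. relevant s \<and> ord s \<le> k \<and> \<not> nested r s} \<subseteq> (\<Union>x\<in>X. {s. relevant s \<and> ord s \<le> k \<and> x \<in> fst s \<inter> snd s})"
  proof
    fix s assume s: "s \<in> {s. relevant s \<and> ord s \<le> k \<and> \<not> nested r s}"
    have "fst s \<inter> snd s \<inter> X \<noteq> {}"
    proof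
      assume e: "fst s \<inter> snd s \<inter> X = {}"
      have "x0 \<in> fst s \<or> x0 \<in> snd s" using x0 relevant_union[of s] s by blast
      then show False using nest[of s] nest[of "prod.swap s"] e s by (auto simp: Int_commute)
    qed
    then show "s \<in> (\<Union>x\<in>X. {s. relevant s \<and> ord s \<le> k \<and> x \<in> fst s \<inter> snd s})" using s by blast
  qed
  moreover have "finite (\<Union>x\<in>X. {s. relevant s \<and> ord s \<le> k \<and> x \<in> fst s \<inter> snd s})"
    using finX finite_relevant_through by blast
  ultimately show ?thesis by (rule finite_subset)
qed

end

section \<open>A canonical nested set of separations\<close>

lemma join_commute: "join r s = join s r"
  by (auto simp: join_def)

context lf_graph
begin

text \<open>Both tangles of s orient r alike. If one of the joins of r with s or its reverse has
  order at most \<open>ord s\<close>, it can replace s. Otherwise, by submodularity, the two corners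
  inside \<open>fst r\<close> have order less than r; since r is efficient, \<open>P\<close>
  contains them oriented as small, and together with the reverse of r they cover the graph.\<close>

lemma uncross_lower_aux:
  assumes r: "eff P P' r" and s: "eff Q Q' s" and lt: "ord r < ord s" and rQ': "r \<in> Q'" and cr: "\<not> nested s r"
  shows "\<exists>c. eff Q Q' c \<and> nested r c \<and> (\<forall>t. nested t r \<longrightarrow> nested t s \<longrightarrow> nested t c)"
proof -
  note R = effD[OF r] and S = effD[OF s]
  have rQ: "r \<in> Q"
  proof (rule ccontr)
    assume "r \<notin> Q"
    then have "prod.swap r \<in> Q" using tangle_orient[OF S(1) S(3) R(5)] lt by simp
    then show False using S(6)[OF _ rQ'] lt by simp
  qed
  have s': "eff Q' Q (prod.swap s)" using s eff_swap by blast
  show ?thesis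
  proof (cases "ord (join s r) \<le> ord s")
    case True
    then have "eff Q Q' (join s r)" using eff_join(2)[OF s rQ'] by blast
    moreover have "nested t (join s r)" if "nested t r" "nested t s" for t
      using nested_join_both[OF that(2,1) cr] .
    ultimately show ?thesis using nested_join(2)[of r s] by blast
  next
    case n1: False
    show ?thesis
    proof (cases "ord (join (prod.swap s) r) \<le> ord s")
      case True
      then have "eff Q' Q (join (prod.swap s) r)" using eff_join(2)[OF s' rQ] by simp
      then have "eff Q Q' (prod.swap (join (prod.swap s) r))" using eff_swap by blast
      moreover have "nested t (join (prod.swap s) r)" if "nested t r" "nested t s" for t
        using nested_join_both[of t "prod.swap s" r] that cr by simp
      ultimately show ?thesis using nested_join(2)[of r "prod.swap s"]
        by (intro exI[of _ "prod.swap (join (prod.swap s) r)"]) (simp del: swap_simp)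
    next
      case n2: False
      let ?c1 = "join (prod.swap s) (prod.swap r)" and ?c2 = "join s (prod.swap r)"
      have fin: "finite (fst r \<inter> snd r)" "finite (fst s \<inter> snd s)" using R(5) S(5) by (auto simp: fsep_def)
      have o1: "ord ?c1 < ord r" using ord_join_submodular[OF fin(2,1)] n1 by simp
      have o2: "ord ?c2 < ord r"
        using ord_join_submodular[of "prod.swap s" r] fin n2 by (simp add: Int_commute)
      have f: "fsep ?c1" "fsep ?c2" using R(5) S(5) by (auto intro!: fsep_join simp del: swap_simp)
      have in_P: "prod.swap c \<in> P" if c: "ord c < ord r" "fsep c" "snd c \<subseteq> fst r" for c
      proof (rule ccontr)
        assume "prod.swap c \<notin> P"
        then have "c \<in> P" using tangle_orient[OF R(1) R(3) c(2)] c(1) by simp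
        moreover have "prod.swap c \<in> P'"
          by (rule tangle_down[OF R(2) R(4) _ _ R(4)]) (use c in auto)
        ultimately show False using R(6)[of "prod.swap c"] c(1) by simp
      qed
      have p: "prod.swap ?c1 \<in> P" "prod.swap ?c2 \<in> P"
        by (rule in_P[OF o1 f(1)], simp add: join_def, rule in_P[OF o2 f(2)], simp add: join_def)
      have "covers3 V E (fst (prod.swap r)) (fst (prod.swap ?c1)) (fst (prod.swap ?c2))"
        using R(5) S(5) separation_edge[of "fst r" "snd r"] separation_edge[of "fst s" "snd s"]
        unfolding covers3_def join_def fsep_def by (auto simp: separation_def)
      then show ?thesis using tangle_cover[OF R(1) R(3) p] by blast
    qed
  qed
qed

lemma uncross_lower:
  assumes r: "relevant r" and s: "eff Q Q' s" and lt: "ord r < ord s" and cr: "\<not> nested s r"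
  shows "\<exists>c. eff Q Q' c \<and> nested r c \<and> (\<forall>t. nested t r \<longrightarrow> nested t s \<longrightarrow> nested t c)"
proof -
  obtain P P' where e: "eff P P' r" using r unfolding relevant_def by blast
  then have e': "eff P' P (prod.swap r)" using eff_swap by blast
  note S = effD[OF s]
  have "r \<in> Q' \<or> prod.swap r \<in> Q'" using tangle_orient[OF S(2) S(4) relevant_fsep[OF r]] lt by simp
  then show ?thesis
  proof
    assume "r \<in> Q'"
    then show ?thesis using uncross_lower_aux[OF e s lt _ cr] by blast
  next
    assume "prod.swap r \<in> Q'"
    then show ?thesis using uncross_lower_aux[OF e' s _ _] lt cr by simp
  qed
qed

text \<open>Neither corner can have smaller order than the efficient separation that it replaces,
  while submodularity bounds the sum; so both orders stay the same.\<close>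

lemma uncross_equal:
  assumes r: "eff P P' r" and s: "eff Q Q' s" and eq: "ord r = ord s"
    and sP: "prod.swap s \<in> P'" and rQ: "prod.swap r \<in> Q'"
  shows "eff P P' (join r (prod.swap s))" "eff Q Q' (join s (prod.swap r))"
    "ord (join r (prod.swap s)) = ord r" "ord (join s (prod.swap r)) = ord s"
proof -
  note R = effD[OF r] and S = effD[OF s]
  have fin: "finite (fst r \<inter> snd r)" "finite (fst (prod.swap s) \<inter> snd (prod.swap s))"
    using R(5) S(5) by (auto simp: fsep_def Int_commute)
  have sum: "ord (join r (prod.swap s)) + ord (join s (prod.swap r)) \<le> ord r + ord s"
    using ord_join_submodular[OF fin] by (simp add: join_commute[of "prod.swap r" s] del: swap_simp)
  note j1 = eff_join[OF r sP] and j2 = eff_join[OF s rQ]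
  show "ord (join r (prod.swap s)) = ord r" "ord (join s (prod.swap r)) = ord s" using sum j1(1) j2(1) by auto
  then show "eff P P' (join r (prod.swap s))" "eff Q Q' (join s (prod.swap r))" using j1(2) j2(2) by auto
qed

section \<open>Crossing numbers and best choices\<close>

definition cross :: "nat \<Rightarrow> 'a set \<times> 'a set \<Rightarrow> ('a set \<times> 'a set) set" where
  "cross k s = {t. relevant t \<and> ord t = k \<and> \<not> nested s t}"

lemma cross_swap [simp]: "cross k (prod.swap s) = cross k s"
  by (simp add: cross_def)

lemma cross_finite: "fsep s \<Longrightarrow> finite (cross k s)"
  using finite_crossing[of s k] by (rule rev_finite_subset) (auto simp: cross_def)

text \<open>A separation crossing one of the corners crosses r or s, and one crossing both corners
  crosses both r and s. The inequality is strict because r itself is counted: it crosses s but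
  neither corner.\<close>

lemma cross_join_less:
  assumes "fsep r" "fsep s" "relevant r" "ord r = k" "\<not> nested r s"
  shows "card (cross k (join r s)) + card (cross k (join (prod.swap r) (prod.swap s))) < card (cross k r) + card (cross k s)"
proof -
  let ?c = "join r s" and ?d = "join (prod.swap r) (prod.swap s)"
  have fin: "finite (cross k r)" "finite (cross k s)" "finite (cross k ?c)" "finite (cross k ?d)"
    using assms by (auto intro!: cross_finite fsep_join simp del: swap_simp)
  have sub1: "cross k ?c \<union> cross k ?d \<subseteq> cross k r \<union> cross k s"
  proof
    fix t assume t: "t \<in> cross k ?c \<union> cross k ?d"
    show "t \<in> cross k r \<union> cross k s"
    proof (rule ccontr)
      assume "t \<notin> cross k r \<union> cross k s"
      then have "nested t r" "nested t s" using t nested_sym unfolding cross_def by blast+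
      then have "nested t ?c" "nested t ?d" 
        using nested_join_both[of t r s] nested_join_both[of t "prod.swap r" "prod.swap s"] assms(5) by simp_all
      then show False using t nested_sym unfolding cross_def by blast
    qed
  qed
  have "nested ?c r" "nested ?d r"
    using nested_join(1)[of r s] nested_join(1)[of "prod.swap r" "prod.swap s"] nested_sym[of r ?c]
      nested_sym[of r ?d] by simp_all
  then have "r \<notin> cross k ?c \<union> cross k ?d" by (simp add: cross_def)
  moreover have "r \<in> cross k r \<union> cross k s" using assms nested_sym[of r s] by (simp add: cross_def)
  ultimately have 1: "card (cross k ?c \<union> cross k ?d) < card (cross k r \<union> cross k s)"
    using sub1 fin by (intro psubset_card_mono) auto
  have "cross k ?c \<inter> cross k ?d \<subseteq> cross k r \<inter> cross k s"
  proof
    fix t assume t: "t \<in> cross k ?c \<inter> cross k ?d"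
    then have "\<not> nested t ?c" "\<not> nested t ?d" using nested_sym unfolding cross_def by blast+
    then have "\<not> nested t r" "\<not> nested t s" using nested_join_or[of t r s] by blast+
    then show "t \<in> cross k r \<inter> cross k s" using t nested_sym unfolding cross_def by blast
  qed
  then have 2: "card (cross k ?c \<inter> cross k ?d) \<le> card (cross k r \<inter> cross k s)" using fin by (intro card_mono) auto
  show ?thesis using 1 2 card_Un_Int[OF fin(3,4)] card_Un_Int[OF fin(1,2)] by simp
qed

definition cand :: "nat \<Rightarrow> ('a set \<times> 'a set) set \<Rightarrow> ('a set \<times> 'a set) set \<Rightarrow> ('a set \<times> 'a set) set \<Rightarrow>
    'a set \<times> 'a set \<Rightarrow> bool" where
  "cand k M P Q s \<longleftrightarrow> eff P Q s \<and> ord s = k \<and> (\<forall>t\<in>M. nested t s)"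

definition best :: "nat \<Rightarrow> ('a set \<times> 'a set) set \<Rightarrow> ('a set \<times> 'a set) set \<Rightarrow> ('a set \<times> 'a set) set \<Rightarrow>
    'a set \<times> 'a set \<Rightarrow> bool" where
  "best k M P Q s \<longleftrightarrow> cand k M P Q s \<and> (\<forall>s'. cand k M P Q s' \<longrightarrow> card (cross k s) \<le> card (cross k s'))"

text \<open>\<open>Nlt k\<close> consists of members of order less than k, so stage
  \<open>Suc k\<close> adds those of order exactly k, for all pairs of tangles at once.\<close>

primrec Nlt :: "nat \<Rightarrow> ('a set \<times> 'a set) set" where
  "Nlt 0 = {}"
| "Nlt (Suc k) = Nlt k \<union> {s. \<exists>P Q. best k (Nlt k) P Q s}"

definition N :: "('a set \<times> 'a set) set" where "N = (\<Union>k. Nlt k)"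

lemma cand_swap: "cand k M P Q s \<longleftrightarrow> cand k M Q P (prod.swap s)"
  unfolding cand_def using eff_swap[of P Q s] by simp

lemma best_swap: "best k M P Q s \<Longrightarrow> best k M Q P (prod.swap s)"
  unfolding best_def
proof (intro conjI allI impI)
  assume *: "cand k M P Q s \<and> (\<forall>s'. cand k M P Q s' \<longrightarrow> card (cross k s) \<le> card (cross k s'))"
  then show "cand k M Q P (prod.swap s)" using cand_swap by blast
  fix s' assume "cand k M Q P s'"
  then have "cand k M P Q (prod.swap s')" using cand_swap by blast
  then show "card (cross k (prod.swap s)) \<le> card (cross k s')" using * by (metis cross_swap)
qed

text \<open>Replacing r and s by two opposite corners keeps both pairs efficiently distinguished and
  preserves nestedness with \<open>M\<close>, yet lowers the sum of the crossing numbers; one of r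
  and s was not best.\<close>

lemma best_not_opposite:
  assumes r: "best k M P P' r" and s: "best k M Q Q' s" and cr: "\<not> nested r s"
    and sP: "prod.swap s \<in> P'" and rQ: "prod.swap r \<in> Q'"
  shows False
proof -
  have cr1: "cand k M P P' r" and cs: "cand k M Q Q' s" using r s unfolding best_def by blast+
  then have e: "eff P P' r" "eff Q Q' s" "ord r = k" "ord s = k" "\<forall>t\<in>M. nested t r" "\<forall>t\<in>M. nested t s"
    unfolding cand_def by blast+
  have eq: "ord r = ord s" using e by simp
  note u = uncross_equal[OF e(1,2) eq sP rQ]
  have "cand k M P P' (join r (prod.swap s))"
    unfolding cand_def using u(1,3) e cr by (auto intro!: nested_join_both simp del: swap_simp)
  moreover have "cand k M Q Q' (join s (prod.swap r))"
    unfolding cand_def using u(2,4) e cr nested_sym[of r s] by (auto intro!: nested_join_both simp del: swap_simp)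
  ultimately have "card (cross k r) + card (cross k s) \<le>
      card (cross k (join r (prod.swap s))) + card (cross k (join s (prod.swap r)))"
    using r s unfolding best_def by (meson add_mono)
  moreover have "relevant r" using e(1) unfolding relevant_def by blast
  then have "card (cross k (join r (prod.swap s))) + card (cross k (join (prod.swap r) s)) <
      card (cross k r) + card (cross k s)"
    using cross_join_less[of r "prod.swap s" k] effD(5)[OF e(1)] effD(5)[OF e(2)] e(3) cr by (simp del: swap_simp)
  ultimately show False by (simp add: join_commute[of s])
qed

text \<open>All four tangles orient both r and s, the orders being equal. The facts
  \<open>n1\<close> to \<open>n4\<close> say that tangles of different pairs never occupy opposite
  corners. What remains is reduced to the single pair P, P', whose own two tangles then occupy
  opposite corners.\<close>

lemma best_nested:
  assumes r: "best k M P P' r" and s: "best k M Q Q' s"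
  shows "nested r s"
proof (rule ccontr)
  assume cr: "\<not> nested r s"
  have cr1: "cand k M P P' r" and cs: "cand k M Q Q' s" using r s unfolding best_def by blast+
  then have e: "eff P P' r" "eff Q Q' s" "ord r = k" "ord s = k"
    unfolding cand_def by blast+
  note R = effD[OF e(1)] and S = effD[OF e(2)]
  have oP: "s \<in> P \<or> prod.swap s \<in> P" using tangle_orient[OF R(1,3) S(5)] e by simp
  have oP': "s \<in> P' \<or> prod.swap s \<in> P'" using tangle_orient[OF R(2,4) S(5)] e by simp
  have oQ: "r \<in> Q \<or> prod.swap r \<in> Q" using tangle_orient[OF S(1,3) R(5)] e by simp
  have oQ': "r \<in> Q' \<or> prod.swap r \<in> Q'" using tangle_orient[OF S(2,4) R(5)] e by simp
  have r': "best k M P' P (prod.swap r)" and s': "best k M Q' Q (prod.swap s)" using best_swap r s by blast+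
  have n1: "\<not> (prod.swap s \<in> P' \<and> prod.swap r \<in> Q')" using best_not_opposite[OF r s cr] by blast
  have n2: "\<not> (prod.swap s \<in> P \<and> r \<in> Q')" using best_not_opposite[OF r' s] cr by auto
  have n3: "\<not> (s \<in> P' \<and> prod.swap r \<in> Q)" using best_not_opposite[OF r s'] cr by auto
  have n4: "\<not> (s \<in> P \<and> r \<in> Q)" using best_not_opposite[OF r' s'] cr by auto
  \<comment> \<open>In the remaining case each of r and s distinguishes both pairs, so each is a best choice for either pair.\<close>
  have le: "card (cross k s) \<le> card (cross k t)" if "r \<in> Q' \<and> prod.swap r \<in> Q \<or> r \<in> Q \<and> prod.swap r \<in> Q'" "cross k t = cross k r" for t
  proof -
    have "cand k M Q Q' r \<or> cand k M Q Q' (prod.swap r)"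
      using that(1) eff_same_ord[OF e(2), of r] eff_same_ord[OF e(2), of "prod.swap r"] e cr1
      unfolding cand_def by auto
    then show ?thesis using s that(2) unfolding best_def by (metis cross_swap)
  qed
  have best_s: "best k M X Y t" if t: "cand k M X Y t" "cross k t = cross k s" and X: "X = P \<and> Y = P' \<or> X = P' \<and> Y = P"
    and q: "r \<in> Q' \<and> prod.swap r \<in> Q \<or> r \<in> Q \<and> prod.swap r \<in> Q'" for X Y t
    unfolding best_def
  proof (intro conjI allI impI)
    fix s' assume "cand k M X Y s'"
    then have "cand k M P P' s' \<or> cand k M P P' (prod.swap s')" using X cand_swap by blast
    then have "card (cross k r) \<le> card (cross k s')" using r unfolding best_def by (metis cross_swap)
    then show "card (cross k t) \<le> card (cross k s')" using le[OF q refl] t(2) by simp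
  qed (rule t(1))
  show False
  proof (cases "s \<in> P'")
    case True
    then have q: "r \<in> Q" "prod.swap s \<in> P" "prod.swap r \<in> Q'" using n2 n3 n4 oQ oP oQ' by blast+
    have "cand k M P P' s" unfolding cand_def using eff_same_ord[OF e(1), of s] True q e cs by (auto simp: cand_def)
    then have b: "best k M P' P (prod.swap s)" using best_swap best_s[of P P' s] q by blast
    show False using best_not_opposite[OF r b] cr True R(3) by auto
  next
    case False
    then have q: "prod.swap s \<in> P'" "r \<in> Q'" "s \<in> P" "prod.swap r \<in> Q" using n1 n2 n4 oP' oP oQ oQ' by blast+
    have "cand k M P' P s" unfolding cand_def using eff_same_ord[of P' P "prod.swap r" s] eff_swap[of P P' r] q e cs by (auto simp: cand_def)
    then have b: "best k M P' P s" using best_s[of P' P s] q by blast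
    show False using best_not_opposite[OF r b] cr q R(3) by auto
  qed
qed

lemma Nlt_relevant: "s \<in> Nlt k \<Longrightarrow> relevant s \<and> ord s < k"
  by (induction k) (auto simp: best_def cand_def relevant_def)

lemma Nlt_nested: "s \<in> Nlt k \<Longrightarrow> t \<in> Nlt k \<Longrightarrow> nested s t"
proof (induction k)
  case (Suc k)
  have "nested u s" if "u \<in> Nlt k" "\<exists>P Q. best k (Nlt k) P Q s" for u s
    using that unfolding best_def cand_def by blast
  then show ?case using Suc best_nested nested_sym unfolding Nlt.simps by blast
qed auto

lemma Nlt_mono: "j \<le> k \<Longrightarrow> Nlt j \<subseteq> Nlt k"
  by (rule lift_Suc_mono_le[of Nlt]) auto

lemma N_nested: "s \<in> N \<Longrightarrow> t \<in> N \<Longrightarrow> nested s t"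
proof -
  assume "s \<in> N" "t \<in> N"
  then obtain i j where "s \<in> Nlt i" "t \<in> Nlt j" by (auto simp: N_def)
  then have "s \<in> Nlt (max i j)" "t \<in> Nlt (max i j)" using Nlt_mono[of i "max i j"] Nlt_mono[of j "max i j"] by auto
  then show ?thesis by (rule Nlt_nested)
qed

lemma N_relevant: "s \<in> N \<Longrightarrow> relevant s"
  using Nlt_relevant unfolding N_def by blast

lemma N_swap: "s \<in> N \<Longrightarrow> prod.swap s \<in> N"
proof -
  have "prod.swap s \<in> Nlt k" if "s \<in> Nlt k" for k using that
  proof (induction k)
    case (Suc k)
    then show ?case using best_swap unfolding Nlt.simps by blast
  qed simp
  then show "s \<in> N \<Longrightarrow> prod.swap s \<in> N" unfolding N_def by blast
qed

text \<open>Take an efficient separation crossing as few members of \<open>Nlt k\<close> as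
  possible, a finite number by \<open>finite_crossing\<close>. If it crossed t, uncrossing would
  make it nested with t without creating a new crossing in \<open>Nlt k\<close>.\<close>

lemma cand_exists:
  assumes "eff P Q s" "ord s = k"
  shows "\<exists>s'. cand k (Nlt k) P Q s'"
proof -
  let ?g = "\<lambda>s. eff P Q s \<and> ord s = k" and ?X = "\<lambda>s. {t \<in> Nlt k. \<not> nested s t}"
  have "?g s" using assms by blast
  from ex_has_least_nat[of ?g s "\<lambda>s. card (?X s)", OF this]
  obtain s' where s': "eff P Q s'" "ord s' = k"
    and m: "\<And>t. eff P Q t \<Longrightarrow> ord t = k \<Longrightarrow> card (?X s') \<le> card (?X t)" by blast
  have "nested t s'" if t: "t \<in> Nlt k" for t
  proof (rule ccontr)
    assume n: "\<not> nested t s'"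
    have rt: "relevant t" "ord t < ord s'" using Nlt_relevant[OF t] s' by auto
    obtain c where c: "eff P Q c" "nested t c" "\<And>u. nested u t \<Longrightarrow> nested u s' \<Longrightarrow> nested u c"
      using uncross_lower[OF rt(1) s'(1) rt(2)] n nested_sym by blast
    have oc: "ord c = k" using effD(6)[OF c(1)] effD(6)[OF s'(1)] effD(3,4)[OF c(1)] effD(3,4)[OF s'(1)] s'(2)
      by (metis le_antisym)
    have "?X c \<subseteq> ?X s'"
      using c(3) Nlt_nested[OF _ t] nested_sym by blast
    moreover have "t \<in> ?X s'" "t \<notin> ?X c" using t n c(2) nested_sym[of t s'] nested_sym[of t c] by simp_all
    moreover have "finite (?X s')"
      by (rule finite_subset[OF _ finite_crossing[OF effD(5)[OF s'(1)], of k]]) (use Nlt_relevant less_imp_le in blast)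
    ultimately have "card (?X c) < card (?X s')" by (intro psubset_card_mono) auto
    then show False using m[OF c(1) oc] by simp
  qed
  then show ?thesis using s' unfolding cand_def by blast
qed

lemma N_distinguishes:
  assumes "tangle V E P" "tangle V E Q" "prod.swap t \<in> P" "t \<in> Q"
  shows "\<exists>s\<in>N. eff P Q s"
proof -
  let ?g = "\<lambda>s. prod.swap s \<in> P \<and> s \<in> Q"
  have "?g t" using assms by blast
  from ex_has_least_nat[of ?g t ord, OF this]
  obtain s where "?g s" "\<forall>u. ?g u \<longrightarrow> ord s \<le> ord u" by blast
  then have "eff P Q s" using assms unfolding eff_def by blast
  then obtain s1 where "cand (ord s) (Nlt (ord s)) P Q s1" using cand_exists by blast
  from ex_has_least_nat[of "cand (ord s) (Nlt (ord s)) P Q" s1 "\<lambda>u. card (cross (ord s) u)", OF this]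
  obtain s2 where b: "best (ord s) (Nlt (ord s)) P Q s2" unfolding best_def by blast
  then have "s2 \<in> Nlt (Suc (ord s))" by auto
  then show ?thesis using b unfolding N_def best_def cand_def by blast
qed

end

section \<open>Chains of efficient separations\<close>

lemma finite_subset_increasing_Union:
  assumes "finite F" "F \<subseteq> (\<Union>n. A n)" "\<And>m n. m \<le> n \<Longrightarrow> A m \<subseteq> A n"
  shows "\<exists>n::nat. F \<subseteq> A n"
  using assms(1,2)
proof (induction F rule: finite_induct)
  case (insert x F)
  then obtain m n where "x \<in> A m" "F \<subseteq> A n" by blast
  then have "insert x F \<subseteq> A (max m n)" using assms(3)[of m "max m n"] assms(3)[of n "max m n"] by auto
  then show ?case by blast
qed auto

context lf_graph
begin

text \<open>Joining r with t discards the separator vertices strictly on the small side of t and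
  adds at most \<open>ord t\<close> new ones, but \<open>eff_join\<close> forbids the order to
  drop.\<close>

lemma eff_linked:
  assumes "eff P Q r" "t \<in> Q"
  shows "card (fst r \<inter> snd r \<inter> (fst t - snd t)) \<le> ord t"
proof -
  let ?Z = "fst r \<inter> snd r" and ?T = "fst t - snd t"
  note R = effD[OF assms(1)]
  have fin: "finite ?Z" "finite (fst t \<inter> snd t)"
    using R(5) tangle_fsep[OF R(2) assms(2)] by (auto simp: fsep_def)
  have "card ?Z \<le> card ((fst r \<union> fst t) \<inter> (snd r \<inter> snd t))"
    using eff_join(1)[OF assms] by (simp add: ord_def join_def)
  also have "\<dots> \<le> card ((?Z - ?T) \<union> (fst t \<inter> snd t))" using fin by (intro card_mono) auto
  also have "\<dots> \<le> card (?Z - ?T) + ord t" unfolding ord_def by (rule card_Un_le)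
  finally have "card ?Z \<le> card (?Z - ?T) + ord t" .
  moreover have "card ?Z = card (?Z - ?T) + card (?Z \<inter> ?T)"
    using card_Un_disjoint[of "?Z - ?T" "?Z \<inter> ?T"] fin by (simp add: Un_Diff_Int disjoint_iff)
  ultimately show ?thesis by simp
qed

text \<open>The orders along the sequence may be unbounded. An empty intersection means that no
  member of \<open>N\<close> bounds the sequence from above, since second sides of members are
  nonempty.\<close>

lemma relevant_chain_inter_empty:
  assumes no_thick: "\<forall>\<epsilon>\<in>ends V E. \<not> thick_end \<epsilon>"
    and rel: "\<And>n. relevant (f n)"
    and le: "\<And>n. osep_le (f n) (f (Suc n))" and neq: "\<And>n. f n \<noteq> f (Suc n)"
  shows "(\<Inter>n. snd (f n)) = {}"
proof -
  define A where "A n = fst (f n)" for n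
  define B where "B n = snd (f n)" for n
  define As where "As = (\<Union>n. A n)"
  define Bs where "Bs = (\<Inter>n. B n)"
  define W where "W = As \<inter> Bs"
  have fAB: "f n = (A n, B n)" for n by (simp add: A_def B_def)
  have A_mono: "A m \<subseteq> A n" if "m \<le> n" for m n
    using that by (rule lift_Suc_mono_le[of A, rotated]) (use le in \<open>auto simp: A_def osep_le_def\<close>)
  have B_mono: "B n \<subseteq> B m" if "m \<le> n" for m n
    using that by (rule lift_Suc_antimono_le[of B, rotated]) (use le in \<open>auto simp: B_def osep_le_def\<close>)
  have sep: "separation V E (A n) (B n)" and finZ: "finite (A n \<inter> B n)" for n
    using relevant_fsep[OF rel[of n]] by (auto simp: fsep_def A_def B_def)
  have ABV: "A n \<union> B n = V" for n using sep unfolding separation_def by blast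
  have A_As: "A n \<subseteq> As" and Bs_B: "Bs \<subseteq> B n" for n by (auto simp: As_def Bs_def)
  have U: "As \<union> Bs = V"
  proof
    show "As \<union> Bs \<subseteq> V" using ABV unfolding As_def Bs_def by blast
    show "V \<subseteq> As \<union> Bs" using ABV unfolding As_def Bs_def by blast
  qed
  have sepW: "separation V E As Bs"
  proof (rule separationI[OF U])
    fix u v assume uv: "E u v" "u \<in> As - Bs" "v \<in> Bs - As"
    then obtain m n where "u \<in> A m" "u \<notin> B n" unfolding As_def Bs_def by blast
    then have "u \<in> A (max m n)" "u \<notin> B (max m n)" using A_mono[of m "max m n"] B_mono[of n "max m n"] by auto
    then show False using separation_edge[OF sep uv(1), of "max m n"] uv(3) unfolding As_def by blast
  qed
  have W_A: "\<exists>n. F \<subseteq> A n" if "finite F" "F \<subseteq> As" for F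
    using finite_subset_increasing_Union[of F A] that A_mono unfolding As_def by blast
  have fin: "finite W"
  proof (rule ccontr)
    assume inf: "infinite W"
    have "\<exists>\<epsilon>\<in>ends V E. thick_end \<epsilon>"
    proof (rule concentrated_imp_thick_end[OF _ inf])
      show "W \<subseteq> V" using U unfolding W_def by blast
      fix X Y U U' assume h: "separation V E X Y" "finite (X \<inter> Y)" "finite U" "finite U'"
        "U \<subseteq> W \<inter> (X - Y)" "U' \<subseteq> W \<inter> (Y - X)" "card (X \<inter> Y) < card U" "card (X \<inter> Y) < card U'"
      \<comment> \<open>For late n both finite sets lie in the separator of \<open>f n\<close>, so
        \<open>Q\<close> must orient \<open>X\<close> and \<open>Y\<close>;
        \<open>eff_linked\<close> bounds the separator vertices on whichever side it calls
        small.\<close>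
      have "U \<union> U' \<subseteq> As" using h(5,6) unfolding W_def by blast
      then obtain n where n: "U \<union> U' \<subseteq> A n" using W_A h(3,4) by blast
      have sub: "U \<subseteq> A n \<inter> B n" "U' \<subseteq> A n \<inter> B n" using n h(5,6) Bs_B[of n] unfolding W_def by blast+
      obtain P Q where e: "eff P Q (f n)" using rel[of n] unfolding relevant_def by blast
      note R = effD[OF e]
      have "card U \<le> ord (f n)" using card_mono[OF finZ[of n] sub(1)] by (simp add: ord_def A_def B_def)
      then have "ord (X, Y) \<le> ord (f n)" using h(7) by (simp add: ord_def)
      moreover have "fsep (X, Y)" using h(1,2) by (simp add: fsep_def)
      ultimately have "(X, Y) \<in> Q \<or> (Y, X) \<in> Q" using tangle_orient[OF R(2,4)] by fastforce
      then show False
      proof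
        assume "(X, Y) \<in> Q"
        then have "card (A n \<inter> B n \<inter> (X - Y)) \<le> card (X \<inter> Y)"
          using eff_linked[OF e, of "(X, Y)"] by (simp add: ord_def A_def B_def)
        moreover have "card U \<le> card (A n \<inter> B n \<inter> (X - Y))" using sub h(5) finZ[of n] by (intro card_mono) auto
        ultimately show False using h(7) by simp
      next
        assume "(Y, X) \<in> Q"
        then have "card (A n \<inter> B n \<inter> (Y - X)) \<le> card (X \<inter> Y)"
          using eff_linked[OF e, of "(Y, X)"] by (simp add: ord_def A_def B_def Int_commute)
        moreover have "card U' \<le> card (A n \<inter> B n \<inter> (Y - X))" using sub h(6) finZ[of n] by (intro card_mono) auto
        ultimately show False using h(8) by simp
      qed
    qed
    then show False using no_thick by blast
  qed
  have "W = {}"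
  proof (rule ccontr)
    assume Wne: "W \<noteq> {}"
    have WV: "W \<subseteq> V" using U unfolding W_def by blast
    \<comment> \<open>Neighbours are included so that from stage n on no edge leads from
      \<open>W\<close> into the part of \<open>As\<close> outside \<open>A m\<close>.\<close>
    have "finite (W \<union> (nbrs W \<inter> As))" using fin finite_nbrs[OF fin WV] by blast
    then obtain n where n: "W \<union> (nbrs W \<inter> As) \<subseteq> A n" using W_A[of "W \<union> (nbrs W \<inter> As)"] unfolding W_def by blast
    have eqW: "A m \<inter> B m = W" if "n \<le> m" for m
    proof -
      have WA: "W \<subseteq> A m" and NA: "nbrs W \<inter> As \<subseteq> A m" using n A_mono[OF that] by auto
      then have WZ: "W \<subseteq> A m \<inter> B m" using Bs_B[of m] unfolding W_def by blast
      obtain P Q where e: "eff P Q (f m)" using rel[of m] unfolding relevant_def by blast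
      note R = effD[OF e]
      have ordf: "ord (f m) = card (A m \<inter> B m)" by (simp add: ord_def A_def B_def)
      have fst_f: "fst (f m) = A m" "fst (prod.swap (f m)) = B m" by (simp_all add: A_def B_def)
      \<comment> \<open>\<open>Y\<close> is the region between \<open>f m\<close> and the supremum,
        without \<open>W\<close>. The separator of \<open>(X, Y)\<close> is that of
        \<open>f m\<close> minus \<open>W\<close>, so its order is smaller and efficiency of
        \<open>f m\<close> makes \<open>Y\<close> small for \<open>Q\<close>.\<close>
      define X where "X = A m \<union> Bs"
      define Y where "Y = (B m \<inter> As) - W"
      have int: "X \<inter> Y = (A m \<inter> B m) - W" using A_As[of m] unfolding X_def Y_def W_def by blast
      have in_BAs: "u \<in> A m \<and> v \<in> A m \<or> u \<in> Bs \<and> v \<in> Bs \<or> u \<in> Y \<and> v \<in> Y" if "E u v" for u v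
      proof -
        have "u \<in> A m \<and> v \<in> A m \<or> u \<in> B m \<and> v \<in> B m" by (rule separation_edge[OF sep that])
        moreover have "u \<in> As \<and> v \<in> As \<or> u \<in> Bs \<and> v \<in> Bs" by (rule separation_edge[OF sepW that])
        moreover have "u \<in> W \<Longrightarrow> v \<in> As \<Longrightarrow> u \<in> A m \<and> v \<in> A m" using WA NA that unfolding nbrs_def by blast
        moreover have "v \<in> W \<Longrightarrow> u \<in> As \<Longrightarrow> u \<in> A m \<and> v \<in> A m" using WA NA E_sym[OF that] unfolding nbrs_def by blast
        ultimately show ?thesis unfolding Y_def by blast
      qed
      have XYV: "X \<union> Y = V" using U ABV[of m] unfolding X_def Y_def W_def by blast
      have "separation V E X Y"
      proof (rule separationI[OF XYV])
        fix u v assume "E u v" "u \<in> X - Y" "v \<in> Y - X"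
        then show False using in_BAs[of u v] unfolding X_def by blast
      qed
      then have fXY: "fsep (X, Y)" using finZ[of m] int by (simp add: fsep_def)
      have lt: "ord (X, Y) < ord (f m)"
        unfolding ord_def[of "(X, Y)"] ordf fst_conv snd_conv int using WZ Wne finZ[of m] by (intro psubset_card_mono) auto
      have "(X, Y) \<notin> Q"
      proof
        assume q: "(X, Y) \<in> Q"
        have "prod.swap (X, Y) \<in> P"
        proof (rule tangle_down[OF R(1) R(3) _ _ R(3)])
          show "fsep (prod.swap (X, Y))" using fXY by (simp only: fsep_swap)
          show "ord (prod.swap (X, Y)) \<le> ord (prod.swap (f m))" using lt by (simp only: ord_swap)
          show "fst (prod.swap (X, Y)) \<subseteq> fst (prod.swap (f m))" unfolding fst_f by (auto simp: Y_def)
        qed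
        then show False using R(6)[OF _ q] lt by simp
      qed
      then have YQ: "(Y, X) \<in> Q" using tangle_orient[OF R(2,4) fXY] lt by simp
      have fW: "fsep (As, Bs)" using sepW fin by (simp add: fsep_def W_def)
      have ordW: "ord (As, Bs) = card W" by (simp add: ord_def W_def)
      have leW: "ord (As, Bs) \<le> ord (f m)" unfolding ordW ordf by (rule card_mono[OF finZ WZ])
      \<comment> \<open>Otherwise the small sides \<open>A m\<close>, \<open>Bs\<close> and
        \<open>Y\<close> would cover the graph. So the supremum distinguishes \<open>P\<close> from
        \<open>Q\<close>, and its order \<open>card W\<close> is at least that of
        \<open>f m\<close>.\<close>
      have "(Bs, As) \<notin> Q"
      proof
        assume q: "(Bs, As) \<in> Q"
        have "covers3 V E (fst (f m)) (fst (Bs, As)) (fst (Y, X))"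
          unfolding covers3_def fst_conv fst_f using XYV in_BAs unfolding X_def by auto
        then show False using tangle_cover[OF R(2) R(4) q YQ] by blast
      qed
      then have WQ: "(As, Bs) \<in> Q" using tangle_orient[OF R(2,4) fW leW] by simp
      have "prod.swap (As, Bs) \<in> P"
      proof (rule tangle_down[OF R(1) R(3) _ _ R(3)])
        show "fsep (prod.swap (As, Bs))" using fW by (simp only: fsep_swap)
        show "ord (prod.swap (As, Bs)) \<le> ord (prod.swap (f m))" using leW by (simp only: ord_swap)
        show "fst (prod.swap (As, Bs)) \<subseteq> fst (prod.swap (f m))" unfolding fst_f using Bs_B by auto
      qed
      then have "card (A m \<inter> B m) \<le> card W" using R(6)[OF _ WQ] unfolding ordf ordW by blast
      then show ?thesis using card_seteq[OF finZ WZ] by simp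
    qed
    have e1: "A n \<inter> B n = W" and e2: "A (Suc n) \<inter> B (Suc n) = W" using eqW by auto
    \<comment> \<open>Two consecutive separations with the same separator \<open>W\<close> differ by
      a set without edges to the rest, because all neighbours of \<open>W\<close> in
      \<open>As\<close> lie in \<open>A n\<close> already.\<close>
    let ?U = "A (Suc n) - A n"
    have "?U = V"
    proof (rule connected_closed)
      show "?U \<noteq> {}"
      proof
        assume "?U = {}"
        then have "A (Suc n) = A n" using A_mono[of n "Suc n"] by auto
        moreover have "B (Suc n) = B n" using calculation e1 e2 ABV[of n] ABV[of "Suc n"] by blast
        ultimately show False using neq[of n] fAB by simp
      qed
      show "?U \<subseteq> V" using ABV[of "Suc n"] by blast
      fix u v assume u: "u \<in> ?U" "E u v"
      have v: "v \<in> A (Suc n)" "v \<in> B n"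
        using separation_edge[OF sep u(2), of "Suc n"] separation_edge[OF sep u(2), of n] u(1) e1 e2 by blast+
      have "v \<notin> W"
      proof
        assume "v \<in> W"
        then have "u \<in> nbrs W" using E_sym[OF u(2)] unfolding nbrs_def by blast
        then show False using n u(1) A_As[of "Suc n"] by blast
      qed
      then show "v \<in> ?U" using v e1 by blast
    qed
    then show False using Wne WV n by blast
  qed
  have "As = V"
  proof (rule connected_closed)
    show "As \<noteq> {}" using relevant_nonempty(1)[OF rel[of 0]] A_As[of 0] unfolding A_def by blast
    show "As \<subseteq> V" using U by blast
    show "v \<in> As" if "u \<in> As" "E u v" for u v
      using separation_edge[OF sepW that(2)] that(1) \<open>W = {}\<close> unfolding W_def by blast
  qed
  then have "Bs = {}" using \<open>W = {}\<close> U unfolding W_def by blast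
  then show ?thesis unfolding Bs_def B_def .
qed

end

section \<open>The tree\<close>

lemma gpath_Cons: "gpath E (x # q) \<longleftrightarrow> q = [] \<or> (x \<notin> set q \<and> E x (hd q) \<and> gpath E q)"
  unfolding gpath_alt by (cases q) auto

locale thin_graph = lf_graph +
  assumes no_thick: "\<forall>\<epsilon>\<in>ends V E. \<not> thick_end \<epsilon>"
begin

lemma N_regular: "s \<in> N \<Longrightarrow> \<not> osep_le s (prod.swap s)" "s \<in> N \<Longrightarrow> \<not> osep_le (prod.swap s) s"
  using relevant_regular N_relevant by blast+

lemma N_swap_iff [simp]: "prod.swap s \<in> N \<longleftrightarrow> s \<in> N"
  using N_swap[of s] N_swap[of "prod.swap s"] by auto

text \<open>Otherwise there is a strictly increasing sequence in \<open>Q\<close> whose second sides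
  all contain the nonempty set \<open>U\<close>.\<close>

lemma N_maximal:
  assumes "U \<noteq> {}" "Q \<noteq> {}" "\<And>t. t \<in> Q \<Longrightarrow> t \<in> N \<and> U \<subseteq> snd t"
  shows "\<exists>m\<in>Q. \<forall>t\<in>Q. osep_le m t \<longrightarrow> t = m"
proof -
  let ?r = "{(t, s). s \<in> Q \<and> t \<in> Q \<and> osep_le s t \<and> s \<noteq> t}"
  have "wf ?r"
    unfolding wf_iff_no_infinite_down_chain
  proof
    assume "\<exists>f. \<forall>i. (f (Suc i), f i) \<in> ?r"
    then obtain f where f: "\<And>i. (f (Suc i), f i) \<in> ?r" by blast
    have "(\<Inter>n. snd (f n)) = {}"
      by (rule relevant_chain_inter_empty[OF no_thick]) (use f assms(3) N_relevant in blast)+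
    moreover have "U \<subseteq> snd (f n)" for n using f[of n] assms(3) by blast
    ultimately show False using assms(1) by blast
  qed
  moreover obtain q where "q \<in> Q" using assms(2) by blast
  ultimately obtain m where "m \<in> Q" "\<And>y. (y, m) \<in> ?r \<Longrightarrow> y \<notin> Q" by (rule wfE_min) blast
  then show ?thesis by blast
qed

lemma N_maximal_below:
  assumes "s \<in> N" "Q \<noteq> {}" "\<And>t. t \<in> Q \<Longrightarrow> t \<in> N \<and> osep_le t s"
  shows "\<exists>m\<in>Q. \<forall>t\<in>Q. osep_le m t \<longrightarrow> t = m"
  by (rule N_maximal[of "snd s"])
    (use assms relevant_nonempty(2)[OF N_relevant] in \<open>auto simp: osep_le_def\<close>)

lemma N_minimal_above:
  assumes "s \<in> N" "Q \<noteq> {}" "\<And>t. t \<in> Q \<Longrightarrow> t \<in> N \<and> osep_le s t"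
  shows "\<exists>m\<in>Q. \<forall>t\<in>Q. osep_le t m \<longrightarrow> t = m"
proof -
  have "\<exists>m\<in>prod.swap ` Q. \<forall>t\<in>prod.swap ` Q. osep_le m t \<longrightarrow> t = m"
  proof (rule N_maximal_below[of "prod.swap s"])
    fix t assume "t \<in> prod.swap ` Q"
    then obtain u where "u \<in> Q" "t = prod.swap u" by blast
    then show "t \<in> N \<and> osep_le t (prod.swap s)" using assms(3)[of u] osep_le_swap(1)[of u s] by simp
  qed (simp_all add: assms(1,2))
  then obtain m where m: "m \<in> Q" "\<forall>t\<in>prod.swap ` Q. osep_le (prod.swap m) t \<longrightarrow> t = prod.swap m" by blast
  have "t = m" if "t \<in> Q" "osep_le t m" for t
  proof -
    have "prod.swap t = prod.swap m" using m(2) that osep_le_swap(1)[of m t] by blast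
    then show ?thesis by (metis swap_swap)
  qed
  then show ?thesis using m(1) by blast
qed

text \<open>The other two ways of being nested would put r below its own reverse, or the reverse of
  s below s.\<close>

lemma N_comparable:
  assumes "r \<in> N" "s \<in> N" "t \<in> N" "u \<in> N" "osep_le r t" "osep_le r u" "osep_le t s" "osep_le u s"
  shows "osep_le t u \<or> osep_le u t"
proof -
  have "\<not> osep_le t (prod.swap u)"
    using N_regular(1)[OF assms(1)] osep_le_trans assms osep_le_swap(1) by blast
  moreover have "\<not> osep_le (prod.swap t) u"
    using N_regular(2)[OF assms(2)] osep_le_trans assms osep_le_swap(1) by blast
  ultimately show ?thesis using N_nested[OF assms(3,4)] unfolding nested_iff by blast
qed

section \<open>Finiteness of intervals\<close>

definition interval :: "'a set \<times> 'a set \<Rightarrow> 'a set \<times> 'a set \<Rightarrow> ('a set \<times> 'a set) set" where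
  "interval r s = {t \<in> N. osep_le r t \<and> osep_le t s}"

text \<open>Take t minimal with an infinite interval from r to t, and u maximal strictly below t. By
  comparability the interval up to t is the interval up to u plus t, so u contradicts the minimality
  of t.\<close>

lemma interval_finite:
  assumes "r \<in> N" "s \<in> N"
  shows "finite (interval r s)"
proof (rule ccontr)
  assume inf: "infinite (interval r s)"
  let ?Q = "{t \<in> interval r s. infinite (interval r t)}"
  obtain q where q: "q \<in> interval r s" using inf infinite_imp_nonempty by blast
  then have "s \<in> interval r s"
    using osep_le_trans osep_le_refl[of s] assms unfolding interval_def by blast
  then have "?Q \<noteq> {}" using inf by blast
  then obtain t where t: "t \<in> ?Q" and tmin: "\<And>u. u \<in> ?Q \<Longrightarrow> osep_le u t \<Longrightarrow> u = t"
    using N_minimal_above[OF assms(1), of ?Q] unfolding interval_def by blast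
  have tN: "t \<in> N" "osep_le r t" "osep_le t s" using t unfolding interval_def by blast+
  let ?Q' = "interval r t - {t}"
  have ne: "?Q' \<noteq> {}"
  proof
    assume "?Q' = {}"
    then have "interval r t \<subseteq> {t}" by blast
    then show False using t finite_subset by blast
  qed
  obtain u where u: "u \<in> ?Q'" and umax: "\<And>x. x \<in> ?Q' \<Longrightarrow> osep_le u x \<Longrightarrow> x = u"
    using N_maximal_below[OF tN(1) ne] unfolding interval_def by blast
  have uN: "u \<in> N" "osep_le r u" "osep_le u t" "u \<noteq> t" using u unfolding interval_def by blast+
  have "interval r t \<subseteq> insert t (interval r u)"
  proof
    fix x assume x: "x \<in> interval r t"
    then have xN: "x \<in> N" "osep_le r x" "osep_le x t" unfolding interval_def by blast+
    show "x \<in> insert t (interval r u)"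
    proof (cases "x = t")
      case False
      have "osep_le x u \<or> osep_le u x" using N_comparable[OF assms(1) tN(1) xN(1) uN(1)] xN uN by blast
      then have "osep_le x u" using umax[of x] x False osep_le_refl[of u] by blast
      then show ?thesis using xN unfolding interval_def by blast
    qed simp
  qed
  then have "infinite (interval r u)" using t finite_subset by blast
  then have "u \<in> ?Q" using uN tN osep_le_trans unfolding interval_def by blast
  then show False using tmin uN by blast
qed

text \<open>The consistent orientation of \<open>N\<close> in which m is a maximal element, that is,
  the end of the tree edge m towards which m points. Excluding the reverse of m makes the two ends
  of this edge differ.\<close>

definition node :: "'a set \<times> 'a set \<Rightarrow> ('a set \<times> 'a set) set" where
  "node m = {s \<in> N. osep_le s m \<or> (osep_le s (prod.swap m) \<and> s \<noteq> prod.swap m)}"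

text \<open>For empty \<open>N\<close> the tree is one vertex, the empty orientation, whose bag is
  \<open>V\<close>.\<close>

definition TV :: "('a set \<times> 'a set) set set" where
  "TV = (if N = {} then {{}} else node ` N)"

definition TE :: "('a set \<times> 'a set) set \<Rightarrow> ('a set \<times> 'a set) set \<Rightarrow> bool" where
  "TE x y \<longleftrightarrow> (\<exists>m\<in>N. x = node m \<and> y = node (prod.swap m))"

definition bags :: "('a set \<times> 'a set) set \<Rightarrow> 'a set" where
  "bags t = {v \<in> V. \<forall>s\<in>t. v \<in> snd s}"

lemma node_self: "m \<in> N \<Longrightarrow> m \<in> node m"
  by (simp add: node_def osep_le_refl)

lemma node_total: "m \<in> N \<Longrightarrow> s \<in> N \<Longrightarrow> s \<in> node m \<or> prod.swap s \<in> node m"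
proof -
  assume ms: "m \<in> N" "s \<in> N"
  consider "osep_le s m" | "osep_le s (prod.swap m)" | "osep_le (prod.swap s) m" | "osep_le (prod.swap s) (prod.swap m)"
    using N_nested[OF ms(2,1)] unfolding nested_def by blast
  then show ?thesis
  proof cases
    case 2
    then show ?thesis using ms node_self[OF ms(1)] unfolding node_def by (cases "s = prod.swap m") auto
  next
    case 4
    show ?thesis
    proof (cases "s = m")
      case False
      then have "prod.swap s \<noteq> prod.swap m" by (metis swap_swap)
      then show ?thesis using 4 ms unfolding node_def by simp
    qed (use node_self[OF ms(1)] in simp)
  qed (use ms in \<open>auto simp: node_def\<close>)
qed

lemma node_excl: "m \<in> N \<Longrightarrow> s \<in> node m \<Longrightarrow> prod.swap s \<notin> node m"
proof
  assume m: "m \<in> N" and s: "s \<in> node m" and s': "prod.swap s \<in> node m"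
  have a: "osep_le s m \<or> (osep_le s (prod.swap m) \<and> s \<noteq> prod.swap m)" using s unfolding node_def by blast
  have b: "osep_le (prod.swap m) s \<or> (osep_le m s \<and> s \<noteq> m)"
    using s' osep_le_swap(2)[of s m] osep_le_swap(1)[of s m] unfolding node_def by auto
  show False using a b N_regular[OF m] osep_le_trans osep_le_antisym by metis
qed

lemma node_down: "m \<in> N \<Longrightarrow> s \<in> node m \<Longrightarrow> t \<in> N \<Longrightarrow> osep_le t s \<Longrightarrow> t \<in> node m"
  unfolding node_def using osep_le_trans osep_le_antisym by blast

lemma node_N: "node m \<subseteq> N"
  unfolding node_def by blast

lemma node_eqI: "m \<in> N \<Longrightarrow> n \<in> N \<Longrightarrow> node m \<subseteq> node n \<Longrightarrow> node m = node n"
  using node_total[of m] node_excl[of n] node_N by blast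

lemma node_maximal: "m \<in> N \<Longrightarrow> t \<in> node m \<Longrightarrow> osep_le m t \<Longrightarrow> t = m"
  unfolding node_def using N_regular osep_le_trans osep_le_antisym by blast

text \<open>An orientation is recovered from any of its maximal elements: each member t is nested
  with s, and consistency and maximality leave only positions that put t into
  \<open>node s\<close>.\<close>

lemma node_eq_maximal:
  assumes m: "m \<in> N" and s: "s \<in> node m" and max: "\<And>t. t \<in> node m \<Longrightarrow> osep_le s t \<Longrightarrow> t = s"
  shows "node m = node s"
proof (rule node_eqI[OF m])
  show sN: "s \<in> N" using s node_N by blast
  show "node m \<subseteq> node s"
  proof
    fix t assume t: "t \<in> node m"
    then have tN: "t \<in> N" using node_N by blast
    have "t \<noteq> prod.swap s" using node_excl[OF m s] t by blast
    moreover have "\<not> osep_le (prod.swap t) s" using node_down[OF m s] node_excl[OF m t] tN N_swap by blast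
    moreover have "osep_le t s" if "osep_le s t" using max[OF t that] osep_le_refl by blast
    ultimately show "t \<in> node s" using N_nested[OF tN sN] tN unfolding nested_iff node_def by blast
  qed
qed

text \<open>The members of \<open>node a\<close> above s all lie below a, or all below its reverse;
  being bounded by a member of \<open>N\<close>, they have a maximal element.\<close>

lemma node_top:
  assumes a: "a \<in> N" and s: "s \<in> node a"
  shows "\<exists>m\<in>node a. osep_le s m \<and> (\<forall>t\<in>node a. osep_le m t \<longrightarrow> t = m)"
proof -
  let ?Q = "{t \<in> node a. osep_le s t}"
  have sN: "s \<in> N" using s node_N by blast
  have not_both: "\<not> (osep_le s a \<and> osep_le s (prod.swap a))"
    using N_regular(1)[OF sN] osep_le_trans osep_le_swap(3) by blast
  have "\<exists>c\<in>N. \<forall>t\<in>?Q. osep_le t c"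
  proof (cases "osep_le s a")
    case True
    then have "\<forall>t\<in>?Q. osep_le t a" using not_both osep_le_trans unfolding node_def by blast
    then show ?thesis using a by blast
  next
    case False
    then have "\<forall>t\<in>?Q. osep_le t (prod.swap a)" using osep_le_trans unfolding node_def by blast
    then show ?thesis using a N_swap by blast
  qed
  then obtain c where c: "c \<in> N" "\<And>t. t \<in> ?Q \<Longrightarrow> osep_le t c" by blast
  have "?Q \<noteq> {}" using s osep_le_refl by blast
  from N_maximal_below[OF c(1) this] obtain m where m: "m \<in> ?Q" "\<And>t. t \<in> ?Q \<Longrightarrow> osep_le m t \<Longrightarrow> t = m"
    using c(2) node_N by blast
  then show ?thesis using osep_le_trans by blast
qed

text \<open>The separations oriented differently at two nodes form a chain: the edges of the path
  between the nodes. The other nested positions would force one node to contain both orientations of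
  some separation.\<close>

lemma node_diff_comparable:
  assumes "a \<in> N" "b \<in> N" "s \<in> node a - node b" "t \<in> node a - node b"
  shows "osep_le s t \<or> osep_le t s"
proof -
  have N: "s \<in> N" "t \<in> N" using assms node_N by blast+
  have sb: "prod.swap s \<in> node b" using node_total[OF assms(2) N(1)] assms(3) by blast
  have "\<not> osep_le s (prod.swap t)"
    using node_down[OF assms(2) sb N(2)] assms(4) osep_le_swap(3)[of s t] by blast
  moreover have "\<not> osep_le (prod.swap s) t"
    using node_down[OF assms(1), of t "prod.swap s"] assms(3,4) node_excl[OF assms(1)] N N_swap by blast
  ultimately show ?thesis using N_nested[OF N] unfolding nested_iff by blast
qed

lemma node_diff_top:
  assumes "a \<in> N" "b \<in> N" "node a - node b \<noteq> {}"
  shows "\<exists>m\<in>node a - node b. node a = node m \<and> (\<forall>s\<in>node a - node b. osep_le s m)"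
proof -
  obtain s0 where s0: "s0 \<in> node a - node b" using assms(3) by blast
  obtain m where m: "m \<in> node a" "osep_le s0 m" "\<And>t. t \<in> node a \<Longrightarrow> osep_le m t \<Longrightarrow> t = m"
    using node_top[OF assms(1), of s0] s0 by blast
  have mD: "m \<in> node a - node b" using m(1,2) s0 node_down[OF assms(2), of m s0] node_N by blast
  have "osep_le s m" if s: "s \<in> node a - node b" for s
    using node_diff_comparable[OF assms(1,2) s mD] m(3) s osep_le_refl by blast
  moreover have "node a = node m" by (rule node_eq_maximal[OF assms(1) m(1)]) (rule m(3))
  ultimately show ?thesis using mD by blast
qed

text \<open>The chain has a largest element, and so has the opposite difference; reversed, the
  latter bounds the chain from below. So the chain lies in an interval of \<open>N\<close>.\<close>

lemma node_diff_finite: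
  assumes "a \<in> N" "b \<in> N"
  shows "finite (node a - node b)"
proof (cases "node a - node b = {}")
  case False
  then obtain s0 where s0: "s0 \<in> node a - node b" by blast
  have sw: "prod.swap s \<in> node b - node a" if "s \<in> node a - node b" for s
    using that node_total[OF assms(2), of s] node_excl[OF assms(1), of s] node_N by blast
  obtain m where m: "m \<in> node a - node b" "\<And>s. s \<in> node a - node b \<Longrightarrow> osep_le s m"
    using node_diff_top[OF assms False] by blast
  have "node b - node a \<noteq> {}" using sw s0 by blast
  from node_diff_top[OF assms(2,1) this]
  obtain m' where m': "m' \<in> node b - node a" "\<And>s. s \<in> node b - node a \<Longrightarrow> osep_le s m'" by blast
  have "node a - node b \<subseteq> interval (prod.swap m') m"
  proof
    fix s assume s: "s \<in> node a - node b"
    have "osep_le (prod.swap m') s" using m'(2)[OF sw[OF s]] osep_le_swap(2) by blast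
    then show "s \<in> interval (prod.swap m') m" using m(2)[OF s] s node_N unfolding interval_def by blast
  qed
  moreover have "finite (interval (prod.swap m') m)" using interval_finite m m' node_N N_swap by blast
  ultimately show ?thesis by (rule finite_subset)
qed (simp only: finite.emptyI)

text \<open>Crossing a tree edge flips just one separation, so a step towards \<open>node b\<close>
  removes one element from the difference.\<close>

lemma node_swap: "m \<in> N \<Longrightarrow> node (prod.swap m) = insert (prod.swap m) (node m - {m})"
proof -
  assume m: "m \<in> N"
  have "m \<noteq> prod.swap m" using N_regular(1)[OF m] osep_le_refl[of m] by metis
  moreover have "\<not> osep_le m (prod.swap m)" "\<not> osep_le (prod.swap m) m" using N_regular[OF m] by blast+
  ultimately show ?thesis using m unfolding node_def by (auto simp: osep_le_refl simp del: swap_simp)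
qed

section \<open>Paths in the tree\<close>

lemma TV_node: "N \<noteq> {} \<Longrightarrow> x \<in> TV \<Longrightarrow> \<exists>a\<in>N. x = node a"
  unfolding TV_def by auto

lemma node_TV: "m \<in> N \<Longrightarrow> node m \<in> TV"
  unfolding TV_def by auto

lemma TE_TV: "TE x y \<Longrightarrow> x \<in> TV \<and> y \<in> TV \<and> x \<noteq> y \<and> TE y x"
proof -
  assume "TE x y"
  then obtain m where m: "m \<in> N" "x = node m" "y = node (prod.swap m)" unfolding TE_def by blast
  have "x \<noteq> y" using node_self[OF m(1)] node_excl[of "prod.swap m" "prod.swap m"] node_self[of "prod.swap m"] N_swap[OF m(1)] m by auto
  moreover have "TE y x" unfolding TE_def using m N_swap[OF m(1)] by (intro bexI[of _ "prod.swap m"]) auto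
  ultimately show ?thesis using node_TV[OF m(1)] node_TV[OF N_swap[OF m(1)]] m by simp
qed

text \<open>Induction on the number of disagreements: flipping the largest one is a step along an
  edge. The inclusion in the conclusion keeps the new first node off the rest of the path, and later
  yields that the bags of the two ends meet inside every bag on the path.\<close>

lemma tree_path_exists:
  assumes "b \<in> N"
  shows "a \<in> N \<Longrightarrow> \<exists>p. tpath TE (node a) (node b) p \<and> (\<forall>z\<in>set p. z \<in> TV \<and> z - node b \<subseteq> node a - node b)"
proof (induction "card (node a - node b)" arbitrary: a)
  case 0
  then have "node a - node b = {}" using node_diff_finite[OF 0(2) assms] by simp
  then have "node a = node b" using node_eqI[OF 0(2) assms] by blast
  then show ?case using node_TV[OF assms] by (intro exI[of _ "[node a]"]) (auto simp: tpath_def gpath_def)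
next
  case (Suc n)
  then have "card (node a - node b) \<noteq> 0" by simp
  then have "node a - node b \<noteq> {}" by (metis card.empty)
  from node_diff_top[OF Suc(3) assms this] obtain m where m: "m \<in> node a - node b" "node a = node m" by blast
  have mN: "m \<in> N" "prod.swap m \<in> N" using m node_N N_swap by blast+
  have smb: "prod.swap m \<in> node b" using node_total[OF assms mN(1)] m by blast
  have d: "node (prod.swap m) - node b = (node a - node b) - {m}"
    unfolding node_swap[OF mN(1)] m(2) using smb by auto
  have "n = card (node (prod.swap m) - node b)"
    unfolding d using Suc(2) m node_diff_finite[OF Suc(3) assms] by simp
  from Suc(1)[OF this mN(2)] obtain p where p: "tpath TE (node (prod.swap m)) (node b) p"
    "\<forall>z\<in>set p. z \<in> TV \<and> z - node b \<subseteq> node (prod.swap m) - node b" by blast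
  have "node a \<notin> set p" using p(2) m(1) unfolding d by blast
  moreover have "TE (node a) (node (prod.swap m))" unfolding TE_def using m mN by blast
  ultimately have "tpath TE (node a) (node b) (node a # p)"
    using p(1) gpath_def[of TE p] unfolding tpath_def gpath_Cons by auto
  moreover have "\<forall>z\<in>set (node a # p). z \<in> TV \<and> z - node b \<subseteq> node a - node b"
    using p(2) node_TV[OF Suc(3)] unfolding d by auto
  ultimately show ?case by blast
qed

text \<open>The only step that can add m to an orientation is the edge into \<open>node m\<close>,
  and the walk avoids that node.\<close>

lemma no_return:
  assumes m: "m \<in> N"
  shows "successively TE q \<Longrightarrow> node m \<notin> set q \<Longrightarrow> q \<noteq> [] \<Longrightarrow> m \<notin> hd q \<Longrightarrow> z \<in> set q \<Longrightarrow> m \<notin> z"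
proof (induction q)
  case (Cons x q)
  show ?case
  proof (cases "q = []")
    case False
    then have "TE x (hd q)" "successively TE q" using Cons.prems(1) by (cases q; auto)+
    then obtain k where k: "k \<in> N" "x = node k" "hd q = node (prod.swap k)" unfolding TE_def by blast
    have "m \<notin> hd q"
    proof
      assume "m \<in> hd q"
      then have "m = prod.swap k" using Cons.prems(4) unfolding k(3) node_swap[OF k(1)] k(2)[symmetric] by auto
      then have "node m = hd q" using k by simp
      then show False using Cons.prems(2) False by auto
    qed
    then show ?thesis using Cons False \<open>successively TE q\<close> by auto
  qed (use Cons.prems in auto)
qed simp

text \<open>A path never returns to its first node \<open>node m\<close>, so m stays lost once
  flipped; hence the first edge of a path to \<open>node b\<close> must be one on which the ends
  disagree.\<close>

lemma first_step:
  assumes p: "gpath TE (x # q)" "q \<noteq> []" "last q = node b" and b: "b \<in> N"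
  shows "\<exists>m\<in>x - node b. m \<in> N \<and> x = node m \<and> hd q = node (prod.swap m)"
proof -
  have q: "x \<notin> set q" "TE x (hd q)" "successively TE q" using p(1,2) unfolding gpath_Cons by (auto simp: gpath_alt)
  then obtain m where m: "m \<in> N" "x = node m" "hd q = node (prod.swap m)" unfolding TE_def by blast
  have "m \<notin> hd q" using m(3) node_excl[of "prod.swap m" "prod.swap m"] node_self[of "prod.swap m"] N_swap[OF m(1)] by auto
  then have "m \<notin> node b" using no_return[OF m(1) q(3) _ p(2)] q(1) m(2) p(2,3) last_in_set by metis
  then show ?thesis using m node_self by blast
qed

text \<open>Both are maximal in the same orientation, and as disagreements with
  \<open>node b\<close> they are comparable.\<close>

lemma first_step_unique:
  assumes "b \<in> N" "m \<in> N" "k \<in> N" "node m = node k" "m \<notin> node b" "k \<notin> node b"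
  shows "m = k"
proof -
  have "m \<in> node m - node b" "k \<in> node m - node b" using assms node_self[of m] node_self[of k] by auto
  from node_diff_comparable[OF assms(2,1) this] show ?thesis
    using node_maximal[OF assms(2), of k] node_maximal[OF assms(3), of m] node_self[of m] node_self[of k] assms by auto
qed

lemma tree_path_unique:
  assumes b: "b \<in> N"
  shows "tpath TE x (node b) p \<Longrightarrow> tpath TE x (node b) q \<Longrightarrow> p = q"
proof (induction p arbitrary: x q)
  case (Cons y p)
  then have [simp]: "y = x" by (simp add: tpath_def)
  obtain q' where q: "q = x # q'" using Cons.prems(2) by (cases q) (auto simp: tpath_def gpath_def)
  have g: "gpath TE (x # p)" "gpath TE (x # q')" "last (x # p) = node b" "last (x # q') = node b"
    using Cons.prems q by (auto simp: tpath_def)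
  have single: "r = []" if "gpath TE (x # r)" "last (x # r) = x" for r
    using that last_in_set[of r] unfolding gpath_Cons by (auto split: if_splits)
  show ?case
  proof (cases "x = node b")
    case True
    have "p = []" "q' = []"
      by (rule single[OF g(1) trans[OF g(3) True[symmetric]]], rule single[OF g(2) trans[OF g(4) True[symmetric]]])
    then show ?thesis using q by simp
  next
    case False
    then have ne: "p \<noteq> []" "q' \<noteq> []" using g(3,4) by auto
    obtain m where m: "m \<in> x - node b" "m \<in> N" "x = node m" "hd p = node (prod.swap m)"
      using first_step[OF g(1) ne(1) _ b] g(3) ne by auto
    obtain k where k: "k \<in> x - node b" "k \<in> N" "x = node k" "hd q' = node (prod.swap k)"
      using first_step[OF g(2) ne(2) _ b] g(4) ne by auto
    have "m = k"
      by (rule first_step_unique[OF b m(2) k(2) trans[OF m(3)[symmetric] k(3)]]) (use m(1) k(1) in blast)+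
    then have "hd q' = hd p" using m(4) k(4) by simp
    then have "tpath TE (hd p) (node b) p" "tpath TE (hd p) (node b) q'"
      using g ne unfolding tpath_def gpath_Cons by simp_all
    then show ?thesis using Cons.IH q by simp
  qed
qed (simp add: tpath_def gpath_def)

lemma TV_empty: "N = {} \<Longrightarrow> TV = {{}}" "N = {} \<Longrightarrow> \<not> TE x y"
  by (auto simp: TV_def TE_def)

lemma tpath_no_edges:
  assumes "\<And>x y. \<not> R x y"
  shows "tpath R x y p \<longleftrightarrow> p = [x] \<and> x = y"
  using assms by (cases p) (auto simp: tpath_def gpath_Cons gpath_def[of R "[]"])

lemma TV_path:
  assumes "x \<in> TV" "y \<in> TV"
  shows "\<exists>!p. tpath TE x y p" "\<And>z. z \<in> set (tree_path TE x y) \<Longrightarrow> z \<in> TV \<and> z - y \<subseteq> x - y"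
    "tpath TE x y (tree_path TE x y)"
proof -
  have "\<exists>p. tpath TE x y p \<and> (\<forall>z\<in>set p. z \<in> TV \<and> z - y \<subseteq> x - y) \<and> (\<forall>q. tpath TE x y q \<longrightarrow> q = p)"
  proof (cases "N = {}")
    case True
    then have "x = {}" "y = {}" using assms TV_empty by auto
    then show ?thesis using tpath_no_edges[of TE] TV_empty[OF True] by (intro exI[of _ "[x]"]) auto
  next
    case False
    obtain a b where ab: "a \<in> N" "x = node a" "b \<in> N" "y = node b" using TV_node[OF False] assms by metis
    then show ?thesis using tree_path_exists[OF ab(3) ab(1)] tree_path_unique[OF ab(3), of x] by blast
  qed
  then obtain p where p: "tpath TE x y p" "\<And>z. z \<in> set p \<Longrightarrow> z \<in> TV \<and> z - y \<subseteq> x - y" "\<And>q. tpath TE x y q \<Longrightarrow> q = p" by blast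
  then have "tree_path TE x y = p" unfolding tree_path_def by blast
  then show "\<exists>!p. tpath TE x y p" "\<And>z. z \<in> set (tree_path TE x y) \<Longrightarrow> z \<in> TV \<and> z - y \<subseteq> x - y"
    "tpath TE x y (tree_path TE x y)" using p by blast+
qed

lemma is_tree_TV: "is_tree TV TE"
  unfolding is_tree_def graph_def
  using TV_path(1) TE_TV by (auto simp: TV_def)

text \<open>Choose m maximal above s with \<open>U\<close> on its second side. A member t of
  \<open>node m\<close> pointing away from \<open>U\<close> would have its reverse strictly above m,
  still pointing to \<open>U\<close>. Used for single vertices and for edges.\<close>

lemma bag_covers:
  assumes U: "U \<subseteq> V" "U \<noteq> {}" and sep: "\<And>s. s \<in> N \<Longrightarrow> U \<subseteq> fst s \<or> U \<subseteq> snd s" and s: "s \<in> N" "U \<subseteq> snd s"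
  shows "\<exists>t\<in>TV. s \<in> t \<and> U \<subseteq> bags t"
proof -
  let ?Q = "{t \<in> N. U \<subseteq> snd t \<and> osep_le s t}"
  have "s \<in> ?Q" using s osep_le_refl by blast
  then obtain m where m: "m \<in> ?Q" "\<And>t. t \<in> ?Q \<Longrightarrow> osep_le m t \<Longrightarrow> t = m"
    using N_maximal[OF U(2), of ?Q] by blast
  have mN: "m \<in> N" "U \<subseteq> snd m" "osep_le s m" using m by blast+
  have "U \<subseteq> snd t" if t: "t \<in> node m" for t
  proof (rule ccontr)
    assume n: "\<not> U \<subseteq> snd t"
    have tN: "t \<in> N" using t node_N by blast
    then have Ut: "U \<subseteq> snd (prod.swap t)" using sep[OF tN] n by simp
    have "\<not> osep_le t m" using mN n unfolding osep_le_def by blast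
    then have h: "osep_le t (prod.swap m)" "t \<noteq> prod.swap m" using t unfolding node_def by blast+
    then have mt: "osep_le m (prod.swap t)" using osep_le_swap(3) by blast
    then have "prod.swap t \<in> ?Q" using Ut tN N_swap mN(3) osep_le_trans by blast
    then show False using m(2) mt h(2) by (metis swap_swap)
  qed
  then have "U \<subseteq> bags (node m)" using U unfolding bags_def by blast
  moreover have "s \<in> node m" using s(1) mN unfolding node_def by blast
  ultimately show ?thesis using node_TV[OF mN(1)] by blast
qed

lemma bag_covers_edge_or_vertex:
  assumes "U \<subseteq> V" "U \<noteq> {}" "\<And>s. s \<in> N \<Longrightarrow> U \<subseteq> fst s \<or> U \<subseteq> snd s"
  shows "\<exists>t\<in>TV. U \<subseteq> bags t"
proof (cases "N = {}")
  case True
  then show ?thesis using assms TV_empty by (auto simp: bags_def)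
next
  case False
  then obtain s where s: "s \<in> N" by blast
  then have "\<exists>s\<in>N. U \<subseteq> snd s" using assms(3)[OF s] N_swap[OF s] by (metis snd_swap)
  then show ?thesis using bag_covers[OF assms] by blast
qed

section \<open>The tree-decomposition and its induced separations\<close>

lemma N_separation: "s \<in> N \<Longrightarrow> separation V E (fst s) (snd s)"
  using relevant_fsep N_relevant unfolding fsep_def by blast

lemma N_union: "s \<in> N \<Longrightarrow> fst s \<union> snd s = V"
  using N_separation unfolding separation_def by blast

lemma tree_decomp_TV: "tree_decomp V E TV TE bags"
  unfolding tree_decomp_def
proof (intro conjI ballI allI impI)
  show "is_tree TV TE" by (rule is_tree_TV)
  show "bags t \<subseteq> V" for t by (auto simp: bags_def)
  have "v \<in> (\<Union>t\<in>TV. bags t)" if "v \<in> V" for v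
    using bag_covers_edge_or_vertex[of "{v}"] that N_union by blast
  then show "(\<Union>t\<in>TV. bags t) = V" by (auto simp: bags_def)
  show "\<exists>t\<in>TV. u \<in> bags t \<and> v \<in> bags t" if "E u v" for u v
    using bag_covers_edge_or_vertex[of "{u, v}"] separation_edge[OF N_separation that] E_V[OF that] by auto
  show "bags x \<inter> bags y \<subseteq> bags z" if "x \<in> TV" "y \<in> TV" "z \<in> set (tree_path TE x y)" for x y z
    using TV_path(2)[OF that] unfolding bags_def by blast
qed

text \<open>If t lacks m, the first step of the path from \<open>node m\<close> to t flips m. If t
  contains m, every node on the path is contained in \<open>node m \<union> t\<close>, which omits
  the reverse of m.\<close>

lemma tree_side_TV:
  assumes m: "m \<in> N"
  shows "tree_side TV TE (node m) (node (prod.swap m)) = {t \<in> TV. m \<in> t}"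
proof -
  have "node (prod.swap m) \<notin> set (tree_path TE (node m) t) \<longleftrightarrow> m \<in> t" if t: "t \<in> TV" for t
  proof -
    have ne: "N \<noteq> {}" using m by blast
    obtain b where b: "b \<in> N" "t = node b" using TV_node[OF ne t] by blast
    note P = TV_path[OF node_TV[OF m] t]
    show ?thesis
    proof
      assume n: "node (prod.swap m) \<notin> set (tree_path TE (node m) t)"
      show "m \<in> t"
      proof (rule ccontr)
        assume mt: "m \<notin> t"
        have "node m \<noteq> t" using mt node_self[OF m] by blast
        then obtain q where q: "tree_path TE (node m) t = node m # q" "q \<noteq> []"
          using P(3) unfolding tpath_def gpath_def 
          by (cases "tree_path TE (node m) t") (auto split: if_splits)
        obtain k where k: "k \<in> node m - node b" "k \<in> N" "node m = node k" "hd q = node (prod.swap k)"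
          using first_step[of "node m" q b] P(3) q b unfolding tpath_def by auto
        have "m = k" using first_step_unique[OF b(1) m k(2,3)] mt b k by blast
        then show False using n q k(4) by (metis hd_in_set list.set_intros(2))
      qed
    next
      assume mt: "m \<in> t"
      show "node (prod.swap m) \<notin> set (tree_path TE (node m) t)"
      proof
        assume "node (prod.swap m) \<in> set (tree_path TE (node m) t)"
        then have "node (prod.swap m) \<subseteq> node m \<union> t" using P(2) by blast
        then have "prod.swap m \<in> node m \<union> t" using node_self[of "prod.swap m"] N_swap[OF m] by blast
        then show False using node_excl[OF m node_self[OF m]] node_excl[OF b(1), of m] mt b by blast
      qed
    qed
  qed
  then show ?thesis unfolding tree_side_def by blast
qed

lemma tree_side_bags: "m \<in> N \<Longrightarrow> (\<Union>t\<in>{t \<in> TV. m \<in> t}. bags t) = snd m"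
proof
  assume m: "m \<in> N"
  show "(\<Union>t\<in>{t \<in> TV. m \<in> t}. bags t) \<subseteq> snd m" by (auto simp: bags_def)
  show "snd m \<subseteq> (\<Union>t\<in>{t \<in> TV. m \<in> t}. bags t)"
  proof
    fix v assume v: "v \<in> snd m"
    then have "v \<in> V" using N_union[OF m] by blast
    then have "\<exists>t\<in>TV. m \<in> t \<and> {v} \<subseteq> bags t" using v m N_union by (intro bag_covers) blast+
    then show "v \<in> (\<Union>t\<in>{t \<in> TV. m \<in> t}. bags t)" by blast
  qed
qed

text \<open>The sides come out exchanged: the nodes on the side of \<open>node m\<close> contain m,
  so their bags lie in \<open>snd m\<close>.\<close>

lemma induced_sep_TV: "m \<in> N \<Longrightarrow> induced_sep TV TE bags (node m) (node (prod.swap m)) = (snd m, fst m)"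
  using tree_side_TV[of m] tree_side_TV[of "prod.swap m"] tree_side_bags[of m] tree_side_bags[of "prod.swap m"] N_swap[of m]
  unfolding induced_sep_def by simp

text \<open>Passes from the unordered notion to the oriented one: a tangle never contains both
  orientations, so two distinguished tangles contain opposite ones.\<close>

lemma tangle_distinguishes:
  assumes "tangle V E P" "tangle V E Q" "distinguishes V E P Q A B"
  shows "\<exists>t. prod.swap t \<in> P \<and> t \<in> Q \<and> fst t \<inter> snd t = A \<inter> B"
proof -
  have "\<not> ((A, B) \<in> P \<and> (B, A) \<in> P)" "\<not> ((A, B) \<in> Q \<and> (B, A) \<in> Q)"
    using tangle_not_both[OF assms(1), of "(A, B)"] tangle_not_both[OF assms(2), of "(A, B)"] by auto
  then have "(A, B) \<in> P \<and> (B, A) \<in> Q \<or> (B, A) \<in> P \<and> (A, B) \<in> Q"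
    using assms(3) unfolding distinguishes_def by blast
  then show ?thesis
    by (elim disjE) (rule exI[of _ "(B, A)"], simp add: Int_commute, rule exI[of _ "(A, B)"], simp)
qed

lemma eff_eff_distinguishes:
  assumes "eff P Q s"
  shows "eff_distinguishes V E P Q (snd s) (fst s)"
  unfolding eff_distinguishes_def
proof (intro conjI allI impI)
  note S = effD[OF assms]
  have "fsep (prod.swap s)" using S(5) by simp
  then show "distinguishes V E P Q (snd s) (fst s)"
  proof -
    have "(snd s, fst s) \<in> P" "(fst s, snd s) \<notin> P" "(fst s, snd s) \<in> Q"
      using S(3,4) tangle_not_both[OF S(1) S(3)] by (simp_all add: prod.swap_def)
    moreover have "separation V E (snd s) (fst s)" using \<open>fsep (prod.swap s)\<close> by (simp add: fsep_def)
    ultimately show ?thesis unfolding distinguishes_def by blast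
  qed
  fix C D assume "distinguishes V E P Q C D"
  then obtain t where t: "prod.swap t \<in> P" "t \<in> Q" "fst t \<inter> snd t = C \<inter> D"
    using tangle_distinguishes[OF S(1,2)] by blast
  then show "sep_order (snd s) (fst s) \<le> sep_order C D"
    using S(6)[OF t(1,2)] S(5) tangle_fsep[OF S(2) t(2)] unfolding sep_order_def fsep_def ord_def
    by (simp add: Int_commute)
qed

lemma eff_distinguishes_all_TV: "eff_distinguishes_all_tangles V E TV TE bags"
  unfolding eff_distinguishes_all_tangles_def
proof (intro allI impI)
  fix P Q assume h: "tangle V E P \<and> tangle V E Q \<and> (\<exists>A B. distinguishes V E P Q A B)"
  then obtain t where "prod.swap t \<in> P" "t \<in> Q" using tangle_distinguishes by blast
  then obtain s where s: "s \<in> N" "eff P Q s" using N_distinguishes h by blast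
  have "TE (node s) (node (prod.swap s))" unfolding TE_def using s by blast
  then show "\<exists>x y. TE x y \<and> eff_distinguishes V E P Q (fst (induced_sep TV TE bags x y)) (snd (induced_sep TV TE bags x y))"
    using eff_eff_distinguishes[OF s(2)] induced_sep_TV[OF s(1)] by (metis fst_conv snd_conv)
qed

end

section \<open>Automorphisms\<close>

definition act :: "('a \<Rightarrow> 'a) \<Rightarrow> 'a set \<times> 'a set \<Rightarrow> 'a set \<times> 'a set" where
  "act \<phi> s = (\<phi> ` fst s, \<phi> ` snd s)"

lemma act_swap: "act \<phi> (prod.swap s) = prod.swap (act \<phi> s)"
  by (simp add: act_def)

lemma act_comp: "act (\<phi> \<circ> \<psi>) s = act \<phi> (act \<psi> s)"
  by (simp add: act_def image_comp)

lemma act_inv: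
  assumes "bij \<phi>"
  shows "act \<phi> (act (inv \<phi>) s) = s" "act (inv \<phi>) (act \<phi> s) = s"
  using assms by (simp_all add: act_def image_f_inv_f bij_is_surj image_inv_f_f bij_is_inj)

lemma act_inj: "bij \<phi> \<Longrightarrow> act \<phi> s = act \<phi> t \<longleftrightarrow> s = t"
  by (metis act_inv(2))

lemma act_osep_le: "bij \<phi> \<Longrightarrow> osep_le (act \<phi> r) (act \<phi> s) = osep_le r s"
  by (simp add: osep_le_def act_def inj_image_subset_iff bij_is_inj)

lemma act_nested: "bij \<phi> \<Longrightarrow> nested (act \<phi> r) (act \<phi> s) = nested r s"
  unfolding nested_def act_swap[symmetric] by (simp only: act_osep_le)

lemma act_inter: "bij \<phi> \<Longrightarrow> fst (act \<phi> s) \<inter> snd (act \<phi> s) = \<phi> ` (fst s \<inter> snd s)"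
  by (simp add: act_def image_Int bij_is_inj)

lemma act_ord: "bij \<phi> \<Longrightarrow> ord (act \<phi> s) = ord s"
  unfolding ord_def act_inter by (rule card_image[OF inj_on_subset[OF bij_is_inj subset_UNIV]])

lemma act_sep_order: "bij \<phi> \<Longrightarrow> sep_order (\<phi> ` A) (\<phi> ` B) = sep_order A B"
proof -
  assume b: "bij \<phi>"
  have i: "inj_on \<phi> (A \<inter> B)" using b bij_is_inj inj_on_subset by blast
  have "\<phi> ` A \<inter> \<phi> ` B = \<phi> ` (A \<inter> B)" using b by (simp add: image_Int bij_is_inj)
  then show ?thesis using finite_image_iff[OF i] card_image[OF i] by (simp add: sep_order_def)
qed

context lf_graph
begin

lemma aut_V: "graph_aut V E \<phi> \<Longrightarrow> \<phi> ` V = V"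
  unfolding graph_aut_def bij_betw_def by blast

lemma aut_mem: "graph_aut V E \<phi> \<Longrightarrow> \<phi> v \<in> V \<longleftrightarrow> v \<in> V"
  using aut_V[of \<phi>] unfolding graph_aut_def by (cases "v \<in> V") auto

text \<open>Automorphisms fix everything outside \<open>V\<close>, so they are bijections of the
  whole type and \<open>inv\<close> may be used.\<close>

lemma aut_bij: "graph_aut V E \<phi> \<Longrightarrow> bij \<phi>"
proof (rule bijI)
  assume a: "graph_aut V E \<phi>"
  have out: "\<phi> x = x" if "x \<notin> V" for x using a that unfolding graph_aut_def by blast
  have "inj_on \<phi> V" using a unfolding graph_aut_def bij_betw_def by blast
  then show "inj \<phi>" using aut_mem[OF a] out by (metis injI inj_onD)
  show "surj \<phi>" unfolding surj_def using aut_V[OF a] out by (metis imageE)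
qed

lemma aut_E: "graph_aut V E \<phi> \<Longrightarrow> E (\<phi> u) (\<phi> v) \<longleftrightarrow> E u v"
  using aut_mem[of \<phi> u] aut_mem[of \<phi> v] E_V[of u v] E_V[of "\<phi> u" "\<phi> v"] unfolding graph_aut_def by blast

lemma aut_inv: "graph_aut V E \<phi> \<Longrightarrow> graph_aut V E (inv \<phi>)"
proof -
  assume a: "graph_aut V E \<phi>"
  have b: "bij \<phi>" by (rule aut_bij[OF a])
  have f: "\<phi> (inv \<phi> x) = x" for x using b by (simp add: bij_is_surj surj_f_inv_f)
  have V: "inv \<phi> x \<in> V \<longleftrightarrow> x \<in> V" for x using aut_mem[OF a, of "inv \<phi> x"] f by simp
  show ?thesis unfolding graph_aut_def
  proof (intro conjI allI impI ballI)
    show "bij_betw (inv \<phi>) V V"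
      unfolding bij_betw_def
    proof
      show "inj_on (inv \<phi>) V" using f by (metis inj_onI)
      show "inv \<phi> ` V = V" using V aut_mem[OF a] b by (metis (no_types, lifting) aut_V[OF a] bij_is_inj image_inv_f_f)
    qed
    show "inv \<phi> x = x" if "x \<notin> V" for x
    proof -
      have "\<phi> x = x" using a that unfolding graph_aut_def by blast
      then show ?thesis using b by (metis bij_is_inj inv_f_f)
    qed
    show "E u v = E (inv \<phi> u) (inv \<phi> v)" for u v using aut_E[OF a, of "inv \<phi> u" "inv \<phi> v"] f by simp
  qed
qed

lemma aut_separation:
  assumes a: "graph_aut V E \<phi>" and s: "separation V E A B"
  shows "separation V E (\<phi> ` A) (\<phi> ` B)"
proof (rule separationI)
  have i: "inj \<phi>" using aut_bij[OF a] bij_is_inj by blast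
  show "\<phi> ` A \<union> \<phi> ` B = V" using s aut_V[OF a] unfolding separation_def by (metis image_Un)
  fix u v assume uv: "E u v" "u \<in> \<phi> ` A - \<phi> ` B" "v \<in> \<phi> ` B - \<phi> ` A"
  then obtain u' v' where "u = \<phi> u'" "v = \<phi> v'" "u' \<in> A - B" "v' \<in> B - A" by blast
  then show False using uv(1) aut_E[OF a] s unfolding separation_def by metis
qed

lemma aut_covers3:
  assumes a: "graph_aut V E \<phi>" and c: "covers3 V E (\<phi> ` A) (\<phi> ` B) (\<phi> ` C)"
  shows "covers3 V E A B C"
proof -
  have i: "inj \<phi>" using aut_bij[OF a] bij_is_inj by blast
  have "\<phi> ` (A \<union> B \<union> C) = \<phi> ` V" using c aut_V[OF a] unfolding covers3_def by (simp add: image_Un)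
  then have "A \<union> B \<union> C = V" by (simp only: inj_image_eq_iff[OF i])
  moreover have "u \<in> A \<and> v \<in> A \<or> u \<in> B \<and> v \<in> B \<or> u \<in> C \<and> v \<in> C" if "E u v" for u v
  proof -
    have "E (\<phi> u) (\<phi> v)" using aut_E[OF a] that by blast
    then have "\<phi> u \<in> \<phi> ` A \<and> \<phi> v \<in> \<phi> ` A \<or> \<phi> u \<in> \<phi> ` B \<and> \<phi> v \<in> \<phi> ` B \<or> \<phi> u \<in> \<phi> ` C \<and> \<phi> v \<in> \<phi> ` C"
      using c unfolding covers3_def by metis
    then show ?thesis by (simp only: inj_image_mem_iff[OF i])
  qed
  ultimately show ?thesis unfolding covers3_def by blast
qed

lemma act_pair: "(A, B) \<in> act \<phi> ` P \<longleftrightarrow> (\<exists>A' B'. (A', B') \<in> P \<and> A = \<phi> ` A' \<and> B = \<phi> ` B')"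
proof
  assume "(A, B) \<in> act \<phi> ` P"
  then obtain s where "s \<in> P" "(A, B) = act \<phi> s" by blast
  then show "\<exists>A' B'. (A', B') \<in> P \<and> A = \<phi> ` A' \<and> B = \<phi> ` B'"
    by (intro exI[of _ "fst s"] exI[of _ "snd s"]) (simp add: act_def)
next
  assume "\<exists>A' B'. (A', B') \<in> P \<and> A = \<phi> ` A' \<and> B = \<phi> ` B'"
  then obtain A' B' where "(A', B') \<in> P" "(A, B) = act \<phi> (A', B')" by (auto simp: act_def)
  then show "(A, B) \<in> act \<phi> ` P" by (metis imageI)
qed

lemma aut_tangle:
  assumes a: "graph_aut V E \<phi>" and P: "tangle V E P"
  shows "tangle V E (act \<phi> ` P)"
proof -
  have b: "bij \<phi>" by (rule aut_bij[OF a])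
  have inj: "inj (act \<phi>)" using act_inj[OF b] by (meson injI)
  obtain k :: enat where k: "\<And>A B. separation V E A B \<Longrightarrow> sep_order A B < k \<Longrightarrow> card (P \<inter> {(A, B), (B, A)}) = 1"
      "\<And>A B. (A, B) \<in> P \<Longrightarrow> separation V E A B \<and> sep_order A B < k" "consistent P"
    using P unfolding tangle_def pre_tangle_def by blast
  have 1: "card (act \<phi> ` P \<inter> {(A, B), (B, A)}) = 1" if h: "separation V E A B" "sep_order A B < k" for A B
  proof -
    let ?A = "inv \<phi> ` A" and ?B = "inv \<phi> ` B"
    have s: "separation V E ?A ?B" by (rule aut_separation[OF aut_inv[OF a] h(1)])
    have o: "sep_order ?A ?B < k" using h(2) act_sep_order[OF bij_imp_bij_inv[OF b]] by simp
    have e: "\<phi> ` ?A = A" "\<phi> ` ?B = B" using b by (simp_all add: image_f_inv_f bij_is_surj)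
    have "{(A, B), (B, A)} = act \<phi> ` {(?A, ?B), (?B, ?A)}" unfolding act_def by (simp only: image_insert image_empty fst_conv snd_conv e)
    then have "act \<phi> ` P \<inter> {(A, B), (B, A)} = act \<phi> ` (P \<inter> {(?A, ?B), (?B, ?A)})" by (simp only: image_Int[OF inj])
    then have "card (act \<phi> ` P \<inter> {(A, B), (B, A)}) = card (P \<inter> {(?A, ?B), (?B, ?A)})"
      using card_image[OF inj_on_subset[OF inj subset_UNIV]] by metis
    then show ?thesis using k(1)[OF s o] by simp
  qed
  have 2: "separation V E A B \<and> sep_order A B < k" if "(A, B) \<in> act \<phi> ` P" for A B
    using that k(2) aut_separation[OF a] act_sep_order[OF b] unfolding act_pair by auto
  have 3: "consistent (act \<phi> ` P)"
    unfolding consistent_def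
  proof
    assume "\<exists>A B C D. (A, B) \<in> act \<phi> ` P \<and> (C, D) \<in> act \<phi> ` P \<and> {A, B} \<noteq> {C, D} \<and> osep_le (B, A) (C, D)"
    then obtain A' B' C' D' where h': "(A', B') \<in> act \<phi> ` P" "(C', D') \<in> act \<phi> ` P" "{A', B'} \<noteq> {C', D'}"
      "osep_le (B', A') (C', D')" by (elim exE conjE)
    obtain A B where AB: "(A, B) \<in> P" "A' = \<phi> ` A" "B' = \<phi> ` B" using h'(1) unfolding act_pair by blast
    obtain C D where CD: "(C, D) \<in> P" "C' = \<phi> ` C" "D' = \<phi> ` D" using h'(2) unfolding act_pair by blast
    have h: "(A, B) \<in> P" "(C, D) \<in> P" "{\<phi> ` A, \<phi> ` B} \<noteq> {\<phi> ` C, \<phi> ` D}"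
      "osep_le (\<phi> ` B, \<phi> ` A) (\<phi> ` C, \<phi> ` D)" using AB CD h'(3,4) by simp_all
    have "{A, B} \<noteq> {C, D}"
    proof
      assume "{A, B} = {C, D}"
      then have "(\<lambda>X. \<phi> ` X) ` {A, B} = (\<lambda>X. \<phi> ` X) ` {C, D}" by simp
      then show False using h(3) by simp
    qed
    moreover have "osep_le (B, A) (C, D)" using h(4) act_osep_le[OF b, of "(B, A)" "(C, D)"] by (simp add: act_def)
    ultimately show False using k(3) h(1,2) unfolding consistent_def by blast
  qed
  have 4: "\<not> covers3 V E A1 A2 A3" if h: "(A1, B1) \<in> act \<phi> ` P" "(A2, B2) \<in> act \<phi> ` P" "(A3, B3) \<in> act \<phi> ` P" for A1 B1 A2 B2 A3 B3
  proof
    assume c: "covers3 V E A1 A2 A3"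
    obtain A1' B1' where 1: "(A1', B1') \<in> P" "A1 = \<phi> ` A1'" using h(1) unfolding act_pair by blast
    obtain A2' B2' where 2: "(A2', B2') \<in> P" "A2 = \<phi> ` A2'" using h(2) unfolding act_pair by blast
    obtain A3' B3' where 3: "(A3', B3') \<in> P" "A3 = \<phi> ` A3'" using h(3) unfolding act_pair by blast
    have "covers3 V E A1' A2' A3'" by (rule aut_covers3[OF a]) (use c 1(2) 2(2) 3(2) in simp)
    then show False using tangle_cover[OF P 1(1) 2(1) 3(1)] by simp
  qed
  have "pre_tangle V E (act \<phi> ` P)" unfolding pre_tangle_def using 1 2 3 by (intro exI[of _ k]) simp
  then show ?thesis unfolding tangle_def
    by (intro conjI allI impI) (assumption, elim conjE, rule 4)
qed

lemma aut_eff: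
  assumes a: "graph_aut V E \<phi>" and e: "eff P Q s"
  shows "eff (act \<phi> ` P) (act \<phi> ` Q) (act \<phi> s)"
proof -
  have b: "bij \<phi>" by (rule aut_bij[OF a])
  have inj: "inj (act \<phi>)" using act_inj[OF b] by (meson injI)
  note S = effD[OF e]
  show ?thesis unfolding eff_def
  proof (intro conjI allI impI)
    show "tangle V E (act \<phi> ` P)" "tangle V E (act \<phi> ` Q)" using aut_tangle[OF a] S(1,2) by blast+
    show "prod.swap (act \<phi> s) \<in> act \<phi> ` P" using S(3) unfolding act_swap[symmetric] by blast
    show "act \<phi> s \<in> act \<phi> ` Q" using S(4) by blast
    fix t assume t: "prod.swap t \<in> act \<phi> ` P \<and> t \<in> act \<phi> ` Q"
    then obtain t' where t': "t' \<in> Q" "t = act \<phi> t'" by blast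
    have "act \<phi> (prod.swap t') \<in> act \<phi> ` P" using t t'(2) act_swap by metis
    then have "prod.swap t' \<in> P" by (simp only: inj_image_mem_iff[OF inj])
    then show "ord (act \<phi> s) \<le> ord t" using S(6)[of t'] t' act_ord[OF b] by simp
  qed
qed

lemma aut_relevant: "graph_aut V E \<phi> \<Longrightarrow> relevant s \<Longrightarrow> relevant (act \<phi> s)"
  unfolding relevant_def by (elim exE) (intro exI, erule (1) aut_eff)

lemma aut_cross:
  assumes a: "graph_aut V E \<phi>"
  shows "card (cross k (act \<phi> s)) = card (cross k s)"
proof -
  have b: "bij \<phi>" by (rule aut_bij[OF a])
  have inj: "inj (act \<phi>)" using act_inj[OF b] by (meson injI)
  have "cross k (act \<phi> s) = act \<phi> ` cross k s"
  proof
    show "act \<phi> ` cross k s \<subseteq> cross k (act \<phi> s)"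
    proof
      fix t assume "t \<in> act \<phi> ` cross k s"
      then obtain u where "u \<in> cross k s" "t = act \<phi> u" by blast
      then show "t \<in> cross k (act \<phi> s)"
        using aut_relevant[OF a, of u] act_ord[OF b, of u] act_nested[OF b, of s u] unfolding cross_def by simp
    qed
    show "cross k (act \<phi> s) \<subseteq> act \<phi> ` cross k s"
    proof
      fix t assume t: "t \<in> cross k (act \<phi> s)"
      let ?t = "act (inv \<phi>) t"
      have e: "t = act \<phi> ?t" by (rule act_inv(1)[OF b, symmetric])
      have "relevant ?t" using t aut_relevant[OF aut_inv[OF a]] unfolding cross_def by blast
      moreover have "ord ?t = k" using t act_ord[OF b, of ?t, unfolded act_inv(1)[OF b]] unfolding cross_def by simp
      moreover have "\<not> nested s ?t" 
        using t act_nested[OF b, of s ?t, unfolded act_inv(1)[OF b]] unfolding cross_def by simp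
      ultimately show "t \<in> act \<phi> ` cross k s" using e unfolding cross_def by blast
    qed
  qed
  then show ?thesis using card_image[OF inj_on_subset[OF inj subset_UNIV]] by simp
qed

lemma aut_cand:
  assumes a: "graph_aut V E \<phi>" and M: "\<And>t. t \<in> M \<Longrightarrow> act (inv \<phi>) t \<in> M" and c: "cand k M P Q s"
  shows "cand k M (act \<phi> ` P) (act \<phi> ` Q) (act \<phi> s)"
proof -
  have b: "bij \<phi>" by (rule aut_bij[OF a])
  have "nested t (act \<phi> s)" if t: "t \<in> M" for t
  proof -
    have "nested (act (inv \<phi>) t) s" using c M[OF t] unfolding cand_def by blast
    then show ?thesis using act_nested[OF b, of "act (inv \<phi>) t" s] act_inv(1)[OF b] by simp
  qed
  then show ?thesis using c aut_eff[OF a] act_ord[OF b] unfolding cand_def by simp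
qed

text \<open>Competitors for the image pair are pulled back along the inverse automorphism, which
  preserves crossing numbers.\<close>

lemma aut_best:
  assumes a: "graph_aut V E \<phi>" and M: "\<And>\<psi> t. graph_aut V E \<psi> \<Longrightarrow> t \<in> M \<Longrightarrow> act \<psi> t \<in> M" and c: "best k M P Q s"
  shows "best k M (act \<phi> ` P) (act \<phi> ` Q) (act \<phi> s)"
  unfolding best_def
proof (intro conjI allI impI)
  have b: "bij \<phi>" by (rule aut_bij[OF a])
  have a': "graph_aut V E (inv \<phi>)" by (rule aut_inv[OF a])
  have ii: "inv (inv \<phi>) = \<phi>" using b by (simp add: inv_inv_eq)
  show "cand k M (act \<phi> ` P) (act \<phi> ` Q) (act \<phi> s)"
    by (rule aut_cand[OF a]) (use c M[OF a'] in \<open>auto simp: best_def\<close>)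
  fix s' assume s': "cand k M (act \<phi> ` P) (act \<phi> ` Q) s'"
  have im: "act (inv \<phi>) ` act \<phi> ` X = X" for X :: "('a set \<times> 'a set) set"
    unfolding image_image act_inv(2)[OF b] by simp
  have "cand k M (act (inv \<phi>) ` act \<phi> ` P) (act (inv \<phi>) ` act \<phi> ` Q) (act (inv \<phi>) s')"
    by (rule aut_cand[OF a' _ s']) (use M[OF a] ii in simp)
  then have "card (cross k s) \<le> card (cross k (act (inv \<phi>) s'))" using c unfolding im best_def by blast
  then show "card (cross k (act \<phi> s)) \<le> card (cross k s')" using aut_cross[OF a] aut_cross[OF a'] by simp
qed

lemma aut_Nlt: "graph_aut V E \<phi> \<Longrightarrow> s \<in> Nlt k \<Longrightarrow> act \<phi> s \<in> Nlt k"
proof (induction k arbitrary: \<phi> s)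
  case (Suc k)
  show ?case
  proof (cases "s \<in> Nlt k")
    case True
    then show ?thesis using Suc by simp
  next
    case False
    then obtain P Q where "best k (Nlt k) P Q s" using Suc.prems by auto
    then have "best k (Nlt k) (act \<phi> ` P) (act \<phi> ` Q) (act \<phi> s)" using aut_best[OF Suc.prems(1)] Suc.IH by blast
    then show ?thesis by auto
  qed
qed simp

lemma aut_N: "graph_aut V E \<phi> \<Longrightarrow> s \<in> N \<Longrightarrow> act \<phi> s \<in> N"
  unfolding N_def by (elim UN_E) (intro UN_I[OF UNIV_I] aut_Nlt)

end

section \<open>The action on the tree\<close>

context thin_graph
begin

lemma aut_node:
  assumes a: "graph_aut V E \<phi>"
  shows "act \<phi> ` node m = node (act \<phi> m)"
proof -
  have b: "bij \<phi>" by (rule aut_bij[OF a])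
  have iff: "act \<phi> s \<in> node (act \<phi> m) \<longleftrightarrow> s \<in> node m" for s
  proof -
    have "act \<phi> s \<in> N \<longleftrightarrow> s \<in> N" 
      using aut_N[OF a, of s] aut_N[OF aut_inv[OF a], of "act \<phi> s"] unfolding act_inv(2)[OF b] by blast
    moreover have "act \<phi> s = act \<phi> (prod.swap m) \<longleftrightarrow> s = prod.swap m" by (rule act_inj[OF b])
    ultimately show ?thesis unfolding node_def mem_Collect_eq act_swap[symmetric] by (simp only: act_osep_le[OF b])
  qed
  show ?thesis
  proof
    show "act \<phi> ` node m \<subseteq> node (act \<phi> m)" using iff by blast
    show "node (act \<phi> m) \<subseteq> act \<phi> ` node m"
    proof
      fix t assume t: "t \<in> node (act \<phi> m)"
      have e: "act \<phi> (act (inv \<phi>) t) = t" by (rule act_inv(1)[OF b])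
      then have "act (inv \<phi>) t \<in> node m" using iff[of "act (inv \<phi>) t"] t by simp
      then show "t \<in> act \<phi> ` node m" using e by (metis imageI)
    qed
  qed
qed

lemma aut_TV: "graph_aut V E \<phi> \<Longrightarrow> x \<in> TV \<Longrightarrow> act \<phi> ` x \<in> TV"
proof (cases "N = {}")
  case True
  assume "x \<in> TV"
  then show ?thesis using True TV_empty by simp
next
  case False
  assume a: "graph_aut V E \<phi>" and x: "x \<in> TV"
  then obtain m where "m \<in> N" "x = node m" using TV_node[OF False] by blast
  then show ?thesis using aut_node[OF a] aut_N[OF a] node_TV by simp
qed

lemma aut_TE: "graph_aut V E \<phi> \<Longrightarrow> TE x y \<Longrightarrow> TE (act \<phi> ` x) (act \<phi> ` y)"
proof -
  assume a: "graph_aut V E \<phi>" and "TE x y"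
  then obtain m where m: "m \<in> N" "x = node m" "y = node (prod.swap m)" unfolding TE_def by blast
  have "act \<phi> ` x = node (act \<phi> m)" "act \<phi> ` y = node (prod.swap (act \<phi> m))"
    using m aut_node[OF a] act_swap[of \<phi> m] by simp_all
  then show ?thesis unfolding TE_def using aut_N[OF a m(1)] by blast
qed

lemma aut_bags:
  assumes a: "graph_aut V E \<phi>"
  shows "bags (act \<phi> ` t) = \<phi> ` bags t"
proof -
  have b: "bij \<phi>" by (rule aut_bij[OF a])
  have mem: "\<phi> v \<in> bags (act \<phi> ` t) \<longleftrightarrow> v \<in> bags t" for v
    unfolding bags_def using aut_mem[OF a] inj_image_mem_iff[OF bij_is_inj[OF b]] by (simp add: act_def)
  show ?thesis
  proof
    show "\<phi> ` bags t \<subseteq> bags (act \<phi> ` t)" using mem by blast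
    show "bags (act \<phi> ` t) \<subseteq> \<phi> ` bags t"
    proof
      fix v assume v: "v \<in> bags (act \<phi> ` t)"
      obtain u where "v = \<phi> u" using b by (meson bij_pointE)
      then show "v \<in> \<phi> ` bags t" using mem v by blast
    qed
  qed
qed

lemma canonical_TV: "canonical_td V E TV TE bags"
  unfolding canonical_td_def
\<comment> \<open>Outside \<open>TV\<close> the action has to be the identity, as
  \<open>graph_aut\<close> demands; the composition law then uses that \<open>TV\<close> is mapped
  into itself.\<close>
proof (intro exI[of _ "\<lambda>\<phi> t. if t \<in> TV then act \<phi> ` t else t"] conjI allI impI)
  fix \<phi> assume a: "graph_aut V E \<phi>"
  let ?\<alpha> = "\<lambda>t. if t \<in> TV then act \<phi> ` t else t"
  have b: "bij \<phi>" by (rule aut_bij[OF a])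
  have a': "graph_aut V E (inv \<phi>)" by (rule aut_inv[OF a])
  have im: "act (inv \<phi>) ` act \<phi> ` X = X" "act \<phi> ` act (inv \<phi>) ` X = X" for X :: "('a set \<times> 'a set) set"
    unfolding image_image act_inv[OF b] by simp_all
  show "graph_aut TV TE ?\<alpha>"
    unfolding graph_aut_def
  proof (intro conjI allI impI ballI)
    show "bij_betw ?\<alpha> TV TV"
      by (rule bij_betw_byWitness[where f' = "\<lambda>t. act (inv \<phi>) ` t"]) (use im aut_TV[OF a] aut_TV[OF a'] in auto)
    show "TE x y = TE (?\<alpha> x) (?\<alpha> y)" if "x \<in> TV" "y \<in> TV" for x y
      using aut_TE[OF a, of x y] aut_TE[OF a', of "act \<phi> ` x" "act \<phi> ` y"] that unfolding im by auto
  qed auto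
  show "\<forall>t\<in>TV. bags (?\<alpha> t) = \<phi> ` bags t" using aut_bags[OF a] by simp
next
  fix \<phi> \<psi> assume a: "graph_aut V E \<phi> \<and> graph_aut V E \<psi>"
  show "(\<lambda>t. if t \<in> TV then act (\<phi> \<circ> \<psi>) ` t else t) =
      (\<lambda>t. if t \<in> TV then act \<phi> ` t else t) \<circ> (\<lambda>t. if t \<in> TV then act \<psi> ` t else t)"
    using a aut_TV[of \<psi>] by (auto simp: fun_eq_iff act_comp image_image)
qed

end

theorem theorem1:
  fixes V :: "'a set" and E :: "'a \<Rightarrow> 'a \<Rightarrow> bool"
  assumes "graph V E" and "connected_graph V E" and "locally_finite V E"
    and "\<forall>\<epsilon>\<in>ends V E. \<not> thick_end \<epsilon>"
  shows "\<exists>(TV :: ('a set \<times> 'a set) set set) TE bags.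
           tree_decomp V E TV TE bags \<and> canonical_td V E TV TE bags \<and>
           eff_distinguishes_all_tangles V E TV TE bags"
proof -
  interpret thin_graph V E by unfold_locales (fact assms)+
  show ?thesis using tree_decomp_TV canonical_TV eff_distinguishes_all_TV by blast
qed

end
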